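(* Let $\beta>0$ and let $\mathcal{P}=\{\gamma,l^+,L,\varepsilon,C,\alpha,\xi,M\}$ be a parameter set. There exists a constant $\bar\sigma(\beta)\in(0,1)$, depending only on $\beta$ and $\mathcal{P}$ and continuous in $\beta$, such that for every $f\in\mathcal{H}(\beta,\mathcal{P})$ and every $\sigma\in(0,\bar\sigma(\beta))$ there exists a finite Gaussian mixture density $$\wp_\sigma(x)=\sum_{u=1}^{m'}p_u\,\psi_\sigma(x-\mu_u),\qquad p_u\ge 0,\ \sum_u p_u=1,$$ (all components having the same scale $\sigma$) whose number of support points $m'$ is less than $G_\beta\,\sigma^{-1}|\ln\sigma|^{3/2}$ and whose means satisfy $\mu_u\in[-\mu_\sigma,\mu_\sigma]$ with $\mu_\sigma\le \tilde G_\beta|\ln\sigma|^{1/2}$, such that $$\mathrm{KL}(f,\wp_\sigma)=\int_{\mathbb{R}}f(x)\ln\frac{f(x)}{\wp_\sigma(x)}\,dx\le c_\beta\,\sigma^{2\beta},$$ where $c_\beta>0$ is uniform over $\mathcal{H}(\beta,\mathcal{P})$ (depends only on $\beta$ and $\mathcal{P}$) and is continuous in $\beta$, and $G_\beta,\tilde G_\beta$ are positive constants depending only on $\beta$ and $\mathcal{P}$ which are increasing functions of $\beta$.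
   Context: $\psi(x)=\pi^{-1/2}e^{-x^2}$ and $\psi_\sigma(x)=\sigma^{-1}\psi(x/\sigma)$ for $\sigma>0$. For $\beta>0$, $r$ denotes the largest integer strictly less than $\beta$. A parameter set $\mathcal{P}=\{\gamma,l^+,L,\varepsilon,C,\alpha,\xi,M\}$ consists of a polynomial function $L$ on $\mathbb{R}$ and positive constants $\gamma,l^+,\varepsilon,C,\alpha,\xi,M$. The class $\mathcal{H}(\beta,\mathcal{P})$ is the set of probability densities $f$ on $\mathbb{R}$ (w.r.t. Lebesgue measure) such that: (1) (smoothness) $\ln f$ is $r$ times differentiable, for all $x,y$ with $|y-x|\le\gamma$, $|(\ln f)^{(r)}(x)-(\ln f)^{(r)}(y)|\le r!\,L(x)|y-x|^{\beta-r}$, and $|(\ln f)^{(j)}(0)|\le l^+$ for all $j\in\{0,\dots,r\}$; (2) (moments) $\int_{\mathbb{R}}|(\ln f)^{(j)}(x)|^{(2\beta+\varepsilon)/j}f(x)\,dx\le C$ for $j=1,\dots,r$ and $\int_{\mathbb{R}}|L(x)|^{2+\varepsilon/\beta}f(x)\,dx\le C$; (3) (tail) $f(x)\le M\psi(x)$ for all $x$; (4) (monotonicity) $f>0$, $f$ is nondecreasing on $(-\infty,-\alpha)$ and nonincreasing on $(\alpha,\infty)$, and $f(x)\ge\xi$ for all $x\in[-\alpha,\alpha]$. *)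

theory Defs
  imports "HOL-Analysis.Analysis" "HOL-Computational_Algebra.Polynomial"
begin

definition psi :: "real \<Rightarrow> real" where
  "psi x = exp (- (x ^ 2)) / sqrt pi"

definition psi_s :: "real \<Rightarrow> real \<Rightarrow> real" where
  "psi_s \<sigma> x = psi (x / \<sigma>) / \<sigma>"

text \<open>r = largest integer strictly less than beta (for beta > 0).\<close>
definition rr :: "real \<Rightarrow> nat" where
  "rr \<beta> = nat (\<lceil>\<beta>\<rceil> - 1)"

definition dlog :: "nat \<Rightarrow> (real \<Rightarrow> real) \<Rightarrow> real \<Rightarrow> real" where
  "dlog j f = (deriv ^^ j) (\<lambda>x. ln (f x))"

definition is_density :: "(real \<Rightarrow> real) \<Rightarrow> bool" where
  "is_density f \<longleftrightarrow> f \<in> borel_measurable borel \<and> (\<forall>x. 0 \<le> f x)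
     \<and> (\<integral>\<^sup>+ x. ennreal (f x) \<partial>lborel) = 1"

definition Hclass ::
  "real \<Rightarrow> real \<Rightarrow> real \<Rightarrow> real poly \<Rightarrow> real \<Rightarrow> real \<Rightarrow> real \<Rightarrow> real \<Rightarrow> real
     \<Rightarrow> (real \<Rightarrow> real) set" where
  "Hclass \<beta> \<gamma> lp L \<epsilon> C \<alpha> \<xi> M = {f. is_density f \<and>
     \<comment> \<open>(1) smoothness\<close>
     (\<forall>j < rr \<beta>. \<forall>x. dlog j f differentiable (at x)) \<and>
     (\<forall>x y. \<bar>y - x\<bar> \<le> \<gamma> \<longrightarrow>
        \<bar>dlog (rr \<beta>) f x - dlog (rr \<beta>) f y\<bar>
          \<le> fact (rr \<beta>) * poly L x * \<bar>y - x\<bar> powr (\<beta> - real (rr \<beta>))) \<and>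
     (\<forall>j \<le> rr \<beta>. \<bar>dlog j f 0\<bar> \<le> lp) \<and>
     \<comment> \<open>(2) moments\<close>
     (\<forall>j \<in> {1..rr \<beta>}. (\<integral>\<^sup>+ x. ennreal (\<bar>dlog j f x\<bar> powr ((2 * \<beta> + \<epsilon>) / real j) * f x) \<partial>lborel)
        \<le> ennreal C) \<and>
     (\<integral>\<^sup>+ x. ennreal (\<bar>poly L x\<bar> powr (2 + \<epsilon> / \<beta>) * f x) \<partial>lborel) \<le> ennreal C \<and>
     \<comment> \<open>(3) tail\<close>
     (\<forall>x. f x \<le> M * psi x) \<and>
     \<comment> \<open>(4) monotonicity\<close>
     (\<forall>x. 0 < f x) \<and> mono_on {..< - \<alpha>} f \<and> antimono_on {\<alpha> <..} f \<and>
     (\<forall>x \<in> {-\<alpha>..\<alpha>}. \<xi> \<le> f x)}"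

end

theory Submission
  imports Defs "HOL-Probability.Distributions" "HOL-Real_Asymp.Real_Asymp"
begin

text \<open>
  Since \<open>L\<close> is a polynomial and the derivatives of \<open>ln f\<close> at \<open>0\<close> are bounded, all derivatives of
  \<open>ln f\<close> up to order \<open>r\<close> grow at most polynomially, uniformly over the class. So on
  \<open>\<bar>x\<bar> \<le> A * \<bar>ln \<sigma>\<bar> powr (1/2)\<close> the density is, at scale \<open>\<sigma> * \<bar>ln \<sigma>\<bar>\<close>, a polynomial times \<open>f x\<close> up to a
  relative error \<open>\<sigma> powr \<beta>\<close> times a power of \<open>1 + \<bar>x\<bar>\<close>, while outside it is negligible by the tail
  condition.

  The mixture is written down explicitly. Fix weights \<open>w\<close> for which \<open>\<Sum>i. w i * f (y + i * \<sigma>)\<close>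
  undoes, on polynomials, the convolution with \<open>psi_s \<sigma>\<close>, and put this (positive) quantity as mass on a
  grid of step \<open>\<sigma> / q\<close> with \<open>q\<close> of order \<open>\<bar>ln \<sigma>\<bar>\<close>. The rectangle rule for a Gaussian is exponentially
  accurate in \<open>q\<close>, so passing from the integral to the grid costs only a high power of \<open>\<sigma>\<close>, and the
  grid has of the order of \<open>\<bar>ln \<sigma>\<bar> powr (3/2) / \<sigma>\<close> points.

  If \<open>Q\<close> is the mixture before normalisation, the divergence is at most the integral of the
  nonnegative function \<open>f * ln (f / Q) + Q - f\<close>. This is quadratic in the relative error where
  \<open>f > \<sigma> powr (4 * \<beta> + 4)\<close>, and elsewhere it is small because \<open>f\<close> is and \<open>ln (1 / Q)\<close> is at most
  of order \<open>(1 + x\<^sup>2) / \<sigma>\<^sup>2\<close>.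
\<close>

text \<open>Two obstacles shape the details. Nodes far from \<open>x\<close> give an absolute error,
  since \<open>f\<close> may be tiny at \<open>x\<close> and of order one there. The target for it
  is \<open>\<sigma> powr (5 * \<beta> + 4) * exp (- x^2)\<close>: where
  \<open>f x > \<sigma> powr (4 * \<beta> + 4)\<close> this is at most
  \<open>\<sigma> powr \<beta> * f x\<close>, hence a relative error of the right size. On the
  window of radius \<open>A * sqrt \<bar>ln \<sigma>\<bar>\<close>, with
  \<open>A = 4 * \<beta> + 8\<close>, the factor \<open>exp (- x^2)\<close> can drop to
  \<open>\<sigma> powr (A^2)\<close>, so the discarded terms have to be of order
  \<open>\<sigma> powr H\<close> with \<open>H = A^2 + 5 * \<beta> + 4\<close>. This fixes
  \<open>q\<close> near \<open>12 * H * \<bar>ln \<sigma>\<bar>\<close> and, with the radius, the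
  explicit node count. The other obstacle is continuity in \<beta>: the order \<open>r\<close> of
  the expansion jumps at the integers, and \<open>\<sigma> powr \<beta>\<close> loses its force as
  \<beta> tends to 0. The estimates are therefore uniform over all \<beta> with
  \<open>rr \<beta> = r\<close> and \<open>b \<le> \<beta>\<close>; the resulting countable family
  of constants is dominated by a continuous function of \<open>\<beta> + 1 / \<beta>\<close>. The
  bounds on the number and the range of the means are explicit polynomials in \<beta> and need no
  such step.\<close>

section \<open>Elementary Gaussian estimates\<close>

lemma power_le_fact_mult_exp:
  fixes t :: real
  assumes "0 \<le> t"
  shows "t ^ n \<le> fact n * exp t"
proof -
  have "(\<Sum>k\<in>{n}. t ^ k /\<^sub>R fact k) \<le> (\<Sum>k. t ^ k /\<^sub>R fact k)"
    using assms by (intro sum_le_suminf summable_exp_generic) auto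
  then have "t ^ n / fact n \<le> exp t"
    by (simp add: exp_def divide_inverse mult.commute)
  then show ?thesis
    by (simp add: divide_simps mult.commute)
qed

text \<open>Half of the Gaussian decay pays for the polynomial: the power is at most
  \<open>fact d * exp (1 + \<bar>x\<bar>)\<close>, and the tangent of \<open>x^2 / 8\<close> at
  \<open>\<bar>x\<bar> = 4\<close> bounds the linear exponent. The pure Gaussian on the right is the
  integrable majorant for all weighted errors.\<close>

lemma poly_growth_mult_gauss_le:
  fixes x :: real
  shows "(1 + \<bar>x\<bar>) ^ d * exp (- x\<^sup>2 / 4) \<le> fact d * exp 3 * exp (- x\<^sup>2 / 8)"
proof -
  have "0 \<le> (\<bar>x\<bar> - 4)\<^sup>2" by simp
  then have le: "1 + \<bar>x\<bar> \<le> 3 + x\<^sup>2 / 8"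
    by (simp add: power2_diff)
  have "(1 + \<bar>x\<bar>) ^ d * exp (- x\<^sup>2 / 4) \<le> (fact d * exp (1 + \<bar>x\<bar>)) * exp (- x\<^sup>2 / 4)"
    by (intro mult_right_mono power_le_fact_mult_exp) auto
  also have "\<dots> \<le> (fact d * exp (3 + x\<^sup>2 / 8)) * exp (- x\<^sup>2 / 4)"
    using le by (intro mult_right_mono mult_left_mono) auto
  also have "\<dots> = fact d * exp 3 * exp (- x\<^sup>2 / 8)"
    by (simp add: exp_add [symmetric] mult.assoc)
  finally show ?thesis .
qed

lemma integrable_exp_sq_eighth: "integrable lborel (\<lambda>x::real. exp (- x\<^sup>2 / 8))"
proof -
  have "integrable lborel (\<lambda>x. sqrt (2 * pi * 2\<^sup>2) * normal_density 0 2 x)"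
    by (intro integrable_mult_right) auto
  then show ?thesis
    by (simp add: normal_density_def)
qed

lemma psi_s_eq_normal_density:
  assumes "0 < \<sigma>"
  shows "psi_s \<sigma> (x - \<mu>) = normal_density \<mu> (\<sigma> / sqrt 2) x"
  using assms by (simp add: psi_s_def psi_def normal_density_def power_divide real_sqrt_mult field_simps)

lemma has_bochner_integral_psi_s:
  assumes "0 < \<sigma>"
  shows "has_bochner_integral lborel (\<lambda>x. psi_s \<sigma> (x - \<mu>)) 1"
  using assms by (simp add: has_bochner_integral_iff psi_s_eq_normal_density)

lemma has_bochner_integral_psi: "has_bochner_integral lborel psi 1"
  using has_bochner_integral_psi_s [of 1 0] by (simp add: psi_s_def [abs_def])

lemma psi_pos: "0 < psi x" by (simp add: psi_def)

lemma psi_le_exp: "psi x \<le> exp (- x\<^sup>2)"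
proof -
  have "1 \<le> sqrt pi" using pi_gt3 by simp
  then show ?thesis by (simp add: psi_def divide_le_eq mult_le_cancel_left1)
qed

section \<open>The sum of the absolute values of the coefficients\<close>

text \<open>The l1 norm of the coefficients. Deconvolution weights are tested on monomials only, so
  errors add up in this norm, and it is submultiplicative, which controls powers of a Taylor
  polynomial.\<close>

definition coeff_norm :: "real poly \<Rightarrow> real" where
  "coeff_norm p = (\<Sum>i\<le>degree p. \<bar>coeff p i\<bar>)"

lemma coeff_norm_eq_sum:
  assumes "degree p \<le> n"
  shows "coeff_norm p = (\<Sum>i\<le>n. \<bar>coeff p i\<bar>)"
  unfolding coeff_norm_def using assms
  by (intro sum.mono_neutral_left) (auto simp: coeff_eq_0)

lemma coeff_norm_nonneg: "0 \<le> coeff_norm p"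
  by (simp add: coeff_norm_def sum_nonneg)

lemma coeff_norm_0 [simp]: "coeff_norm 0 = 0"
  by (simp add: coeff_norm_def)

lemma coeff_norm_pCons: "coeff_norm (pCons a p) = \<bar>a\<bar> + coeff_norm p"
proof -
  have "coeff_norm (pCons a p) = (\<Sum>i\<le>Suc (degree p). \<bar>coeff (pCons a p) i\<bar>)"
    by (rule coeff_norm_eq_sum) (rule degree_pCons_le)
  then show ?thesis
    by (simp add: sum.atMost_Suc_shift coeff_norm_def del: sum.atMost_Suc)
qed

lemma coeff_norm_add_le: "coeff_norm (p + q) \<le> coeff_norm p + coeff_norm q"
proof -
  let ?n = "max (degree p) (degree q)"
  have "coeff_norm (p + q) = (\<Sum>i\<le>?n. \<bar>coeff p i + coeff q i\<bar>)"
    using coeff_norm_eq_sum [of "p + q" ?n] by (simp add: degree_add_le_max)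
  also have "\<dots> \<le> (\<Sum>i\<le>?n. \<bar>coeff p i\<bar> + \<bar>coeff q i\<bar>)"
    by (intro sum_mono) auto
  finally show ?thesis
    by (simp add: sum.distrib coeff_norm_eq_sum [of p ?n] coeff_norm_eq_sum [of q ?n])
qed

lemma coeff_norm_smult: "coeff_norm (smult c p) = \<bar>c\<bar> * coeff_norm p"
  using coeff_norm_eq_sum [of "smult c p" "degree p"]
  by (simp add: coeff_norm_def sum_distrib_left abs_mult)

lemma coeff_norm_sum_le: "coeff_norm (sum P A) \<le> (\<Sum>i\<in>A. coeff_norm (P i))"
  by (induction A rule: infinite_finite_induct) (auto intro: order_trans [OF coeff_norm_add_le])

lemma coeff_norm_mult_le: "coeff_norm (p * q) \<le> coeff_norm p * coeff_norm q"
proof (induction p)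
  case (pCons a p)
  have "coeff_norm (pCons a p * q) \<le> coeff_norm (smult a q) + coeff_norm (pCons 0 (p * q))"
    by (simp add: coeff_norm_add_le)
  also have "\<dots> \<le> (\<bar>a\<bar> + coeff_norm p) * coeff_norm q"
    using pCons.IH by (simp add: coeff_norm_smult coeff_norm_pCons algebra_simps)
  finally show ?case by (simp add: coeff_norm_pCons)
qed simp

lemma coeff_norm_power_le: "coeff_norm (p ^ n) \<le> coeff_norm p ^ n"
proof (induction n)
  case 0
  then show ?case by (simp add: coeff_norm_def)
next
  case (Suc n)
  have "coeff_norm (p ^ Suc n) \<le> coeff_norm p * coeff_norm (p ^ n)"
    by (simp add: coeff_norm_mult_le)
  also have "\<dots> \<le> coeff_norm p * coeff_norm p ^ n"
    by (intro mult_left_mono Suc coeff_norm_nonneg)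
  finally show ?case by simp
qed

lemma abs_poly_le_coeff_norm:
  "\<bar>poly p x\<bar> \<le> coeff_norm p * (1 + \<bar>x\<bar>) ^ degree p"
proof -
  have "\<bar>poly p x\<bar> \<le> (\<Sum>i\<le>degree p. \<bar>coeff p i\<bar> * \<bar>x\<bar> ^ i)"
    unfolding poly_altdef by (rule order_trans [OF sum_abs]) (simp add: abs_mult power_abs)
  also have "\<dots> \<le> (\<Sum>i\<le>degree p. \<bar>coeff p i\<bar> * (1 + \<bar>x\<bar>) ^ degree p)"
  proof (intro sum_mono mult_left_mono)
    fix i assume "i \<in> {..degree p}"
    have "\<bar>x\<bar> ^ i \<le> (1 + \<bar>x\<bar>) ^ i" by (intro power_mono) auto
    also have "\<dots> \<le> (1 + \<bar>x\<bar>) ^ degree p"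
      using \<open>i \<in> _\<close> by (intro power_increasing) auto
    finally show "\<bar>x\<bar> ^ i \<le> (1 + \<bar>x\<bar>) ^ degree p" .
  qed auto
  finally show ?thesis by (simp add: coeff_norm_def sum_distrib_right)
qed

section \<open>Deconvolution coefficients\<close>

text \<open>Subtracting \<open>x 0\<close> times equation \<open>n\<close> from equation
  \<open>n + 1\<close> removes the node \<open>x 0\<close> and leaves a system of the same kind for
  the unknowns \<open>a i * (x i - x 0)\<close> on the other nodes. The equation with
  \<open>n = 0\<close> then determines the weight at \<open>x 0\<close>.\<close>

lemma vandermonde_solvable:
  fixes x :: "nat \<Rightarrow> real" and t :: "nat \<Rightarrow> real"
  assumes "inj_on x {..r}"
  shows "\<exists>a. \<forall>n\<le>r. (\<Sum>i\<le>r. a i * x i ^ n) = t n"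
  using assms
proof (induction r arbitrary: x t)
  case 0
  show ?case by (rule exI [of _ "\<lambda>_. t 0"]) simp
next
  case (Suc r)
  have "inj_on (x \<circ> Suc) {..r}"
    using Suc.prems by (auto simp: inj_on_def)
  from Suc.IH [OF this, of "\<lambda>n. t (Suc n) - x 0 * t n"]
  obtain b where b: "\<And>n. n \<le> r \<Longrightarrow> (\<Sum>i\<le>r. b i * x (Suc i) ^ n) = t (Suc n) - x 0 * t n"
    by (auto simp: o_def)
  define a' where "a' i = b i / (x (Suc i) - x 0)" for i
  define a where "a i = (case i of 0 \<Rightarrow> t 0 - (\<Sum>i\<le>r. a' i) | Suc j \<Rightarrow> a' j)" for i
  have ne: "x (Suc i) - x 0 \<noteq> 0" if "i \<le> r" for i
    using Suc.prems that by (auto simp: inj_on_def)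
  have split: "(\<Sum>i\<le>Suc r. a i * x i ^ n) = (t 0 - (\<Sum>i\<le>r. a' i)) * x 0 ^ n + (\<Sum>i\<le>r. a' i * x (Suc i) ^ n)" for n
    unfolding sum.atMost_Suc_shift by (simp add: a_def)
  have "(\<Sum>i\<le>Suc r. a i * x i ^ n) = t n" if "n \<le> Suc r" for n
    using that
  proof (induction n)
    case 0
    then show ?case unfolding split by simp
  next
    case (Suc n)
    have "(\<Sum>i\<le>Suc r. a i * x i ^ Suc n) - x 0 * (\<Sum>i\<le>Suc r. a i * x i ^ n)
        = (\<Sum>i\<le>r. a' i * (x (Suc i) - x 0) * x (Suc i) ^ n)"
      unfolding split by (simp add: algebra_simps sum_subtractf sum_distrib_left)
    also have "\<dots> = (\<Sum>i\<le>r. b i * x (Suc i) ^ n)"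
      using ne by (intro sum.cong) (auto simp: a'_def)
    also have "\<dots> = t (Suc n) - x 0 * t n" using Suc.prems by (intro b) auto
    finally show ?case using Suc by (simp del: sum.atMost_Suc)
  qed
  then show ?case by blast
qed

text \<open>If \<open>m\<close> lists the moments of a variable U, the inner sum is the n-th moment
  of \<open>i + U\<close>. The weights enter only through their own moments \<open>t n\<close>,
  whose binomial convolution with \<open>m\<close> has to be the unit sequence. That system is
  triangular, and \<open>t\<close> is realised by weights on 0, ..., N by the Vandermonde
  lemma.\<close>

lemma exists_deconvolution_weights:
  fixes m :: "nat \<Rightarrow> real"
  assumes "m 0 = 1"
  shows "\<exists>a. \<forall>n\<le>N. (\<Sum>i\<le>N. a i * (\<Sum>l\<le>n. of_nat (n choose l) * m l * real i ^ (n - l))) = (if n = 0 then 1 else 0)"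
proof -
  have "\<exists>t. \<forall>n\<le>N. (\<Sum>l\<le>n. of_nat (n choose l) * m l * t (n - l)) = (if n = 0 then 1 else 0)"
  proof (induction N)
    case 0
    show ?case using assms by (intro exI [of _ "\<lambda>_. 1"]) auto
  next
    case (Suc N)
    then obtain t where t: "\<And>n. n \<le> N \<Longrightarrow> (\<Sum>l\<le>n. of_nat (n choose l) * m l * t (n - l)) = (if n = 0 then 1 else 0)"
      by blast
    \<comment> \<open>In the equation of index \<open>Suc N\<close> the new unknown has coefficient
      \<open>m 0 = 1\<close>; the earlier equations do not contain it.\<close>
    define s where "s = t(Suc N := - (\<Sum>l\<le>N. of_nat (Suc N choose Suc l) * m (Suc l) * t (N - l)))"
    have "(\<Sum>l\<le>n. of_nat (n choose l) * m l * s (n - l)) = (if n = 0 then 1 else 0)" if "n \<le> Suc N" for n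
    proof (cases "n = Suc N")
      case True
      have "(\<Sum>l\<le>n. of_nat (n choose l) * m l * s (n - l))
         = s (Suc N) + (\<Sum>l\<le>N. of_nat (Suc N choose Suc l) * m (Suc l) * s (N - l))"
        unfolding True sum.atMost_Suc_shift using assms by simp
      also have "(\<Sum>l\<le>N. of_nat (Suc N choose Suc l) * m (Suc l) * s (N - l))
         = (\<Sum>l\<le>N. of_nat (Suc N choose Suc l) * m (Suc l) * t (N - l))"
        by (intro sum.cong) (auto simp: s_def)
      finally show ?thesis using True by (simp add: s_def)
    next
      case False
      then have "(\<Sum>l\<le>n. of_nat (n choose l) * m l * s (n - l)) = (\<Sum>l\<le>n. of_nat (n choose l) * m l * t (n - l))"
        using that by (intro sum.cong) (auto simp: s_def)
      then show ?thesis using t [of n] False that by auto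
    qed
    then show ?case by blast
  qed
  then obtain t where t: "\<And>n. n \<le> N \<Longrightarrow> (\<Sum>l\<le>n. of_nat (n choose l) * m l * t (n - l)) = (if n = 0 then 1 else 0)"
    by blast
  have "inj_on real {..N}" by (simp add: inj_on_def)
  from vandermonde_solvable [OF this, of t]
  obtain a where a: "\<And>n. n \<le> N \<Longrightarrow> (\<Sum>i\<le>N. a i * real i ^ n) = t n" by blast
  have "(\<Sum>i\<le>N. a i * (\<Sum>l\<le>n. of_nat (n choose l) * m l * real i ^ (n - l))) = (if n = 0 then 1 else 0)"
    if "n \<le> N" for n
  proof -
    have "(\<Sum>i\<le>N. a i * (\<Sum>l\<le>n. of_nat (n choose l) * m l * real i ^ (n - l)))
        = (\<Sum>l\<le>n. of_nat (n choose l) * m l * (\<Sum>i\<le>N. a i * real i ^ (n - l)))"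
      unfolding sum_distrib_left by (subst sum.swap) (simp add: ac_simps)
    also have "\<dots> = (\<Sum>l\<le>n. of_nat (n choose l) * m l * t (n - l))"
      using that by (intro sum.cong arg_cong2 [where f = "(*)"] a) auto
    finally show ?thesis using t that by simp
  qed
  then show ?thesis by blast
qed

section \<open>Derivatives of a polynomial times a Gaussian\<close>

text \<open>The polynomial factor of the m-th derivative of \<open>p u * exp (- u^2)\<close>; for
  \<open>p = 1\<close> these are the Hermite polynomials up to sign.\<close>

fun gauss_deriv_poly :: "real poly \<Rightarrow> nat \<Rightarrow> real poly" where
  "gauss_deriv_poly p 0 = p"
| "gauss_deriv_poly p (Suc m) =
     pderiv (gauss_deriv_poly p m) - pCons 0 (smult 2 (gauss_deriv_poly p m))"

lemma DERIV_gauss_deriv_poly: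
  "((\<lambda>u. poly (gauss_deriv_poly p m) u * exp (- u\<^sup>2)) has_real_derivative
    poly (gauss_deriv_poly p (Suc m)) u * exp (- u\<^sup>2)) (at u)"
  by (auto intro!: derivative_eq_intros simp: algebra_simps)

lemma degree_gauss_deriv_poly: "degree (gauss_deriv_poly p m) \<le> degree p + m"
proof (induction m)
  case (Suc m)
  have "degree (pderiv (gauss_deriv_poly p m)) \<le> degree p + Suc m"
    using Suc by (simp add: degree_pderiv)
  moreover have "degree (pCons 0 (smult 2 (gauss_deriv_poly p m))) \<le> degree p + Suc m"
    using Suc by (intro order_trans [OF degree_pCons_le]) simp
  ultimately show ?case by (simp add: degree_diff_le)
qed simp

text \<open>The factorial weights serve two purposes:
  \<open>\<bar>u\<bar> ^ i \<le> fact i * exp \<bar>u\<bar>\<close> gives pointwise bounds, and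
  differentiation does not increase this norm, since the factor \<open>i + 1\<close> is absorbed
  into the next factorial.\<close>

definition fact_norm :: "real poly \<Rightarrow> real" where
  "fact_norm p = (\<Sum>i\<le>degree p. fact i * \<bar>coeff p i\<bar>)"

lemma fact_norm_eq_sum:
  assumes "degree p \<le> n"
  shows "fact_norm p = (\<Sum>i\<le>n. fact i * \<bar>coeff p i\<bar>)"
  unfolding fact_norm_def using assms
  by (intro sum.mono_neutral_left) (auto simp: coeff_eq_0)

lemma abs_poly_le_fact_norm:
  fixes u :: real
  shows "\<bar>poly p u\<bar> \<le> fact_norm p * exp (1 / 2 + u\<^sup>2 / 2)"
proof -
  have "0 \<le> (\<bar>u\<bar> - 1)\<^sup>2" by simp
  then have le: "\<bar>u\<bar> \<le> 1 / 2 + u\<^sup>2 / 2" by (simp add: power2_diff)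
  have "\<bar>poly p u\<bar> \<le> (\<Sum>i\<le>degree p. \<bar>coeff p i\<bar> * \<bar>u\<bar> ^ i)"
    unfolding poly_altdef by (rule order_trans [OF sum_abs]) (simp add: abs_mult power_abs)
  also have "\<dots> \<le> (\<Sum>i\<le>degree p. \<bar>coeff p i\<bar> * (fact i * exp (1 / 2 + u\<^sup>2 / 2)))"
  proof (intro sum_mono mult_left_mono)
    fix i
    have "\<bar>u\<bar> ^ i \<le> fact i * exp \<bar>u\<bar>" by (rule power_le_fact_mult_exp) simp
    also have "\<dots> \<le> fact i * exp (1 / 2 + u\<^sup>2 / 2)" using le by simp
    finally show "\<bar>u\<bar> ^ i \<le> fact i * exp (1 / 2 + u\<^sup>2 / 2)" .
  qed auto
  finally show ?thesis
    by (simp add: fact_norm_def sum_distrib_right mult_ac)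
qed

text \<open>The derivative contributes at most 1; multiplication by \<open>2 * u\<close> raises each
  factorial by one and contributes at most \<open>2 * (d + 1)\<close>.\<close>

lemma fact_norm_gauss_step:
  assumes "degree p \<le> d"
  shows "fact_norm (pderiv p - pCons 0 (smult 2 p)) \<le> (2 * real d + 3) * fact_norm p"
proof -
  let ?q = "pderiv p - pCons 0 (smult 2 p)"
  have d: "degree ?q \<le> Suc d"
  proof (rule degree_diff_le)
    show "degree (pderiv p) \<le> Suc d" using assms by (simp add: degree_pderiv)
    show "degree (pCons 0 (smult 2 p)) \<le> Suc d"
      using assms by (intro order_trans [OF degree_pCons_le]) simp
  qed
  have "fact_norm ?q = (\<Sum>i\<le>Suc d. fact i * \<bar>coeff ?q i\<bar>)"
    by (rule fact_norm_eq_sum [OF d])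
  also have "\<dots> \<le> (\<Sum>i\<le>Suc d. fact i * \<bar>coeff (pderiv p) i\<bar> + fact i * \<bar>coeff (pCons 0 (smult 2 p)) i\<bar>)"
    by (intro sum_mono) (auto simp: distrib_left [symmetric] intro: abs_triangle_ineq4)
  also have "\<dots> = (\<Sum>i\<le>Suc d. fact (Suc i) * \<bar>coeff p (Suc i)\<bar>) + (\<Sum>i\<le>d. fact (Suc i) * (2 * \<bar>coeff p i\<bar>))"
  proof -
    have "(\<Sum>i\<le>Suc d. fact i * \<bar>coeff (pderiv p) i\<bar>) = (\<Sum>i\<le>Suc d. fact (Suc i) * \<bar>coeff p (Suc i)\<bar>)"
      by (intro sum.cong) (auto simp: coeff_pderiv abs_mult simp del: of_nat_Suc)
    moreover have "(\<Sum>i\<le>Suc d. fact i * \<bar>coeff (pCons 0 (smult 2 p)) i\<bar>) = (\<Sum>i\<le>d. fact (Suc i) * (2 * \<bar>coeff p i\<bar>))"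
      unfolding sum.atMost_Suc_shift by (simp add: abs_mult)
    ultimately show ?thesis by (simp add: sum.distrib)
  qed
  also have "(\<Sum>i\<le>Suc d. fact (Suc i) * \<bar>coeff p (Suc i)\<bar>) \<le> fact_norm p"
  proof -
    have "fact_norm p = \<bar>coeff p 0\<bar> + (\<Sum>i\<le>Suc d. fact (Suc i) * \<bar>coeff p (Suc i)\<bar>)"
      using fact_norm_eq_sum [of p "Suc (Suc d)"] assms
      unfolding sum.atMost_Suc_shift [of _ "Suc d"] by simp
    then show ?thesis by simp
  qed
  also have "(\<Sum>i\<le>d. fact (Suc i) * (2 * \<bar>coeff p i\<bar>)) \<le> (\<Sum>i\<le>d. (2 * (real d + 1)) * (fact i * \<bar>coeff p i\<bar>))"
  proof (intro sum_mono)
    fix i assume "i \<in> {..d}"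
    then have "(real i + 1) * (fact i * \<bar>coeff p i\<bar>) \<le> (real d + 1) * (fact i * \<bar>coeff p i\<bar>)"
      by (intro mult_right_mono) auto
    then show "fact (Suc i) * (2 * \<bar>coeff p i\<bar>) \<le> (2 * (real d + 1)) * (fact i * \<bar>coeff p i\<bar>)"
      by (simp add: algebra_simps)
  qed
  also have "\<dots> = (2 * (real d + 1)) * fact_norm p"
    using fact_norm_eq_sum [OF assms] by (simp add: sum_distrib_left)
  finally show ?thesis by (simp add: algebra_simps)
qed

lemma fact_norm_gauss_deriv_monom:
  "fact_norm (gauss_deriv_poly (monom 1 n) m) \<le> 2 ^ m * fact (n + m + 1)"
proof (induction m)
  case 0
  have "fact_norm (monom 1 n) = (\<Sum>i\<in>{n}. fact i * \<bar>coeff (monom 1 n) i\<bar>)"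
    unfolding fact_norm_def
    by (intro sum.mono_neutral_right) (auto simp: degree_monom_eq)
  then show ?case by (simp add: fact_mono)
next
  case (Suc m)
  let ?p = "gauss_deriv_poly (monom 1 n) m"
  have "degree ?p \<le> n + m"
    using degree_gauss_deriv_poly [of "monom 1 n" m] by (simp add: degree_monom_eq)
  from fact_norm_gauss_step [OF this]
  have "fact_norm (gauss_deriv_poly (monom 1 n) (Suc m)) \<le> (2 * real (n + m) + 3) * fact_norm ?p"
    by simp
  also have "\<dots> \<le> (2 * real (n + m + 2)) * (2 ^ m * fact (n + m + 1))"
    using Suc by (intro mult_mono) (auto simp: fact_norm_def intro!: sum_nonneg)
  also have "\<dots> = 2 ^ Suc m * fact (n + Suc m + 1)"
    by (simp add: algebra_simps)
  finally show ?case .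
qed

lemma fact_add_le: "fact (a + b) \<le> (2 ^ (a + b) * fact a * fact b :: real)"
proof -
  have "((a + b) choose a) \<le> 2 ^ (a + b)"
    by (rule binomial_le_pow2)
  then have "real ((a + b) choose a) \<le> real (2 ^ (a + b))"
    by (rule of_nat_mono)
  moreover have "fact (a + b) = (fact a * fact b * real ((a + b) choose a))"
    using binomial_fact_lemma [of a "a + b"] by (metis add_diff_cancel_left' le_add1 of_nat_fact of_nat_mult)
  ultimately show ?thesis by (simp add: mult.commute mult_left_mono)
qed

text \<open>Only the growth \<open>4 ^ m * fact m\<close> in \<open>m\<close> matters: it permits an
  order of differentiation proportional to the inverse step, and hence exponential accuracy. One
  factor \<open>2 ^ m\<close> comes from the recursion, the other from splitting
  \<open>fact (n + m + 1)\<close>; half of the exponent is spent on the polynomial.\<close>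

lemma gauss_deriv_bound:
  "\<bar>poly (gauss_deriv_poly (monom 1 n) m) u * exp (- u\<^sup>2)\<bar>
     \<le> (2 ^ (n + 1) * fact (n + 1) * exp (1 / 2)) * 4 ^ m * fact m * exp (- u\<^sup>2 / 2)"
proof -
  have "\<bar>poly (gauss_deriv_poly (monom 1 n) m) u\<bar> \<le> fact_norm (gauss_deriv_poly (monom 1 n) m) * exp (1 / 2 + u\<^sup>2 / 2)"
    by (rule abs_poly_le_fact_norm)
  also have "\<dots> \<le> (2 ^ m * fact (n + m + 1)) * exp (1 / 2 + u\<^sup>2 / 2)"
    by (intro mult_right_mono fact_norm_gauss_deriv_monom) simp
  also have "\<dots> \<le> (2 ^ m * (2 ^ (n + 1 + m) * fact (n + 1) * fact m)) * exp (1 / 2 + u\<^sup>2 / 2)"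
    using fact_add_le [of "n + 1" m] by (intro mult_right_mono mult_left_mono) (auto simp: add_ac)
  finally have "\<bar>poly (gauss_deriv_poly (monom 1 n) m) u\<bar> * exp (- u\<^sup>2) \<le>
      (2 ^ m * (2 ^ (n + 1 + m) * fact (n + 1) * fact m)) * exp (1 / 2 + u\<^sup>2 / 2) * exp (- u\<^sup>2)"
    by (intro mult_right_mono) auto
  also have "\<dots> = (2 ^ m * 2 ^ m) * (2 ^ (n + 1) * fact (n + 1)) * fact m * (exp (1 / 2 + u\<^sup>2 / 2) * exp (- u\<^sup>2))"
    by (simp add: power_add)
  also have "exp (1 / 2 + u\<^sup>2 / 2) * exp (- u\<^sup>2) = exp (1 / 2) * exp (- u\<^sup>2 / 2)"
    by (simp add: exp_add [symmetric])
  also have "(2 ^ m * 2 ^ m) = (4 ^ m :: real)"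
    by (simp add: power_mult_distrib [symmetric])
  finally show ?thesis by (simp add: abs_mult mult_ac)
qed

section \<open>Accuracy of the rectangle rule\<close>

text \<open>For a family with \<open>g (i + 1) = (g i)'\<close>, the operator \<open>rect_defect\<close> subtracts from each function
  its mean over \<open>[u, u + \<delta>]\<close>; these means telescope in a rectangle sum, and iterating the
  operator \<open>m\<close> times gains a factor \<open>\<delta> ^ m\<close>.\<close>

definition rect_defect :: "real \<Rightarrow> (int \<Rightarrow> real \<Rightarrow> real) \<Rightarrow> int \<Rightarrow> real \<Rightarrow> real" where
  "rect_defect \<delta> g i u = g i u - (g (i - 1) (u + \<delta>) - g (i - 1) u) / \<delta>"

text \<open>Integer indices, because \<open>rect_defect\<close> refers to \<open>g (i - 1)\<close>:
  iterating it reaches ever higher antiderivatives, which sit at the negative indices.\<close>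

definition deriv_family :: "(int \<Rightarrow> real \<Rightarrow> real) \<Rightarrow> bool" where
  "deriv_family g \<longleftrightarrow> (\<forall>i u. (g i has_real_derivative g (i + 1) u) (at u))"

lemma deriv_family_rect_defect:
  assumes "deriv_family g"
  shows "deriv_family (rect_defect \<delta> g)"
proof -
  have D: "(g i has_real_derivative g (i + 1) u) (at u)" for i u
    using assms by (simp add: deriv_family_def)
  have D': "((\<lambda>u. g (i - 1) (u + \<delta>)) has_real_derivative g i (u + \<delta>)) (at u)" for i u
    using D [of "i - 1" "u + \<delta>"] by (simp add: DERIV_shift)
  have D'': "(g (i - 1) has_real_derivative g i u) (at u)" for i u
    using D [of "i - 1" u] by simp
  show ?thesis
    unfolding deriv_family_def rect_defect_def [abs_def] 
    by (intro allI) (auto intro!: DERIV_diff DERIV_cdivide D D' D'')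
qed

lemma deriv_family_rect_defect_iter:
  "deriv_family g \<Longrightarrow> deriv_family ((rect_defect \<delta> ^^ j) g)"
  by (induction j) (auto intro: deriv_family_rect_defect)

text \<open>By the mean value theorem the difference quotient of the antiderivative is
  \<open>g i z\<close> at some point \<open>z\<close> of the interval; a second use bounds
  \<open>g i z - g i u\<close>.\<close>

lemma rect_defect_bound:
  assumes g: "deriv_family g" and \<delta>: "0 < \<delta>"
    and K: "\<And>v. u \<le> v \<Longrightarrow> v \<le> u + \<delta> \<Longrightarrow> \<bar>g (i + 1) v\<bar> \<le> K"
  shows "\<bar>rect_defect \<delta> g i u\<bar> \<le> \<delta> * K"
proof -
  have D: "(g i has_real_derivative g (i + 1) u) (at u)" for i u
    using g by (simp add: deriv_family_def)
  have "\<exists>z>u. z < u + \<delta> \<and> g (i - 1) (u + \<delta>) - g (i - 1) u = (u + \<delta> - u) * g i z"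
    using \<delta> D [of "i - 1"] by (intro MVT2) auto
  then obtain z where z: "u < z" "z < u + \<delta>" "g (i - 1) (u + \<delta>) - g (i - 1) u = \<delta> * g i z"
    by auto
  have "\<exists>y>u. y < z \<and> g i z - g i u = (z - u) * g (i + 1) y"
    using z D [of i] by (intro MVT2) auto
  then obtain y where y: "u < y" "y < z" "g i z - g i u = (z - u) * g (i + 1) y"
    by auto
  have "\<bar>rect_defect \<delta> g i u\<bar> = \<bar>g i z - g i u\<bar>"
    using \<delta> z(3) by (simp add: rect_defect_def abs_minus_commute)
  also have "\<dots> = (z - u) * \<bar>g (i + 1) y\<bar>" using y z by (simp add: abs_mult)
  also have "\<dots> \<le> \<delta> * K" using y z K [of y] by (intro mult_mono) auto
  finally show ?thesis .
qed

text \<open>Each application looks a further \<delta> to the right and asks for one more derivative,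
  hence the interval of length \<open>j * \<delta>\<close> and the index
  \<open>i + j\<close>.\<close>

lemma rect_defect_iter_bound:
  assumes g: "deriv_family g" and \<delta>: "0 < \<delta>"
    and K: "\<And>v. u \<le> v \<Longrightarrow> v \<le> u + real j * \<delta> \<Longrightarrow> \<bar>g (i + int j) v\<bar> \<le> K"
  shows "\<bar>(rect_defect \<delta> ^^ j) g i u\<bar> \<le> \<delta> ^ j * K"
  using K
proof (induction j arbitrary: i u)
  case 0
  then show ?case by simp
next
  case (Suc j)
  have "\<bar>rect_defect \<delta> ((rect_defect \<delta> ^^ j) g) i u\<bar> \<le> \<delta> * (\<delta> ^ j * K)"
  proof (rule rect_defect_bound [OF deriv_family_rect_defect_iter [OF g] \<delta>])
    fix v assume v: "u \<le> v" "v \<le> u + \<delta>"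
    show "\<bar>(rect_defect \<delta> ^^ j) g (i + 1) v\<bar> \<le> \<delta> ^ j * K"
    proof (rule Suc.IH)
      fix w assume "v \<le> w" "w \<le> v + real j * \<delta>"
      then show "\<bar>g (i + 1 + int j) w\<bar> \<le> K"
        using Suc.prems [of w] v by (simp add: algebra_simps)
    qed
  qed
  then show ?case by simp
qed

text \<open>A function is its defect plus its mean over one step, and \<delta> times the mean is an
  increment of the antiderivative; summing leaves boundary values, and the defect is treated again.
  The term \<open>j = 0\<close> is the exact integral, while the later ones are corrections at the
  ends, in the manner of Euler and Maclaurin.\<close>

lemma rect_sum_telescope:
  fixes a b :: int and \<delta> x :: real
  assumes "0 < \<delta>" "a \<le> b"
  shows "(\<Sum>k\<in>{a..<b}. \<delta> * g i (k * \<delta> - x)) =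
    (\<Sum>j<m. (rect_defect \<delta> ^^ j) g (i - 1) (b * \<delta> - x) - (rect_defect \<delta> ^^ j) g (i - 1) (a * \<delta> - x))
    + (\<Sum>k\<in>{a..<b}. \<delta> * (rect_defect \<delta> ^^ m) g i (k * \<delta> - x))"
proof (induction m)
  case 0
  then show ?case by simp
next
  case (Suc m)
  let ?G = "(rect_defect \<delta> ^^ m) g"
  have tel: "(\<Sum>k\<in>{a..<b}. F (k + 1) - F k) = F b - F a" for F :: "int \<Rightarrow> real"
    using \<open>a \<le> b\<close>
  proof (induction b rule: int_ge_induct)
    case (step i)
    have "{a..<i + 1} = insert i {a..<i}" using step by auto
    then show ?case using step by simp
  qed simp
  have "\<delta> * ?G i (k * \<delta> - x) = (?G (i - 1) ((k + 1) * \<delta> - x) - ?G (i - 1) (k * \<delta> - x))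
      + \<delta> * rect_defect \<delta> ?G i (k * \<delta> - x)" for k :: real
    using \<open>0 < \<delta>\<close> by (simp add: rect_defect_def field_simps)
  then have "(\<Sum>k\<in>{a..<b}. \<delta> * ?G i (k * \<delta> - x)) =
      (\<Sum>k\<in>{a..<b}. ?G (i - 1) (of_int (k + 1) * \<delta> - x) - ?G (i - 1) (of_int k * \<delta> - x))
      + (\<Sum>k\<in>{a..<b}. \<delta> * rect_defect \<delta> ?G i (k * \<delta> - x))"
    by (simp add: sum.distrib [symmetric])
  with Suc tel [of "\<lambda>k. ?G (i - 1) (of_int k * \<delta> - x)"] show ?case by simp
qed

text \<open>The negative indices are filled by a chosen antiderivative operator iterated on
  \<open>F 0\<close>; every iterate is differentiable, hence continuous, so the operator applies
  again.\<close>

lemma exists_deriv_family: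
  fixes F :: "nat \<Rightarrow> real \<Rightarrow> real"
  assumes F: "\<And>n u. (F n has_real_derivative F (Suc n) u) (at u)"
  obtains g where "deriv_family g" "\<And>n. g (int n) = F n"
proof -
  have "\<exists>H. \<forall>u. (H has_real_derivative f u) (at u)" if "\<And>u. isCont f u" for f :: "real \<Rightarrow> real"
    using einterval_antiderivative [of "-\<infinity>" "\<infinity>" f] that
    by (simp add: has_real_derivative_iff_has_vector_derivative)
  then obtain I where I: "\<And>f u. (\<And>u. isCont f u) \<Longrightarrow> (I f has_real_derivative f u) (at u)"
    by metis
  define antid where "antid n = (I ^^ n) (F 0)" for n
  have cont: "isCont (antid n) u" for n u
  proof (induction n arbitrary: u)
    case 0
    show ?case using DERIV_isCont [OF F] by (simp add: antid_def)
  next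
    case (Suc n)
    show ?case using DERIV_isCont [OF I [OF Suc]] by (simp add: antid_def)
  qed
  have D: "(antid (Suc n) has_real_derivative antid n u) (at u)" for n u
    using I [OF cont, of n u] by (simp add: antid_def)
  define g where "g i = (if 0 \<le> i then F (nat i) else antid (nat (- i)))" for i
  have "deriv_family g"
    unfolding deriv_family_def
  proof (intro allI)
    fix i :: int and u
    consider "0 \<le> i" | "i = -1" | "i < -1" by linarith
    then show "(g i has_real_derivative g (i + 1) u) (at u)"
    proof cases
      case 1
      then show ?thesis using F [of "nat i" u] by (simp add: g_def nat_add_distrib)
    next
      case 2
      then show ?thesis using D [of 0 u] by (simp add: g_def antid_def)
    next
      case 3
      then have "nat (- i) = Suc (nat (- (i + 1)))" by simp
      then show ?thesis using 3 D [of "nat (- (i + 1))" u] by (simp add: g_def)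
    qed
  qed
  moreover have "g (int n) = F n" for n by (simp add: g_def)
  ultimately show ?thesis using that by blast
qed

text \<open>Each term is at most three times an increment of \<open>arctan\<close>, whose total
  variation is at most pi; the factor 3 compares \<open>1 + z^2\<close> with \<open>1 + u^2\<close>
  over a step of length at most 1. The bound depends neither on the number of nodes nor on their
  position, so it serves for all grid sums below.\<close>

lemma rect_sum_inverse_square_le:
  fixes a b :: int and \<delta> x :: real
  assumes "0 < \<delta>" "\<delta> \<le> 1"
  shows "(\<Sum>k\<in>{a..<b}. \<delta> / (1 + (k * \<delta> - x)\<^sup>2)) \<le> 3 * pi"
proof (cases "a \<le> b")
  case True
  have stepu: "\<delta> / (1 + u\<^sup>2) \<le> 3 * (arctan (u + \<delta>) - arctan u)" for u :: real
  proof -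
    have "\<exists>z>u. z < u + \<delta> \<and> arctan (u + \<delta>) - arctan u = (u + \<delta> - u) * inverse (1 + z\<^sup>2)"
      using assms by (intro MVT2 DERIV_arctan) auto
    then obtain z where z: "u < z" "z < u + \<delta>" "arctan (u + \<delta>) - arctan u = \<delta> * inverse (1 + z\<^sup>2)"
      by auto
    have "z\<^sup>2 \<le> 2 * u\<^sup>2 + 2 * (z - u)\<^sup>2"
      using zero_le_power2 [of "2 * u - z"] by (simp add: power2_eq_square algebra_simps)
    moreover have "(z - u)\<^sup>2 \<le> 1" using z assms by (simp add: abs_square_le_1)
    ultimately have "1 + z\<^sup>2 \<le> 3 * (1 + u\<^sup>2)" using zero_le_power2 [of u] by argo
    then have "1 / (1 + u\<^sup>2) \<le> 3 * inverse (1 + z\<^sup>2)"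
      by (simp add: divide_simps add_pos_nonneg)
    then have "\<delta> * (1 / (1 + u\<^sup>2)) \<le> \<delta> * (3 * inverse (1 + z\<^sup>2))"
      using assms by (intro mult_left_mono) auto
    then show ?thesis using z by simp
  qed
  have "(\<Sum>k\<in>{a..<b}. \<delta> / (1 + (k * \<delta> - x)\<^sup>2)) \<le> 3 * (arctan (b * \<delta> - x) - arctan (a * \<delta> - x))"
    using True
  proof (induction b rule: int_ge_induct)
    case (step i)
    have eq: "{a..<i + 1} = insert i {a..<i}" using step by auto
    have sh: "real_of_int (i + 1) * \<delta> - x = of_int i * \<delta> - x + \<delta>" by (simp add: algebra_simps)
    have "(\<Sum>k\<in>{a..<i + 1}. \<delta> / (1 + (k * \<delta> - x)\<^sup>2))
        = \<delta> / (1 + (i * \<delta> - x)\<^sup>2) + (\<Sum>k\<in>{a..<i}. \<delta> / (1 + (k * \<delta> - x)\<^sup>2))"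
      unfolding eq by simp
    then show ?case unfolding sh using step.IH stepu [of "of_int i * \<delta> - x"] by argo
  qed simp
  also have "\<dots> \<le> 3 * pi"
    using arctan_ubound [of "b * \<delta> - x"] arctan_lbound [of "a * \<delta> - x"] by simp
  finally show ?thesis .
qed simp


lemma exp_neg_sq_quarter_le: "exp (- u\<^sup>2 / 4) \<le> 4 / (1 + u\<^sup>2)" for u :: real
proof -
  have "1 + u\<^sup>2 / 4 \<le> exp (u\<^sup>2 / 4)" by (rule exp_ge_add_one_self)
  then have "(1 + u\<^sup>2) / 4 \<le> exp (u\<^sup>2 / 4)" by argo
  then have "inverse (exp (u\<^sup>2 / 4)) \<le> inverse ((1 + u\<^sup>2) / 4)"
    by (intro le_imp_inverse_le) (auto simp: add_pos_nonneg)
  then show ?thesis by (simp add: exp_minus)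
qed

text \<open>The iterated defect evaluates derivatives up to \<open>j * \<delta> \<le> 1\<close> away
  from the node. Halving the exponent makes the Gaussian bound insensitive to such a shift.\<close>

lemma exp_neg_sq_half_shift_le:
  fixes u v :: real
  assumes "\<bar>v - u\<bar> \<le> 1"
  shows "exp (- v\<^sup>2 / 2) \<le> exp (1 / 2) * exp (- u\<^sup>2 / 4)"
proof -
  have "u\<^sup>2 \<le> 2 * v\<^sup>2 + 2 * (v - u)\<^sup>2"
    using zero_le_power2 [of "2 * v - u"] by (simp add: power2_eq_square algebra_simps)
  moreover have "(v - u)\<^sup>2 \<le> 1" using assms by (simp add: abs_square_le_1)
  ultimately have "- v\<^sup>2 / 2 \<le> 1 / 2 + - u\<^sup>2 / 4" by simp
  then show ?thesis by (simp flip: exp_add)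
qed

text \<open>The origin of the 12 in all later exponents: with \<open>fact j \<le> j ^ j\<close> the
  left side is at most \<open>(4 * j / q) ^ j\<close>, and \<open>12 * j \<le> q\<close> makes the
  base at most 1/3, below the inverse of e.\<close>

lemma power_fact_le_third_power:
  assumes "j \<le> q div 12" "1 \<le> q"
  shows "(1 / real q) ^ j * 4 ^ j * fact j \<le> (1 / 3) ^ j"
proof -
  have "12 * j \<le> q" using assms by linarith
  then have le: "4 * real j / real q \<le> 1 / 3"
    using assms by (simp add: field_simps)
  have "(1 / real q) ^ j * 4 ^ j * fact j \<le> (1 / real q) ^ j * 4 ^ j * real j ^ j"
    using fact_le_power [of j, where 'a = real] by (intro mult_left_mono) auto
  also have "\<dots> = (4 * real j / real q) ^ j"
    by (simp add: power_mult_distrib power_divide)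
  also have "\<dots> \<le> (1 / 3) ^ j"
    using le by (intro power_mono) auto
  finally show ?thesis .
qed

lemma integrable_monom_gauss: "integrable lborel (\<lambda>u::real. u ^ n * exp (- u\<^sup>2))"
proof (rule Bochner_Integration.integrable_bound)
  show "integrable lborel (\<lambda>u::real. (fact n * exp 3) * exp (- u\<^sup>2 / 8))"
    by (intro integrable_mult_right integrable_exp_sq_eighth)
  show "AE u in lborel. norm (u ^ n * exp (- u\<^sup>2)) \<le> norm (fact n * exp 3 * exp (- u\<^sup>2 / 8) :: real)"
  proof (intro AE_I2)
    fix u :: real
    have "\<bar>u\<bar> ^ n * exp (- u\<^sup>2) \<le> (1 + \<bar>u\<bar>) ^ n * exp (- u\<^sup>2 / 4)"
      by (intro mult_mono power_mono) auto
    then show "norm (u ^ n * exp (- u\<^sup>2)) \<le> norm (fact n * exp 3 * exp (- u\<^sup>2 / 8) :: real)"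
      using poly_growth_mult_gauss_le [of u n] by (simp add: abs_mult power_abs)
  qed
qed auto

text \<open>An increment of an antiderivative is the integral over an interval containing [-Y, Y].
  Outside it half of the exponent yields the factor in \<open>Y\<close>, and a quarter of it keeps
  the rest integrable.\<close>

lemma monom_gauss_tail:
  fixes a b Y :: real
  assumes "a \<le> - Y" "Y \<le> b" "0 \<le> Y"
    and K: "\<And>u. (K has_real_derivative u ^ n * exp (- u\<^sup>2)) (at u)"
    and C: "\<And>u. \<bar>u ^ n * exp (- u\<^sup>2)\<bar> \<le> C * exp (- u\<^sup>2 / 2)" "0 \<le> C"
  shows "\<bar>(K b - K a) - (\<integral>u. u ^ n * exp (- u\<^sup>2) \<partial>lborel)\<bar>
     \<le> C * (\<integral>u. exp (- u\<^sup>2 / 8) \<partial>lborel) * exp (- Y\<^sup>2 / 4)"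
proof -
  let ?k = "\<lambda>u::real. u ^ n * exp (- u\<^sup>2)"
  have int1: "has_bochner_integral lborel (\<lambda>u. ?k u * indicator {a..b} u) (K b - K a)"
    using assms(1-3) by (intro has_bochner_integral_FTC_Icc_real K) auto
  have int2: "has_bochner_integral lborel ?k (integral\<^sup>L lborel ?k)"
    by (rule has_bochner_integral_integrable [OF integrable_monom_gauss])
  have d: "has_bochner_integral lborel (\<lambda>u. ?k u * indicator {a..b} u - ?k u) ((K b - K a) - integral\<^sup>L lborel ?k)"
    by (rule has_bochner_integral_diff [OF int1 int2])
  have "\<bar>(K b - K a) - integral\<^sup>L lborel ?k\<bar> = \<bar>\<integral>u. ?k u * indicator {a..b} u - ?k u \<partial>lborel\<bar>"
    using has_bochner_integral_integral_eq [OF d] by simp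
  also have "\<dots> \<le> (\<integral>u. \<bar>?k u * indicator {a..b} u - ?k u\<bar> \<partial>lborel)"
    using integral_norm_bound [of lborel "\<lambda>u. ?k u * indicator {a..b} u - ?k u"] by simp
  also have "\<dots> \<le> (\<integral>u. (C * exp (- Y\<^sup>2 / 4)) * exp (- u\<^sup>2 / 8) \<partial>lborel)"
  proof (rule integral_mono)
    show "integrable lborel (\<lambda>u. \<bar>?k u * indicator {a..b} u - ?k u\<bar>)"
      using has_bochner_integral_iff d by (intro integrable_abs) blast
    show "integrable lborel (\<lambda>u. (C * exp (- Y\<^sup>2 / 4)) * exp (- u\<^sup>2 / 8))"
      by (intro integrable_mult_right integrable_exp_sq_eighth)
    fix u :: real
    show "\<bar>?k u * indicator {a..b} u - ?k u\<bar> \<le> (C * exp (- Y\<^sup>2 / 4)) * exp (- u\<^sup>2 / 8)"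
    proof (cases "u \<in> {a..b}")
      case True
      then show ?thesis using C by simp
    next
      case False
      then have "Y \<le> \<bar>u\<bar>" using assms by auto
      then have "Y\<^sup>2 \<le> u\<^sup>2" using \<open>0 \<le> Y\<close> by (simp add: abs_le_square_iff [symmetric])
      then have "- u\<^sup>2 / 2 \<le> - Y\<^sup>2 / 4 + - u\<^sup>2 / 8" using zero_le_power2 [of u] by linarith
      then have "exp (- u\<^sup>2 / 2) \<le> exp (- Y\<^sup>2 / 4) * exp (- u\<^sup>2 / 8)" by (simp flip: exp_add)
      then have "C * exp (- u\<^sup>2 / 2) \<le> C * (exp (- Y\<^sup>2 / 4) * exp (- u\<^sup>2 / 8))"
        using C by (intro mult_left_mono) auto
      then show ?thesis using C(1) [of u] False by simp
    qed
  qed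
  also have "\<dots> = C * (\<integral>u. exp (- u\<^sup>2 / 8) \<partial>lborel) * exp (- Y\<^sup>2 / 4)"
    by simp
  finally show ?thesis .
qed

text \<open>The sum is telescoped \<open>m = q div 12\<close> times. The leading boundary term is
  the integral over the range of the grid, the corrections form a geometric series times the
  Gaussian at distance \<open>Y\<close>, and the remaining sum is of order
  \<open>(1 / 3) ^ m\<close>, hence of order \<open>exp (- q / 12)\<close>.\<close>

lemma monom_gauss_quadrature:
  "\<exists>C\<ge>0. \<forall>(q::nat) (x::real) (Y::real) (a::int) (b::int). 1 \<le> q \<longrightarrow> 0 \<le> Y \<longrightarrow> a / q - x \<le> - Y \<longrightarrow> Y \<le> b / q - x \<longrightarrow>
     \<bar>(\<Sum>k\<in>{a..<b}. (k / q - x) ^ n * exp (- (k / q - x)\<^sup>2) / q) - (\<integral>u. u ^ n * exp (- u\<^sup>2) \<partial>lborel)\<bar>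
       \<le> C * (exp (- real q / 12) + exp (- Y\<^sup>2 / 4))"
proof -
  define F where "F m u = poly (gauss_deriv_poly (monom 1 n) m) u * exp (- u\<^sup>2)" for m and u :: real
  define D where "D = (2 ^ (n + 1) * fact (n + 1) * exp (1 / 2) :: real)"
  have D0: "0 \<le> D" by (simp add: D_def)
  obtain g where g: "deriv_family g" and gF: "\<And>m. g (int m) = F m"
    using exists_deriv_family [of F] DERIV_gauss_deriv_poly [of "monom 1 n"] unfolding F_def by blast
  have F0: "F 0 u = u ^ n * exp (- u\<^sup>2)" for u by (simp add: F_def poly_monom)
  have FB: "\<bar>F m u\<bar> \<le> D * 4 ^ m * fact m * exp (- u\<^sup>2 / 2)" for m u
    using gauss_deriv_bound [of n m u] by (simp add: F_def D_def)
  define K where "K = g (-1)"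
  have K: "(K has_real_derivative u ^ n * exp (- u\<^sup>2)) (at u)" for u
    using g [unfolded deriv_family_def, rule_format, of "-1" u] gF [of 0] by (simp add: K_def F0)
  define D1 where "D1 = D * exp (1 / 2)"
  have D10: "0 \<le> D1" using D0 by (simp add: D1_def)
  define J where "J = (\<integral>u. exp (- u\<^sup>2 / 8) \<partial>(lborel :: real measure))"
  have J0: "0 \<le> J" by (simp add: J_def)
  \<comment> \<open>The factors \<open>exp 1\<close> pay for rounding \<open>q / 12\<close> down to
    \<open>m\<close>; on the first summand the factor serves the case \<open>m = 0\<close>.\<close>
  define C where "C = D * J * exp 1 + 4 * D1 + D1 * (12 * pi) * exp 1"
  have "D * J * 1 \<le> D * J * exp 1" using D0 J0 by (intro mult_left_mono) auto
  moreover have "0 \<le> D * J * exp 1" "0 \<le> D1 * (12 * pi) * exp 1" using D0 D10 J0 by auto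
  ultimately have CA: "D * J + 4 * D1 \<le> C" and CB: "D1 * (12 * pi) * exp 1 \<le> C"
    and CC: "D * J * exp 1 + D1 * (12 * pi) * exp 1 \<le> C"
    using D10 unfolding C_def by linarith+
  show ?thesis
  proof (rule exI [of _ C], intro conjI allI impI)
    show "0 \<le> C" using D0 D10 J0 by (simp add: C_def)
    fix q :: nat and x Y :: real and a b :: int
    assume q: "1 \<le> q" and Y: "0 \<le> Y" and a: "a / q - x \<le> - Y" and b: "Y \<le> b / q - x"
    define \<delta> where "\<delta> = 1 / real q"
    have \<delta>: "0 < \<delta>" "\<delta> \<le> 1" using q by (auto simp: \<delta>_def)
    define m where "m = q div 12"
    have ab: "a \<le> b"
    proof -
      have "a / q \<le> b / q" using a b Y by linarith
      then show ?thesis using q by (simp add: divide_le_cancel)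
    qed
    have md: "real j * \<delta> \<le> 1" if "j \<le> m" for j
      using that q by (simp add: \<delta>_def m_def field_simps)
    \<comment> \<open>At index \<open>i - j\<close> the j-fold defect involves exactly the
      derivative of order \<open>i\<close>. This covers the boundary terms (index -1, so
      \<open>i = j - 1\<close>) and the remainder (index 0, so \<open>i = j = m\<close>).\<close>
    have bd: "\<bar>(rect_defect \<delta> ^^ j) g (int i - int j) u\<bar> \<le> \<delta> ^ j * (D1 * 4 ^ i * fact i * exp (- u\<^sup>2 / 4))"
      if "j \<le> m" for i j u
    proof (rule rect_defect_iter_bound [OF g \<delta>(1)])
      fix v assume v: "u \<le> v" "v \<le> u + real j * \<delta>"
      have "\<bar>v - u\<bar> \<le> 1" using v md [OF that] by simp
      then have "exp (- v\<^sup>2 / 2) \<le> exp (1 / 2) * exp (- u\<^sup>2 / 4)"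
        by (rule exp_neg_sq_half_shift_le)
      then have "D * 4 ^ i * fact i * exp (- v\<^sup>2 / 2) \<le> D * 4 ^ i * fact i * (exp (1 / 2) * exp (- u\<^sup>2 / 4))"
        using D0 by (intro mult_left_mono) auto
      then show "\<bar>g (int i - int j + int j) v\<bar> \<le> D1 * 4 ^ i * fact i * exp (- u\<^sup>2 / 4)"
        using FB [of i v] by (simp add: gF D1_def mult_ac)
    qed
    have third: "\<delta> ^ j * 4 ^ j * fact j \<le> (1 / 3) ^ j" if "j \<le> m" for j
      using power_fact_le_third_power [of j q] that q by (simp add: \<delta>_def m_def)
    let ?R = "\<lambda>j. (rect_defect \<delta> ^^ j) g"
    have bdry: "\<bar>?R (Suc j) (-1) u\<bar> \<le> D1 * (1 / 3) ^ j * exp (- Y\<^sup>2 / 4)"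
      if "Suc j \<le> m" "Y \<le> \<bar>u\<bar>" for j u
    proof -
      have "Y\<^sup>2 \<le> u\<^sup>2" using \<open>0 \<le> Y\<close> that by (simp add: abs_le_square_iff [symmetric])
      then have e: "exp (- u\<^sup>2 / 4) \<le> exp (- Y\<^sup>2 / 4)" by simp
      have "\<bar>?R (Suc j) (-1) u\<bar> \<le> \<delta> ^ Suc j * (D1 * 4 ^ j * fact j * exp (- u\<^sup>2 / 4))"
        using bd [of "Suc j" j u] that by simp
      also have "\<dots> = \<delta> * (\<delta> ^ j * 4 ^ j * fact j) * (D1 * exp (- u\<^sup>2 / 4))" by simp
      also have "\<dots> \<le> 1 * (1 / 3) ^ j * (D1 * exp (- Y\<^sup>2 / 4))"
        using \<delta> that D10 e by (intro mult_mono third) auto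
      finally show ?thesis by (simp add: mult_ac)
    qed
    have geo: "(\<Sum>j<k. (1 / 3 :: real) ^ j) \<le> 2" for k
    proof -
      have "(\<Sum>j<k. (1 / 3 :: real) ^ j) = (1 - (1 / 3) ^ k) * (3 / 2)"
        using sum_gp_strict [of "1 / 3 :: real" k] by simp
      moreover have "0 \<le> (1 / 3 :: real) ^ k" by simp
      ultimately show ?thesis by argo
    qed
    \<comment> \<open>The summand \<open>j = 0\<close> is \<open>K\<close> itself, so the difference
      contains only the corrections; the conditional covers the empty sum.\<close>
    have bsum: "\<bar>(\<Sum>j<m. ?R j (-1) u) - (if m = 0 then 0 else K u)\<bar> \<le> 2 * D1 * exp (- Y\<^sup>2 / 4)"
      if "Y \<le> \<bar>u\<bar>" for u
    proof (cases m)
      case 0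
      then show ?thesis using D10 by simp
    next
      case (Suc m')
      have "(\<Sum>j<m. ?R j (-1) u) - K u = (\<Sum>j<m'. ?R (Suc j) (-1) u)"
        unfolding Suc sum.lessThan_Suc_shift by (simp add: K_def)
      also have "\<bar>\<dots>\<bar> \<le> (\<Sum>j<m'. D1 * (1 / 3) ^ j * exp (- Y\<^sup>2 / 4))"
        using that Suc by (intro order_trans [OF sum_abs] sum_mono bdry) auto
      also have "\<dots> = D1 * exp (- Y\<^sup>2 / 4) * (\<Sum>j<m'. (1 / 3) ^ j)"
        unfolding sum_distrib_left by (intro sum.cong refl) (simp add: mult_ac)
      also have "\<dots> \<le> D1 * exp (- Y\<^sup>2 / 4) * 2"
        using D10 geo by (intro mult_left_mono) auto
      finally show ?thesis using Suc by simp
    qed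
    have rest: "\<bar>\<Sum>k\<in>{a..<b}. \<delta> * ?R m 0 (k * \<delta> - x)\<bar> \<le> D1 * (12 * pi) * (1 / 3) ^ m"
    proof -
      have "\<bar>\<delta> * ?R m 0 u\<bar> \<le> (D1 * (1 / 3) ^ m * 4) * (\<delta> / (1 + u\<^sup>2))" for u
      proof -
        have "\<bar>?R m 0 u\<bar> \<le> (\<delta> ^ m * 4 ^ m * fact m) * (D1 * exp (- u\<^sup>2 / 4))"
          using bd [of m m u] by (simp add: mult_ac)
        also have "\<dots> \<le> (1 / 3) ^ m * (D1 * (4 / (1 + u\<^sup>2)))"
          using D10 by (intro mult_mono third mult_left_mono exp_neg_sq_quarter_le) auto
        finally have "\<delta> * \<bar>?R m 0 u\<bar> \<le> \<delta> * ((1 / 3) ^ m * (D1 * (4 / (1 + u\<^sup>2))))"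
          using \<delta> by (intro mult_left_mono) auto
        then show ?thesis using \<delta> by (simp add: abs_mult mult_ac)
      qed
      then have "\<bar>\<Sum>k\<in>{a..<b}. \<delta> * ?R m 0 (k * \<delta> - x)\<bar> \<le> (\<Sum>k\<in>{a..<b}. (D1 * (1 / 3) ^ m * 4) * (\<delta> / (1 + (k * \<delta> - x)\<^sup>2)))"
        by (intro order_trans [OF sum_abs] sum_mono) 
      also have "\<dots> = (D1 * (1 / 3) ^ m * 4) * (\<Sum>k\<in>{a..<b}. \<delta> / (1 + (k * \<delta> - x)\<^sup>2))"
        by (simp add: sum_distrib_left)
      also have "\<dots> \<le> (D1 * (1 / 3) ^ m * 4) * (3 * pi)"
        using D10 \<delta> by (intro mult_left_mono rect_sum_inverse_square_le) auto
      finally show ?thesis by (simp add: mult_ac)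
    qed
    have third_exp: "(1 / 3 :: real) ^ m \<le> exp 1 * exp (- real q / 12)"
    proof -
      have "exp (1::real) \<le> 3" by (rule exp_le)
      then have "(1 / 3 :: real) \<le> exp (- 1)" by (simp add: exp_minus field_simps)
      then have "(1 / 3 :: real) ^ m \<le> exp (- 1) ^ m" by (intro power_mono) auto
      also have "\<dots> = exp (- real m)" by (simp flip: exp_of_nat_mult)
      also have "\<dots> \<le> exp (1 + (- real q / 12))"
      proof -
        have "q < 12 * m + 12" unfolding m_def by simp
        then have "real q < 12 * real m + 12" by linarith
        then show ?thesis by simp
      qed
      finally show ?thesis by (simp only: exp_add)
    qed
    have uab: "a * \<delta> - x \<le> - Y" "Y \<le> b * \<delta> - x"
      using a b by (auto simp: \<delta>_def)
    let ?I = "\<integral>u. u ^ n * exp (- u\<^sup>2) \<partial>(lborel :: real measure)"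
    have S: "(\<Sum>k\<in>{a..<b}. (k / q - x) ^ n * exp (- (k / q - x)\<^sup>2) / q) = (\<Sum>k\<in>{a..<b}. \<delta> * g 0 (k * \<delta> - x))"
      using gF [of 0] by (intro sum.cong) (auto simp: F0 \<delta>_def)
    show "\<bar>(\<Sum>k\<in>{a..<b}. (k / q - x) ^ n * exp (- (k / q - x)\<^sup>2) / q) - ?I\<bar>
       \<le> C * (exp (- real q / 12) + exp (- Y\<^sup>2 / 4))"
    proof (cases "m = 0")
      case False
      have "\<bar>(K (b * \<delta> - x) - K (a * \<delta> - x)) - ?I\<bar> \<le> D * J * exp (- Y\<^sup>2 / 4)"
        unfolding J_def using FB [of 0] D0 uab Y by (intro monom_gauss_tail K) (auto simp: F0)
      moreover have "\<bar>(\<Sum>j<m. ?R j (-1) (b * \<delta> - x)) - K (b * \<delta> - x)\<bar> \<le> 2 * D1 * exp (- Y\<^sup>2 / 4)"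
        "\<bar>(\<Sum>j<m. ?R j (-1) (a * \<delta> - x)) - K (a * \<delta> - x)\<bar> \<le> 2 * D1 * exp (- Y\<^sup>2 / 4)"
        using bsum [of "b * \<delta> - x"] bsum [of "a * \<delta> - x"] uab Y False by auto
      moreover have "(\<Sum>k\<in>{a..<b}. \<delta> * g 0 (k * \<delta> - x)) =
          (\<Sum>j<m. ?R j (-1) (b * \<delta> - x)) - (\<Sum>j<m. ?R j (-1) (a * \<delta> - x))
          + (\<Sum>k\<in>{a..<b}. \<delta> * ?R m 0 (k * \<delta> - x))"
        using rect_sum_telescope [OF \<delta>(1) ab, of g 0 x m] by (simp add: sum_subtractf)
      ultimately have "\<bar>(\<Sum>k\<in>{a..<b}. \<delta> * g 0 (k * \<delta> - x)) - ?I\<bar>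
          \<le> D * J * exp (- Y\<^sup>2 / 4) + 4 * D1 * exp (- Y\<^sup>2 / 4) + D1 * (12 * pi) * (1 / 3) ^ m"
        using rest by linarith
      also have "\<dots> \<le> (D * J + 4 * D1) * exp (- Y\<^sup>2 / 4) + D1 * (12 * pi) * (exp 1 * exp (- real q / 12))"
        using third_exp D10 by (simp add: algebra_simps mult_left_mono)
      also have "\<dots> \<le> C * exp (- Y\<^sup>2 / 4) + C * exp (- real q / 12)"
        using mult_right_mono [OF CA, of "exp (- Y\<^sup>2 / 4)"] mult_right_mono [OF CB, of "exp (- real q / 12)"]
        by (intro add_mono) (auto simp: mult_ac)
      finally show ?thesis unfolding S by (simp add: algebra_simps)
    next
      \<comment> \<open>Here \<open>q < 12\<close>, so \<open>exp 1 * exp (- q / 12)\<close> is at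
        least 1 and bounding the sum and the integral separately is enough.\<close>
      case True
      have "\<bar>?I\<bar> \<le> D * J"
      proof -
        have "\<bar>?I\<bar> \<le> (\<integral>u. \<bar>u ^ n * exp (- u\<^sup>2)\<bar> \<partial>(lborel :: real measure))"
          by (rule integral_abs_bound)
        also have "\<dots> \<le> (\<integral>u. D * exp (- u\<^sup>2 / 8) \<partial>lborel)"
        proof (intro integral_mono integrable_abs integrable_monom_gauss integrable_mult_right integrable_exp_sq_eighth)
          fix u :: real
          have "D * exp (- u\<^sup>2 / 2) \<le> D * exp (- u\<^sup>2 / 8)" using D0 by (intro mult_left_mono) auto
          then show "\<bar>u ^ n * exp (- u\<^sup>2)\<bar> \<le> D * exp (- u\<^sup>2 / 8)" using FB [of 0 u] by (simp add: F0)
        qed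
        finally show ?thesis by (simp add: J_def)
      qed
      moreover have "(\<Sum>k\<in>{a..<b}. \<delta> * g 0 (k * \<delta> - x)) = (\<Sum>k\<in>{a..<b}. \<delta> * ?R m 0 (k * \<delta> - x))"
        using True by simp
      ultimately have "\<bar>(\<Sum>k\<in>{a..<b}. \<delta> * g 0 (k * \<delta> - x)) - ?I\<bar> \<le> D * J * 1 + D1 * (12 * pi) * 1"
        using rest True by simp
      also have "\<dots> \<le> D * J * (exp 1 * exp (- real q / 12)) + D1 * (12 * pi) * (exp 1 * exp (- real q / 12))"
        using third_exp True D0 J0 D10 by (intro add_mono mult_left_mono) auto
      also have "\<dots> \<le> C * exp (- real q / 12) + C * exp (- Y\<^sup>2 / 4)"
        using mult_right_mono [OF CC, of "exp (- real q / 12)"]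
          mult_nonneg_nonneg [OF \<open>0 \<le> C\<close>, of "exp (- Y\<^sup>2 / 4)"] by (simp add: algebra_simps)
      finally show ?thesis unfolding S by (simp add: algebra_simps)
    qed
  qed
qed

section \<open>Quasi-interpolation weights\<close>

text \<open>Averaging the shifts by \<open>0, \<dots>, N\<close> with weights \<open>w\<close> inverts, on polynomials of degree at most \<open>N\<close>,
  the smoothing by \<open>psi\<close>; sampled with step \<open>1 / q\<close> this holds up to the quadrature error.\<close>

definition quasi_interpolation_weights :: "nat \<Rightarrow> (nat \<Rightarrow> real) \<Rightarrow> real \<Rightarrow> bool" where
  "quasi_interpolation_weights N w C \<longleftrightarrow> 0 \<le> C \<and> (\<Sum>i\<le>N. w i) = 1 \<and>
     (\<forall>n (q::nat) (x::real) (Y::real) (a::int) (b::int). n \<le> N \<longrightarrow> 1 \<le> q \<longrightarrow> 0 \<le> Y \<longrightarrow>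
        a / q - x \<le> - Y \<longrightarrow> Y \<le> b / q - x \<longrightarrow>
        \<bar>(\<Sum>k\<in>{a..<b}. psi (k / q - x) / q * (\<Sum>i\<le>N. w i * (k / q - x + i) ^ n)) - (if n = 0 then 1 else 0)\<bar>
          \<le> C * (exp (- real q / 12) + exp (- Y\<^sup>2 / 4)))"

text \<open>The weights are those for the exact moments of \<open>psi\<close>. A binomial expansion
  reduces the sampled version to grid moments, each off by its quadrature error; summing the
  constants also over \<open>n\<close> gives a single one for all degrees.\<close>

lemma exists_quasi_interpolation_weights: "\<exists>w C. quasi_interpolation_weights N w C"
proof -
  define m where "m l = (\<integral>u. u ^ l * exp (- u\<^sup>2) \<partial>(lborel :: real measure)) / sqrt pi" for l
  have "m 0 = (\<integral>u. psi u \<partial>lborel)" by (simp add: m_def psi_def [abs_def])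
  then have m0: "m 0 = 1" using has_bochner_integral_integral_eq [OF has_bochner_integral_psi] by simp
  obtain w where w: "\<And>n. n \<le> N \<Longrightarrow> (\<Sum>i\<le>N. w i * (\<Sum>l\<le>n. of_nat (n choose l) * m l * real i ^ (n - l))) = (if n = 0 then 1 else 0)"
    using exists_deconvolution_weights [of m N, OF m0] by blast
  have "\<forall>l. \<exists>C. 0 \<le> C \<and> (\<forall>(q::nat) (x::real) (Y::real) (a::int) (b::int). 1 \<le> q \<longrightarrow> 0 \<le> Y \<longrightarrow>
      a / q - x \<le> - Y \<longrightarrow> Y \<le> b / q - x \<longrightarrow>
     \<bar>(\<Sum>k\<in>{a..<b}. (k / q - x) ^ l * exp (- (k / q - x)\<^sup>2) / q) - (\<integral>u. u ^ l * exp (- u\<^sup>2) \<partial>lborel)\<bar>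
       \<le> C * (exp (- real q / 12) + exp (- Y\<^sup>2 / 4)))"
    by (intro allI monom_gauss_quadrature)
  from choice [OF this] obtain Cq where Cq0: "0 \<le> Cq l"
    and Cq: "1 \<le> q \<Longrightarrow> 0 \<le> Y \<Longrightarrow> a / q - x \<le> - Y \<Longrightarrow> Y \<le> b / q - x \<Longrightarrow>
     \<bar>(\<Sum>k\<in>{a..<b}. (k / q - x) ^ l * exp (- (k / q - x)\<^sup>2) / q) - (\<integral>u. u ^ l * exp (- u\<^sup>2) \<partial>lborel)\<bar>
       \<le> Cq l * (exp (- real q / 12) + exp (- Y\<^sup>2 / 4))"
    for l and q :: nat and x Y :: real and a b :: int
    by blast
  define c where "c n i l = \<bar>w i\<bar> * (of_nat (n choose l) * real i ^ (n - l))" for n i l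
  define C where "C = (\<Sum>n\<le>N. \<Sum>i\<le>N. \<Sum>l\<le>n. c n i l * Cq l)"
  have c0: "0 \<le> c n i l" for n i l by (simp add: c_def)
  have C0: "0 \<le> C" unfolding C_def using c0 Cq0 by (intro sum_nonneg mult_nonneg_nonneg) auto
  have "\<bar>(\<Sum>k\<in>{a..<b}. psi (k / q - x) / q * (\<Sum>i\<le>N. w i * (k / q - x + i) ^ n)) - (if n = 0 then 1 else 0)\<bar>
          \<le> C * (exp (- real q / 12) + exp (- Y\<^sup>2 / 4))"
    if n: "n \<le> N" and q: "1 \<le> q" and Y: "0 \<le> Y" and ab: "a / q - x \<le> - Y" "Y \<le> b / q - x"
    for n q :: nat and x Y :: real and a b :: int
  proof -
    define E where "E = exp (- real q / 12) + exp (- Y\<^sup>2 / 4)"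
    have E0: "0 \<le> E" by (simp add: E_def)
    define u where "u k = real_of_int k / q - x" for k
    define S where "S l = (\<Sum>k\<in>{a..<b}. psi (u k) / q * u k ^ l)" for l
    have SE: "\<bar>S l - m l\<bar> \<le> Cq l * E" for l
    proof -
      have "S l - m l = ((\<Sum>k\<in>{a..<b}. u k ^ l * exp (- (u k)\<^sup>2) / q) - (\<integral>u. u ^ l * exp (- u\<^sup>2) \<partial>lborel)) / sqrt pi"
        by (simp add: S_def m_def psi_def diff_divide_distrib sum_divide_distrib mult_ac)
      also have "\<bar>\<dots>\<bar> \<le> Cq l * E / sqrt pi"
        using Cq [OF q Y ab, of l] by (simp add: abs_divide divide_right_mono u_def E_def)
      also have "\<dots> \<le> Cq l * E"
      proof -
        have "1 \<le> sqrt pi" using pi_gt3 by simp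
        then have "(Cq l * E) * 1 \<le> (Cq l * E) * sqrt pi" using Cq0 E0 by (intro mult_left_mono) auto
        then show ?thesis by (simp add: divide_le_eq)
      qed
      finally show ?thesis .
    qed
    have "(\<Sum>k\<in>{a..<b}. psi (u k) / q * (\<Sum>i\<le>N. w i * (u k + i) ^ n))
       = (\<Sum>k\<in>{a..<b}. \<Sum>i\<le>N. \<Sum>l\<le>n. psi (u k) / q * (w i * (of_nat (n choose l) * u k ^ l * real i ^ (n - l))))"
      by (simp only: binomial_ring sum_distrib_left)
    also have "\<dots> = (\<Sum>i\<le>N. \<Sum>l\<le>n. \<Sum>k\<in>{a..<b}. psi (u k) / q * (w i * (of_nat (n choose l) * u k ^ l * real i ^ (n - l))))"
      by (subst sum.swap, rule sum.cong [OF refl], rule sum.swap)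
    also have "\<dots> = (\<Sum>i\<le>N. \<Sum>l\<le>n. w i * (of_nat (n choose l) * real i ^ (n - l)) * S l)"
      unfolding S_def sum_distrib_left by (intro sum.cong refl) (simp add: mult_ac)
    finally have main: "(\<Sum>k\<in>{a..<b}. psi (u k) / q * (\<Sum>i\<le>N. w i * (u k + i) ^ n))
        = (\<Sum>i\<le>N. \<Sum>l\<le>n. w i * (of_nat (n choose l) * real i ^ (n - l)) * S l)" .
    have "(if n = 0 then 1 else 0) = (\<Sum>i\<le>N. \<Sum>l\<le>n. w i * (of_nat (n choose l) * real i ^ (n - l)) * m l)"
      unfolding w [OF n, symmetric] sum_distrib_left by (intro sum.cong refl) (simp add: mult_ac)
    then have "\<bar>(\<Sum>k\<in>{a..<b}. psi (u k) / q * (\<Sum>i\<le>N. w i * (u k + i) ^ n)) - (if n = 0 then 1 else 0)\<bar>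
       = \<bar>\<Sum>i\<le>N. \<Sum>l\<le>n. w i * (of_nat (n choose l) * real i ^ (n - l)) * (S l - m l)\<bar>"
      unfolding main by (simp only: right_diff_distrib sum_subtractf)
    also have "\<dots> \<le> (\<Sum>i\<le>N. \<Sum>l\<le>n. \<bar>w i * (of_nat (n choose l) * real i ^ (n - l)) * (S l - m l)\<bar>)"
      by (rule order_trans [OF sum_abs], rule sum_mono, rule sum_abs)
    also have "\<dots> \<le> (\<Sum>i\<le>N. \<Sum>l\<le>n. c n i l * Cq l * E)"
    proof (intro sum_mono)
      fix i l
      have "\<bar>w i * (of_nat (n choose l) * real i ^ (n - l)) * (S l - m l)\<bar> = c n i l * \<bar>S l - m l\<bar>"
        by (simp add: c_def abs_mult)
      also have "\<dots> \<le> c n i l * (Cq l * E)" by (intro mult_left_mono SE c0)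
      finally show "\<bar>w i * (of_nat (n choose l) * real i ^ (n - l)) * (S l - m l)\<bar> \<le> c n i l * Cq l * E"
        by simp
    qed
    also have "\<dots> = (\<Sum>i\<le>N. \<Sum>l\<le>n. c n i l * Cq l) * E"
      by (simp add: sum_distrib_right)
    also have "\<dots> \<le> C * E"
    proof (intro mult_right_mono E0)
      show "(\<Sum>i\<le>N. \<Sum>l\<le>n. c n i l * Cq l) \<le> C"
        unfolding C_def using n c0 Cq0
        by (intro member_le_sum [of n "{..N}" "\<lambda>n. \<Sum>i\<le>N. \<Sum>l\<le>n. c n i l * Cq l"]) (auto intro!: sum_nonneg mult_nonneg_nonneg)
    qed
    finally show ?thesis unfolding E_def u_def .
  qed
  moreover have "(\<Sum>i\<le>N. w i) = 1" using w [of 0] m0 by simp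
  ultimately have "quasi_interpolation_weights N w C"
    unfolding quasi_interpolation_weights_def using C0 by blast
  then show ?thesis by blast
qed


section \<open>Log-densities with a Taylor expansion\<close>

text \<open>The local information extracted from the class. It is stated for the logarithm so that
  all errors are relative to \<open>f x\<close>, with one majorant \<open>W\<close> for the
  coefficients and the remainder.\<close>

definition log_taylor ::
  "nat \<Rightarrow> real \<Rightarrow> real \<Rightarrow> (real \<Rightarrow> real) \<Rightarrow> (real \<Rightarrow> nat \<Rightarrow> real) \<Rightarrow> (real \<Rightarrow> real) \<Rightarrow> bool" where
  "log_taylor r \<beta> \<gamma> W c f \<longleftrightarrow> (\<forall>x. 0 < f x) \<and> (\<forall>x. \<forall>j\<in>{1..r}. \<bar>c x j\<bar> \<le> W x) \<and>
     (\<forall>x v. \<bar>v\<bar> \<le> \<gamma> \<longrightarrow>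
        \<bar>ln (f (x + v)) - ln (f x) - (\<Sum>j=1..r. c x j * v ^ j)\<bar> \<le> W x * \<bar>v\<bar> powr \<beta>)"

lemma abs_exp_minus_one_le:
  fixes s :: real
  shows "\<bar>exp s - 1\<bar> \<le> \<bar>s\<bar> * exp \<bar>s\<bar>"
proof -
  obtain t where t: "\<bar>t\<bar> \<le> \<bar>s\<bar>" "exp s = (\<Sum>m<1. s ^ m / fact m) + exp t / fact 1 * s ^ 1"
    using Maclaurin_exp_le [of s 1] by blast
  then have "\<bar>exp s - 1\<bar> = \<bar>s\<bar> * exp t" by (simp add: abs_mult)
  also have "\<dots> \<le> \<bar>s\<bar> * exp \<bar>s\<bar>" using t by (intro mult_left_mono) auto
  finally show ?thesis .
qed

lemma abs_exp_minus_taylor_le: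
  fixes s :: real
  shows "\<bar>exp s - (\<Sum>i\<le>r. s ^ i / fact i)\<bar> \<le> \<bar>s\<bar> ^ Suc r * exp \<bar>s\<bar>"
proof -
  obtain t where t: "\<bar>t\<bar> \<le> \<bar>s\<bar>" "exp s = (\<Sum>m<Suc r. s ^ m / fact m) + exp t / fact (Suc r) * s ^ Suc r"
    using Maclaurin_exp_le [of s "Suc r"] by blast
  have "\<bar>exp s - (\<Sum>i\<le>r. s ^ i / fact i)\<bar> = exp t / fact (Suc r) * \<bar>s\<bar> ^ Suc r"
    unfolding t(2) lessThan_Suc_atMost by (simp add: abs_mult power_abs del: fact_Suc power_Suc)
  also have "\<dots> \<le> exp \<bar>s\<bar> * \<bar>s\<bar> ^ Suc r"
  proof (intro mult_right_mono)
    have "1 \<le> (fact (Suc r) :: real)" by (rule fact_ge_1)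
    then have "exp t / fact (Suc r) \<le> exp t / 1" by (intro divide_left_mono) auto
    then show "exp t / fact (Suc r) \<le> exp \<bar>s\<bar>" using t(1) by (auto intro: order_trans)
  qed simp
  finally show ?thesis by (simp add: mult_ac)
qed

text \<open>The first-order companion of the expansion below. Its bound becomes small with
  \<open>W x * \<bar>v\<bar>\<close> and \<open>W x * \<bar>v\<bar> powr \<beta>\<close>, which is
  what makes the masses positive although some weights may be negative.\<close>

lemma relative_increment_le:
  assumes f: "log_taylor r \<beta> \<gamma> W c f"
    and v: "\<bar>v\<bar> \<le> \<gamma>" "\<bar>v\<bar> \<le> 1" "W x * \<bar>v\<bar> \<le> 1" "W x * \<bar>v\<bar> powr \<beta> \<le> 1"
  shows "\<bar>f (x + v) / f x - 1\<bar> \<le> exp (real r + 1) * (real r * (W x * \<bar>v\<bar>) + W x * \<bar>v\<bar> powr \<beta>)"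
proof -
  define P where "P = (\<Sum>j=1..r. c x j * v ^ j)"
  define s where "s = ln (f (x + v)) - ln (f x)"
  have pos: "0 < f y" for y using f by (simp add: log_taylor_def)
  have P: "\<bar>P\<bar> \<le> real r * (W x * \<bar>v\<bar>)"
  proof -
    have "\<bar>P\<bar> \<le> (\<Sum>j=1..r. W x * \<bar>v\<bar>)"
      unfolding P_def
    proof (rule order_trans [OF sum_abs], rule sum_mono)
      fix j assume j: "j \<in> {1..r}"
      have "\<bar>v\<bar> ^ j \<le> \<bar>v\<bar> ^ 1" using j v by (intro power_decreasing) auto
      moreover have "\<bar>c x j\<bar> \<le> W x" using f j by (simp add: log_taylor_def)
      ultimately show "\<bar>c x j * v ^ j\<bar> \<le> W x * \<bar>v\<bar>"
        by (auto simp: abs_mult power_abs intro!: mult_mono intro: order_trans [OF abs_ge_zero])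
    qed
    then show ?thesis by simp
  qed
  have "\<bar>s - P\<bar> \<le> W x * \<bar>v\<bar> powr \<beta>"
    using f v(1) by (simp add: log_taylor_def s_def P_def)
  then have s: "\<bar>s\<bar> \<le> real r * (W x * \<bar>v\<bar>) + W x * \<bar>v\<bar> powr \<beta>" using P by linarith
  have "real r * (W x * \<bar>v\<bar>) \<le> real r * 1" using v by (intro mult_left_mono) auto
  then have s1: "\<bar>s\<bar> \<le> real r + 1" using s v by linarith
  have "f (x + v) / f x = exp s" using pos by (simp add: s_def exp_diff)
  then have "\<bar>f (x + v) / f x - 1\<bar> \<le> \<bar>s\<bar> * exp \<bar>s\<bar>" using abs_exp_minus_one_le by simp
  also have "\<dots> \<le> (real r * (W x * \<bar>v\<bar>) + W x * \<bar>v\<bar> powr \<beta>) * exp (real r + 1)"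
    using s s1 by (intro mult_mono) auto
  finally show ?thesis by (simp add: mult_ac)
qed

text \<open>The exponential series is truncated but not the resulting polynomial, hence the degree \<open>r * r\<close>
  instead of \<open>r\<close>; the weights below are taken exact to that degree.\<close>

lemma relative_expansion:
  assumes f: "log_taylor r \<beta> \<gamma> W c f" and W: "1 \<le> W x" and \<beta>: "0 < \<beta>" "\<beta> \<le> real r + 1"
  obtains Q :: "real poly" where "degree Q \<le> r * r" "coeff Q 0 = 1"
    "coeff_norm Q \<le> (real r + 1) ^ Suc r * W x ^ r"
    "\<And>v. \<lbrakk>\<bar>v\<bar> \<le> \<gamma>; \<bar>v\<bar> \<le> 1; W x * \<bar>v\<bar> \<le> 1; W x * \<bar>v\<bar> powr \<beta> \<le> 1\<rbrakk> \<Longrightarrow>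
       \<bar>f (x + v) / f x - poly Q v\<bar> \<le> (exp (real r + 1) + real r ^ Suc r * exp (real r)) * W x ^ Suc r * \<bar>v\<bar> powr \<beta>"
proof
  \<comment> \<open>The Taylor polynomial of \<open>ln f\<close> at \<open>x\<close> without its
    constant term; the vanishing at 0 gives \<open>coeff Q 0 = 1\<close> and makes \<open>P\<close>
    of order \<open>W x * \<bar>v\<bar>\<close>.\<close>
  define P where "P = (\<Sum>j=1..r. monom (c x j) j)"
  define Q where "Q = (\<Sum>i\<le>r. smult (1 / fact i) (P ^ i))"
  have pos: "0 < f y" for y using f by (simp add: log_taylor_def)
  have c: "\<bar>c x j\<bar> \<le> W x" if "j \<in> {1..r}" for j using f that by (simp add: log_taylor_def)
  have dP: "degree P \<le> r"
    unfolding P_def by (intro degree_sum_le) (auto intro: order_trans [OF degree_monom_le])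
  show "degree Q \<le> r * r"
    unfolding Q_def
  proof (intro degree_sum_le)
    fix i assume i: "i \<in> {..r}"
    have "degree (P ^ i) \<le> degree P * i" by (rule degree_power_le)
    also have "\<dots> \<le> r * r" using dP i by (intro mult_mono) auto
    finally show "degree (smult (1 / fact i) (P ^ i)) \<le> r * r" by simp
  qed auto
  have "poly P 0 = 0" by (auto simp: P_def poly_sum poly_monom)
  then have "poly Q 0 = (\<Sum>i\<le>r. 0 ^ i / fact i)" by (simp add: Q_def poly_sum)
  also have "\<dots> = 1" by (subst sum.atMost_shift) simp
  finally show "coeff Q 0 = 1" by (simp add: poly_0_coeff_0)
  have nP: "coeff_norm P \<le> real r * W x"
  proof -
    have "coeff_norm (monom a j) = \<bar>a\<bar>" for a j
    proof (cases "a = 0")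
      case False
      then show ?thesis by (simp add: coeff_norm_def degree_monom_eq if_distrib [of abs] sum.delta cong: if_cong)
    qed simp
    then have "coeff_norm P \<le> (\<Sum>j=1..r. \<bar>c x j\<bar>)"
      unfolding P_def by (intro order_trans [OF coeff_norm_sum_le]) simp
    also have "\<dots> \<le> (\<Sum>j=1..r. W x)" by (intro sum_mono c)
    finally show ?thesis by simp
  qed
  have "coeff_norm Q \<le> (\<Sum>i\<le>r. coeff_norm (smult (1 / fact i) (P ^ i)))"
    unfolding Q_def by (rule coeff_norm_sum_le)
  also have "\<dots> \<le> (\<Sum>i\<le>r. ((real r + 1) * W x) ^ r)"
  proof (rule sum_mono)
    fix i assume i: "i \<in> {..r}"
    have "coeff_norm (smult (1 / fact i) (P ^ i)) \<le> 1 * coeff_norm (P ^ i)"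
      unfolding coeff_norm_smult by (intro mult_right_mono coeff_norm_nonneg) (auto simp: fact_ge_1)
    also have "\<dots> \<le> coeff_norm P ^ i" using coeff_norm_power_le by simp
    also have "\<dots> \<le> ((real r + 1) * W x) ^ i"
      using nP W by (intro power_mono coeff_norm_nonneg) (auto simp: algebra_simps)
    also have "\<dots> \<le> ((real r + 1) * W x) ^ r"
    proof (intro power_increasing)
      have "1 * 1 \<le> (real r + 1) * W x" using W by (intro mult_mono) auto
      then show "1 \<le> (real r + 1) * W x" by simp
    qed (use i in auto)
    finally show "coeff_norm (smult (1 / fact i) (P ^ i)) \<le> ((real r + 1) * W x) ^ r" .
  qed
  also have "\<dots> = (real r + 1) ^ Suc r * W x ^ r"
    by (simp add: power_mult_distrib)
  finally show "coeff_norm Q \<le> (real r + 1) ^ Suc r * W x ^ r" .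
  fix v assume v: "\<bar>v\<bar> \<le> \<gamma>" "\<bar>v\<bar> \<le> 1" "W x * \<bar>v\<bar> \<le> 1" "W x * \<bar>v\<bar> powr \<beta> \<le> 1"
  define s where "s = ln (f (x + v)) - ln (f x)"
  have pv: "poly P v = (\<Sum>j=1..r. c x j * v ^ j)" by (simp add: P_def poly_sum poly_monom)
  have pb: "\<bar>poly P v\<bar> \<le> real r * (W x * \<bar>v\<bar>)"
  proof -
    have "\<bar>poly P v\<bar> \<le> (\<Sum>j=1..r. W x * \<bar>v\<bar>)"
      unfolding pv
    proof (rule order_trans [OF sum_abs], rule sum_mono)
      fix j assume j: "j \<in> {1..r}"
      have "\<bar>v\<bar> ^ j \<le> \<bar>v\<bar> ^ 1" using j v by (intro power_decreasing) auto
      then show "\<bar>c x j * v ^ j\<bar> \<le> W x * \<bar>v\<bar>"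
        using c [OF j] W by (auto simp: abs_mult power_abs intro!: mult_mono)
    qed
    then show ?thesis by simp
  qed
  have "real r * (W x * \<bar>v\<bar>) \<le> real r * 1" using v by (intro mult_left_mono) auto
  then have pr: "\<bar>poly P v\<bar> \<le> real r" using pb by simp
  define \<rho> where "\<rho> = s - poly P v"
  have \<rho>: "\<bar>\<rho>\<bar> \<le> W x * \<bar>v\<bar> powr \<beta>"
    using f v(1) by (simp add: log_taylor_def s_def pv \<rho>_def)
  then have \<rho>1: "\<bar>\<rho>\<bar> \<le> 1" using v by linarith
  \<comment> \<open>Two errors: the Taylor remainder \<rho> inside the exponential, and the
    truncation of the exponential series. The latter has order \<open>\<bar>v\<bar> ^ Suc r\<close>,
    which is at most \<open>\<bar>v\<bar> powr \<beta>\<close> because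
    \<open>\<beta> \<le> r + 1\<close> and \<open>\<bar>v\<bar> \<le> 1\<close>.\<close>
  have 1: "\<bar>exp s - exp (poly P v)\<bar> \<le> exp (real r + 1) * (W x ^ Suc r * \<bar>v\<bar> powr \<beta>)"
  proof -
    have "exp s = exp (poly P v) * exp \<rho>" by (simp add: \<rho>_def flip: exp_add)
    then have "\<bar>exp s - exp (poly P v)\<bar> = \<bar>exp (poly P v) * (exp \<rho> - 1)\<bar>" by (simp add: algebra_simps)
    also have "\<dots> = exp (poly P v) * \<bar>exp \<rho> - 1\<bar>" by (simp add: abs_mult)
    also have "\<dots> \<le> exp (real r) * (\<bar>\<rho>\<bar> * exp \<bar>\<rho>\<bar>)"
      using pr by (intro mult_mono abs_exp_minus_one_le) auto
    also have "\<dots> \<le> exp (real r) * ((W x * \<bar>v\<bar> powr \<beta>) * exp 1)"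
      using \<rho> \<rho>1 W by (intro mult_mono) auto
    also have "\<dots> = exp (real r + 1) * (W x ^ 1 * \<bar>v\<bar> powr \<beta>)"
      by (simp add: exp_add mult_ac)
    also have "\<dots> \<le> exp (real r + 1) * (W x ^ Suc r * \<bar>v\<bar> powr \<beta>)"
      using W by (intro mult_left_mono mult_right_mono power_increasing) auto
    finally show ?thesis .
  qed
  have 2: "\<bar>exp (poly P v) - poly Q v\<bar> \<le> (real r ^ Suc r * exp (real r)) * (W x ^ Suc r * \<bar>v\<bar> powr \<beta>)"
  proof -
    have "poly Q v = (\<Sum>i\<le>r. poly P v ^ i / fact i)"
      by (simp add: Q_def poly_sum)
    then have "\<bar>exp (poly P v) - poly Q v\<bar> \<le> \<bar>poly P v\<bar> ^ Suc r * exp \<bar>poly P v\<bar>"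
      using abs_exp_minus_taylor_le by simp
    also have "\<dots> \<le> (real r * (W x * \<bar>v\<bar>)) ^ Suc r * exp (real r)"
      using pb pr by (intro mult_mono power_mono) auto
    also have "\<dots> = (real r ^ Suc r * exp (real r)) * (W x ^ Suc r * \<bar>v\<bar> ^ Suc r)"
      by (simp add: power_mult_distrib mult_ac)
    also have "\<dots> \<le> (real r ^ Suc r * exp (real r)) * (W x ^ Suc r * \<bar>v\<bar> powr \<beta>)"
    proof (intro mult_left_mono)
      show "\<bar>v\<bar> ^ Suc r \<le> \<bar>v\<bar> powr \<beta>"
      proof (cases "v = 0")
        case False
        then have "\<bar>v\<bar> ^ Suc r = \<bar>v\<bar> powr real (Suc r)" by (simp add: powr_realpow del: power_Suc of_nat_Suc)
        also have "\<dots> \<le> \<bar>v\<bar> powr \<beta>" using v \<beta> False by (intro powr_mono') auto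
        finally show ?thesis .
      qed simp
    qed (use W in auto)
    finally show ?thesis .
  qed
  have "f (x + v) / f x = exp s" using pos by (simp add: s_def exp_diff)
  then have "\<bar>f (x + v) / f x - poly Q v\<bar> \<le> \<bar>exp s - exp (poly P v)\<bar> + \<bar>exp (poly P v) - poly Q v\<bar>"
    by linarith
  also have "\<dots> \<le> exp (real r + 1) * (W x ^ Suc r * \<bar>v\<bar> powr \<beta>) + (real r ^ Suc r * exp (real r)) * (W x ^ Suc r * \<bar>v\<bar> powr \<beta>)"
    using 1 2 by linarith
  finally show "\<bar>f (x + v) / f x - poly Q v\<bar> \<le> (exp (real r + 1) + real r ^ Suc r * exp (real r)) * W x ^ Suc r * \<bar>v\<bar> powr \<beta>"
    by (simp add: algebra_simps)
qed

section \<open>Polynomial growth of the derivatives of the log-density\<close>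

text \<open>Walk from 0 to \<open>x\<close> in equal steps of length at most \<gamma>; their number
  is linear in \<open>\<bar>x\<bar>\<close>, which accounts for the extra degree.\<close>

lemma growth_of_local_oscillation:
  fixes g :: "real \<Rightarrow> real"
  assumes "0 < \<gamma>" "0 \<le> A" and osc: "\<And>x y. \<bar>y - x\<bar> \<le> \<gamma> \<Longrightarrow> \<bar>g x - g y\<bar> \<le> A * (1 + \<bar>x\<bar>) ^ d"
  shows "\<bar>g x - g 0\<bar> \<le> (1 / \<gamma> + 1) * A * (1 + \<bar>x\<bar>) ^ Suc d"
proof (cases "x = 0")
  case False
  define n where "n = nat \<lceil>\<bar>x\<bar> / \<gamma>\<rceil>"
  have "0 < \<bar>x\<bar> / \<gamma>" using False assms by simp
  then have n: "0 < n" "\<bar>x\<bar> / \<gamma> \<le> real n" "real n \<le> \<bar>x\<bar> / \<gamma> + 1" unfolding n_def by linarith+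
  define p where "p i = real i * x / real n" for i
  have "g x - g 0 = g (p n) - g (p 0)" using n by (simp add: p_def)
  also have "\<dots> = (\<Sum>i<n. g (p (Suc i)) - g (p i))" by (rule sum_lessThan_telescope [symmetric])
  also have "\<bar>\<dots>\<bar> \<le> (\<Sum>i<n. A * (1 + \<bar>x\<bar>) ^ d)"
  proof (rule order_trans [OF sum_abs], rule sum_mono)
    fix i assume i: "i \<in> {..<n}"
    have "p (Suc i) - p i = x / real n" using n by (simp add: p_def field_simps)
    moreover have "\<bar>x\<bar> / real n \<le> \<gamma>" using n assms by (simp add: field_simps)
    ultimately have "\<bar>p (Suc i) - p i\<bar> \<le> \<gamma>" by simp
    then have "\<bar>g (p i) - g (p (Suc i))\<bar> \<le> A * (1 + \<bar>p i\<bar>) ^ d" by (rule osc)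
    also have "\<dots> \<le> A * (1 + \<bar>x\<bar>) ^ d"
    proof (intro mult_left_mono power_mono add_left_mono)
      have "real i * \<bar>x\<bar> \<le> real n * \<bar>x\<bar>" using i by (intro mult_right_mono) auto
      then show "\<bar>p i\<bar> \<le> \<bar>x\<bar>" using n by (simp add: p_def abs_mult divide_le_eq mult_ac)
    qed (use assms in auto)
    finally show "\<bar>g (p (Suc i)) - g (p i)\<bar> \<le> A * (1 + \<bar>x\<bar>) ^ d" by linarith
  qed
  also have "\<dots> = real n * (A * (1 + \<bar>x\<bar>) ^ d)" by simp
  also have "\<dots> \<le> ((1 / \<gamma> + 1) * (1 + \<bar>x\<bar>)) * (A * (1 + \<bar>x\<bar>) ^ d)"
  proof (intro mult_right_mono)
    have "\<bar>x\<bar> / \<gamma> + 1 \<le> (1 / \<gamma> + 1) * (1 + \<bar>x\<bar>)" using assms by (simp add: field_simps)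
    then show "real n \<le> (1 / \<gamma> + 1) * (1 + \<bar>x\<bar>)" using n by linarith
  qed (use assms in auto)
  finally show ?thesis by (simp add: mult_ac)
qed (use assms in simp)

lemma growth_of_deriv:
  fixes g :: "real \<Rightarrow> real"
  assumes "\<And>x. g differentiable (at x)" "\<And>x. \<bar>deriv g x\<bar> \<le> A * (1 + \<bar>x\<bar>) ^ d" "0 \<le> A"
  shows "\<bar>g x\<bar> \<le> \<bar>g 0\<bar> + A * (1 + \<bar>x\<bar>) ^ Suc d"
proof -
  have D: "(g has_real_derivative deriv g y) (at y)" for y
    using assms(1) by (simp add: DERIV_deriv_iff_real_differentiable)
  have "norm (g x - g 0) \<le> (A * (1 + \<bar>x\<bar>) ^ d) * norm (x - 0)"
  proof (rule field_differentiable_bound [of "closed_segment 0 x" g "deriv g"])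
    fix y assume y: "y \<in> closed_segment 0 x"
    then have "\<bar>y\<bar> \<le> \<bar>x\<bar>" by (auto simp: closed_segment_eq_real_ivl split: if_splits)
    then have "A * (1 + \<bar>y\<bar>) ^ d \<le> A * (1 + \<bar>x\<bar>) ^ d"
      using assms(3) by (intro mult_left_mono power_mono) auto
    then show "norm (deriv g y) \<le> A * (1 + \<bar>x\<bar>) ^ d" using assms(2) [of y] by simp
    show "(g has_field_derivative deriv g y) (at y within closed_segment 0 x)"
      using D by (rule has_field_derivative_at_within)
  qed auto
  also have "\<dots> \<le> (A * (1 + \<bar>x\<bar>) ^ d) * (1 + \<bar>x\<bar>)" using assms(3) by (intro mult_left_mono) auto
  finally have "\<bar>g x - g 0\<bar> \<le> A * (1 + \<bar>x\<bar>) ^ Suc d" by (simp add: mult_ac)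
  then show ?thesis by linarith
qed

lemma rr_eqD:
  assumes "0 < \<beta>" "rr \<beta> = r"
  shows "real r < \<beta>" "\<beta> \<le> real r + 1"
  using assms unfolding rr_def by linarith+

text \<open>\<open>W0\<close> and \<open>d\<close> are chosen before \<beta> and \<open>f\<close>,
  so they depend on \<beta> only through \<open>r\<close>. The Hoelder condition bounds the top
  derivative by chaining from 0; the lower ones follow by integration from their values at 0, each
  gaining one degree.\<close>

lemma Hclass_log_taylor:
  assumes "0 < \<gamma>" "0 < lp"
  shows "\<exists>W0 d. 1 \<le> W0 \<and> (\<forall>\<beta> f. 0 < \<beta> \<longrightarrow> rr \<beta> = r \<longrightarrow> f \<in> Hclass \<beta> \<gamma> lp L \<epsilon> C \<alpha> \<xi> M \<longrightarrow>
     log_taylor r \<beta> \<gamma> (\<lambda>x. W0 * (1 + \<bar>x\<bar>) ^ d) (\<lambda>x j. dlog j f x / fact j) f \<and>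
     (\<forall>x. \<bar>ln (f x)\<bar> \<le> W0 * (1 + \<bar>x\<bar>) ^ d))"
proof -
  define cL where "cL = coeff_norm L"
  define dL where "dL = degree L"
  define A where "A = fact r * cL * (1 + \<gamma>)"
  define K where "K = lp + (1 / \<gamma> + 1) * A"
  define W0 where "W0 = K + real r * lp + cL + 1"
  define d where "d = dL + 1 + r"
  have L: "\<bar>poly L x\<bar> \<le> cL * (1 + \<bar>x\<bar>) ^ dL" for x
    unfolding cL_def dL_def by (rule abs_poly_le_coeff_norm)
  have cL0: "0 \<le> cL" by (simp add: cL_def coeff_norm_nonneg)
  have A0: "0 \<le> A" using cL0 assms by (simp add: A_def)
  have K0: "0 \<le> K" using A0 assms by (simp add: K_def)
  have W01: "1 \<le> W0" using K0 cL0 assms by (simp add: W0_def)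
  have "log_taylor r \<beta> \<gamma> (\<lambda>x. W0 * (1 + \<bar>x\<bar>) ^ d) (\<lambda>x j. dlog j f x / fact j) f \<and>
     (\<forall>x. \<bar>ln (f x)\<bar> \<le> W0 * (1 + \<bar>x\<bar>) ^ d)"
    if \<beta>: "0 < \<beta>" "rr \<beta> = r" and f: "f \<in> Hclass \<beta> \<gamma> lp L \<epsilon> C \<alpha> \<xi> M" for \<beta> f
  proof -
    note r\<beta> = rr_eqD [OF \<beta>]
    have diff: "dlog j f differentiable (at x)" if "j < r" for j x
      using f that \<beta> by (simp add: Hclass_def)
    have holder: "\<bar>dlog r f x - dlog r f y\<bar> \<le> fact r * poly L x * \<bar>y - x\<bar> powr (\<beta> - real r)"
      if "\<bar>y - x\<bar> \<le> \<gamma>" for x y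
      using f that \<beta> by (simp add: Hclass_def)
    have zero: "\<bar>dlog j f 0\<bar> \<le> lp" if "j \<le> r" for j
      using f that \<beta> by (simp add: Hclass_def)
    have pos: "0 < f x" for x using f by (simp add: Hclass_def)
    \<comment> \<open>The exponent \<open>\<beta> - r\<close> lies in (0, 1], so replacing the power
      by \<open>1 + \<gamma>\<close> frees \<open>A\<close> from \<beta>.\<close>
    have osc: "\<bar>dlog r f x - dlog r f y\<bar> \<le> A * (1 + \<bar>x\<bar>) ^ dL" if xy: "\<bar>y - x\<bar> \<le> \<gamma>" for x y
    proof -
      have "\<bar>y - x\<bar> powr (\<beta> - real r) \<le> \<gamma> powr (\<beta> - real r)"
        using xy r\<beta> by (intro powr_mono2) auto
      also have "\<dots> \<le> (1 + \<gamma>) powr (\<beta> - real r)"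
        using assms r\<beta> by (intro powr_mono2) auto
      also have "\<dots> \<le> (1 + \<gamma>) powr 1"
        using assms r\<beta> by (intro powr_mono) auto
      finally have p: "\<bar>y - x\<bar> powr (\<beta> - real r) \<le> 1 + \<gamma>" using assms by simp
      have "fact r * poly L x * \<bar>y - x\<bar> powr (\<beta> - real r) \<le> fact r * \<bar>poly L x\<bar> * \<bar>y - x\<bar> powr (\<beta> - real r)"
        by (intro mult_right_mono mult_left_mono) auto
      also have "\<dots> \<le> fact r * (cL * (1 + \<bar>x\<bar>) ^ dL) * (1 + \<gamma>)"
        using p L [of x] cL0 by (intro mult_mono) auto
      also have "\<dots> = A * (1 + \<bar>x\<bar>) ^ dL" by (simp add: A_def mult_ac)
      finally show ?thesis using holder [OF xy] by linarith
    qed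
    \<comment> \<open>The induction descends from order \<open>r\<close>, the only one that the
      Hoelder condition controls.\<close>
    have growth: "\<bar>dlog (r - i) f x\<bar> \<le> (K + real i * lp) * (1 + \<bar>x\<bar>) ^ (dL + 1 + i)" if "i \<le> r" for i x
      using that
    proof (induction i arbitrary: x)
      case 0
      have "\<bar>dlog r f x - dlog r f 0\<bar> \<le> (1 / \<gamma> + 1) * A * (1 + \<bar>x\<bar>) ^ Suc dL"
        using assms A0 osc by (intro growth_of_local_oscillation) auto
      moreover have "lp * 1 \<le> lp * (1 + \<bar>x\<bar>) ^ Suc dL"
        using assms by (intro mult_left_mono one_le_power) auto
      ultimately have "\<bar>dlog r f x\<bar> \<le> lp * (1 + \<bar>x\<bar>) ^ Suc dL + (1 / \<gamma> + 1) * A * (1 + \<bar>x\<bar>) ^ Suc dL"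
        using zero [of r] by linarith
      also have "\<dots> = K * (1 + \<bar>x\<bar>) ^ Suc dL"
        unfolding K_def by (simp add: distrib_right del: power_Suc)
      finally show ?case by simp
    next
      case (Suc i)
      let ?j = "r - Suc i"
      have Sj: "r - i = Suc ?j" using Suc.prems by simp
      have D: "deriv (dlog ?j f) = dlog (r - i) f" unfolding Sj by (simp add: dlog_def)
      have "\<bar>dlog ?j f x\<bar> \<le> \<bar>dlog ?j f 0\<bar> + (K + real i * lp) * (1 + \<bar>x\<bar>) ^ Suc (dL + 1 + i)"
      proof (rule growth_of_deriv)
        show "dlog ?j f differentiable (at x)" for x using Suc.prems by (intro diff) auto
        show "\<bar>deriv (dlog ?j f) x\<bar> \<le> (K + real i * lp) * (1 + \<bar>x\<bar>) ^ (dL + 1 + i)" for x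
          unfolding D using Suc.IH Suc.prems by simp
        show "0 \<le> K + real i * lp" using K0 assms by simp
      qed
      moreover have "\<bar>dlog ?j f 0\<bar> \<le> lp" by (rule zero) simp
      moreover have "lp * 1 \<le> lp * (1 + \<bar>x\<bar>) ^ Suc (dL + 1 + i)"
        using assms by (intro mult_left_mono one_le_power) auto
      ultimately have "\<bar>dlog ?j f x\<bar> \<le> lp * (1 + \<bar>x\<bar>) ^ Suc (dL + 1 + i) + (K + real i * lp) * (1 + \<bar>x\<bar>) ^ Suc (dL + 1 + i)"
        by linarith
      also have "\<dots> = (K + real (Suc i) * lp) * (1 + \<bar>x\<bar>) ^ (dL + 1 + Suc i)"
        unfolding distrib_right [symmetric] by (simp add: algebra_simps del: power_Suc)
      finally show ?case .
    qed
    have W: "\<bar>dlog j f x\<bar> \<le> W0 * (1 + \<bar>x\<bar>) ^ d" if "j \<le> r" for j x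
    proof -
      have "\<bar>dlog (r - (r - j)) f x\<bar> \<le> (K + real (r - j) * lp) * (1 + \<bar>x\<bar>) ^ (dL + 1 + (r - j))"
        by (rule growth) simp
      also have "\<dots> \<le> W0 * (1 + \<bar>x\<bar>) ^ d"
      proof (intro mult_mono power_increasing)
        have "real (r - j) * lp \<le> real r * lp" using assms by (intro mult_right_mono) auto
        then show "K + real (r - j) * lp \<le> W0" using cL0 by (simp add: W0_def)
      qed (use W01 in \<open>auto simp: d_def\<close>)
      finally show ?thesis using that by simp
    qed
    have LW: "poly L x \<le> W0 * (1 + \<bar>x\<bar>) ^ d" for x
    proof -
      have "poly L x \<le> cL * (1 + \<bar>x\<bar>) ^ dL" using L [of x] by linarith
      also have "\<dots> \<le> W0 * (1 + \<bar>x\<bar>) ^ d"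
        using K0 assms cL0 by (intro mult_mono power_increasing) (auto simp: W0_def d_def)
      finally show ?thesis .
    qed
    have taylor: "\<bar>ln (f (x + v)) - ln (f x) - (\<Sum>j=1..r. dlog j f x / fact j * v ^ j)\<bar>
        \<le> W0 * (1 + \<bar>x\<bar>) ^ d * \<bar>v\<bar> powr \<beta>" if v: "\<bar>v\<bar> \<le> \<gamma>" for x v
    proof (cases "v = 0")
      case True
      then show ?thesis using W01 by (simp add: power_0_left)
    next
      case False
      \<comment> \<open>Expanding only to order \<open>r - 1\<close> puts the r-th derivative at an
        intermediate point; exchanging it for its value at \<open>x\<close> leaves a Hoelder
        difference.\<close>
      have "\<exists>t. \<bar>t\<bar> \<le> \<bar>v\<bar> \<and> ln (f (x + v)) = (\<Sum>m<r. dlog m f (x + 0) / fact m * v ^ m) + dlog r f (x + t) / fact r * v ^ r"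
      proof (rule Maclaurin_bi_le [of "\<lambda>m t. dlog m f (x + t)" "\<lambda>t. ln (f (x + t))"])
        show "(\<lambda>t. dlog 0 f (x + t)) = (\<lambda>t. ln (f (x + t)))" by (simp add: dlog_def)
        show "\<forall>m t. m < r \<and> \<bar>t\<bar> \<le> \<bar>v\<bar> \<longrightarrow> DERIV (\<lambda>t. dlog m f (x + t)) t :> dlog (Suc m) f (x + t)"
        proof (intro allI impI)
          fix m t assume "m < r \<and> \<bar>t\<bar> \<le> \<bar>v\<bar>"
          then have "(dlog m f has_real_derivative dlog (Suc m) f (t + x)) (at (t + x))"
            using diff [of m "t + x"] by (simp add: DERIV_deriv_iff_real_differentiable [symmetric] dlog_def)
          then have "((\<lambda>t. dlog m f (t + x)) has_real_derivative dlog (Suc m) f (t + x)) (at t)"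
            by (simp add: DERIV_shift)
          then show "DERIV (\<lambda>t. dlog m f (x + t)) t :> dlog (Suc m) f (x + t)" by (simp add: add.commute)
        qed
      qed
      then obtain t where t: "\<bar>t\<bar> \<le> \<bar>v\<bar>"
        "ln (f (x + v)) = (\<Sum>m<r. dlog m f x / fact m * v ^ m) + dlog r f (x + t) / fact r * v ^ r" by auto
      have "(\<Sum>m\<le>r. dlog m f x / fact m * v ^ m) = ln (f x) + (\<Sum>j=1..r. dlog j f x / fact j * v ^ j)"
        unfolding atMost_atLeast0 by (subst sum.atLeast_Suc_atMost) (auto simp: dlog_def)
      moreover have "(\<Sum>m\<le>r. dlog m f x / fact m * v ^ m) = (\<Sum>m<r. dlog m f x / fact m * v ^ m) + dlog r f x / fact r * v ^ r"
        by (simp add: lessThan_Suc_atMost [symmetric])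
      ultimately have "ln (f (x + v)) - ln (f x) - (\<Sum>j=1..r. dlog j f x / fact j * v ^ j)
          = (dlog r f (x + t) - dlog r f x) / fact r * v ^ r"
        using t(2) by (simp add: diff_divide_distrib algebra_simps)
      also have "\<bar>\<dots>\<bar> = \<bar>dlog r f x - dlog r f (x + t)\<bar> / fact r * \<bar>v\<bar> ^ r"
        by (simp add: abs_mult power_abs abs_minus_commute)
      also have "\<dots> \<le> (fact r * poly L x * \<bar>v\<bar> powr (\<beta> - real r)) / fact r * \<bar>v\<bar> ^ r"
      proof (intro mult_right_mono divide_right_mono)
        have h: "\<bar>dlog r f x - dlog r f (x + v')\<bar> \<le> fact r * poly L x * \<bar>v'\<bar> powr (\<beta> - real r)" if "\<bar>v'\<bar> \<le> \<bar>v\<bar>" for v'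
          using holder [of "x + v'" x] v that by simp
        \<comment> \<open>The Hoelder inequality itself forces \<open>poly L x\<close> to be
          nonnegative, as \<open>v\<close> is nonzero; this allows \<open>t\<close> to be replaced
          by \<open>v\<close>.\<close>
        have "0 \<le> fact r * poly L x * \<bar>v\<bar> powr (\<beta> - real r)" using h [of v] by linarith
        then have L0: "0 \<le> poly L x" using False fact_gt_zero [of r, where 'a = real]
          by (auto simp: zero_le_mult_iff simp del: fact_gt_zero)
        have "fact r * poly L x * \<bar>t\<bar> powr (\<beta> - real r) \<le> fact r * poly L x * \<bar>v\<bar> powr (\<beta> - real r)"
          using t L0 r\<beta> by (intro mult_left_mono powr_mono2) auto
        then show "\<bar>dlog r f x - dlog r f (x + t)\<bar> \<le> fact r * poly L x * \<bar>v\<bar> powr (\<beta> - real r)"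
          using h [OF t(1)] by linarith
      qed auto
      also have "\<dots> = poly L x * (\<bar>v\<bar> powr (\<beta> - real r) * \<bar>v\<bar> powr real r)"
        using False by (simp add: powr_realpow)
      also have "\<dots> = poly L x * \<bar>v\<bar> powr \<beta>" by (simp flip: powr_add)
      also have "\<dots> \<le> W0 * (1 + \<bar>x\<bar>) ^ d * \<bar>v\<bar> powr \<beta>" by (intro mult_right_mono LW) simp
      finally show ?thesis .
    qed
    have "\<bar>dlog j f x / fact j\<bar> \<le> W0 * (1 + \<bar>x\<bar>) ^ d" if "j \<in> {1..r}" for j x
    proof -
      have "\<bar>dlog j f x\<bar> / fact j \<le> \<bar>dlog j f x\<bar> / 1"
        by (intro divide_left_mono fact_ge_1) auto
      then show ?thesis using W [of j x] that by simp
    qed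
    moreover have "\<bar>ln (f x)\<bar> \<le> W0 * (1 + \<bar>x\<bar>) ^ d" for x
      using W [of 0 x] by (simp add: dlog_def)
    ultimately show ?thesis
      using taylor pos unfolding log_taylor_def by blast
  qed
  then show ?thesis using W01 by blast
qed

section \<open>The mixture and its local accuracy\<close>

definition quasi_density :: "nat \<Rightarrow> (nat \<Rightarrow> real) \<Rightarrow> (real \<Rightarrow> real) \<Rightarrow> real \<Rightarrow> real \<Rightarrow> real" where
  "quasi_density N w f \<sigma> y = (\<Sum>i\<le>N. w i * f (y + real i * \<sigma>))"

definition grid_mixture ::
  "nat \<Rightarrow> (nat \<Rightarrow> real) \<Rightarrow> (real \<Rightarrow> real) \<Rightarrow> real \<Rightarrow> nat \<Rightarrow> int \<Rightarrow> real \<Rightarrow> real" where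
  "grid_mixture N w f \<sigma> q K x =
     (\<Sum>k\<in>{-K..K}. (\<sigma> / q * quasi_density N w f \<sigma> (real_of_int k * \<sigma> / q))
        * psi_s \<sigma> (x - real_of_int k * \<sigma> / q))"

text \<open>Brings the polynomially weighted kernel into the form summed by
  \<open>rect_sum_inverse_square_le\<close>.\<close>

lemma psi_mult_power_le:
  "psi u * (\<bar>u\<bar> + real N + 1) ^ n \<le> ((real N + 1) ^ n * (fact n * exp 3 * 4)) / (1 + u\<^sup>2)"
proof -
  have "(\<bar>u\<bar> + real N + 1) ^ n \<le> ((real N + 1) * (1 + \<bar>u\<bar>)) ^ n"
    by (intro power_mono) (auto simp: algebra_simps)
  then have "psi u * (\<bar>u\<bar> + real N + 1) ^ n \<le> exp (- u\<^sup>2) * ((real N + 1) * (1 + \<bar>u\<bar>)) ^ n"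
    by (intro mult_mono psi_le_exp) auto
  also have "\<dots> = (real N + 1) ^ n * (((1 + \<bar>u\<bar>) ^ n * exp (- u\<^sup>2 / 4)) * exp (- (3 * u\<^sup>2) / 4))"
    by (simp add: power_mult_distrib mult_ac flip: exp_add)
  also have "\<dots> \<le> (real N + 1) ^ n * ((fact n * exp 3 * exp (- u\<^sup>2 / 8)) * exp (- (3 * u\<^sup>2) / 4))"
    by (intro mult_left_mono mult_right_mono poly_growth_mult_gauss_le) auto
  also have "\<dots> = (real N + 1) ^ n * (fact n * exp 3) * exp (- u\<^sup>2 / 8 + - (3 * u\<^sup>2) / 4)"
    unfolding exp_add by (simp add: mult_ac)
  also have "\<dots> \<le> (real N + 1) ^ n * (fact n * exp 3) * exp (- u\<^sup>2 / 4)"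
    by (intro mult_left_mono) auto
  also have "\<dots> \<le> (real N + 1) ^ n * (fact n * exp 3) * (4 / (1 + u\<^sup>2))"
    by (intro mult_left_mono exp_neg_sq_quarter_le) auto
  finally show ?thesis by simp
qed

text \<open>Three errors: the expansion of \<open>f\<close> about \<open>x\<close> (order
  \<open>\<sigma> powr \<beta>\<close>), the quadrature error on its polynomial part, and the nodes
  farther than \<open>\<sigma> * Y\<close>. The first two are relative to \<open>f x\<close>, the
  last is absolute. The constant \<open>A\<close> is chosen ahead of \<beta>, \<open>f\<close> and
  \<open>M\<close>.\<close>

lemma local_approximation:
  assumes w: "quasi_interpolation_weights (r * r) w C"
  shows "\<exists>A\<ge>0. \<forall>\<beta> \<gamma> W c f M (q::nat) \<sigma> Y x (K::int).
    log_taylor r \<beta> \<gamma> W c f \<longrightarrow> 1 \<le> W x \<longrightarrow> 0 < \<beta> \<longrightarrow> \<beta> \<le> real r + 1 \<longrightarrow> (\<forall>y. f y \<le> M) \<longrightarrow>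
    1 \<le> q \<longrightarrow> 0 < \<sigma> \<longrightarrow> 0 \<le> Y \<longrightarrow>
    \<sigma> * (Y + 1 + real (r * r)) \<le> \<gamma> \<longrightarrow> \<sigma> * (Y + 1 + real (r * r)) \<le> 1 \<longrightarrow>
    W x * (\<sigma> * (Y + 1 + real (r * r))) \<le> 1 \<longrightarrow> W x * (\<sigma> * (Y + 1 + real (r * r))) powr \<beta> \<le> 1 \<longrightarrow>
    \<bar>x\<bar> + \<sigma> * (Y + 1) \<le> real_of_int K * \<sigma> / q \<longrightarrow>
    \<bar>grid_mixture (r * r) w f \<sigma> q K x - f x\<bar>
      \<le> A * (f x * (W x ^ Suc r * \<sigma> powr \<beta> + W x ^ r * (exp (- real q / 12) + exp (- Y\<^sup>2 / 4))) + M * exp (- Y\<^sup>2 / 2))"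
proof -
  define N where "N = r * r"
  define B where "B = (\<Sum>i\<le>N. \<bar>w i\<bar>)"
  define Cr where "Cr = exp (real r + 1) + real r ^ Suc r * exp (real r)"
  define Cp where "Cp = (real N + 1) ^ Suc r * (fact (Suc r) * exp 3 * 4 :: real)"
  define A where "A = Cr * B * Cp * (3 * pi) + (real r + 1) ^ Suc r * C + B * (12 * pi)"
  have B0: "0 \<le> B" by (simp add: B_def sum_nonneg)
  have Cr0: "0 \<le> Cr" by (simp add: Cr_def)
  have Cp0: "0 \<le> Cp" by (simp add: Cp_def)
  have C0: "0 \<le> C" using w by (simp add: quasi_interpolation_weights_def)
  have A1: "Cr * B * Cp * (3 * pi) \<le> A" "(real r + 1) ^ Suc r * C \<le> A" "B * (12 * pi) \<le> A" and A0: "0 \<le> A"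
    using B0 Cr0 Cp0 C0 by (auto simp: A_def intro!: add_nonneg_nonneg)
  have "\<bar>grid_mixture N w f \<sigma> q K x - f x\<bar>
      \<le> A * (f x * (W x ^ Suc r * \<sigma> powr \<beta> + W x ^ r * (exp (- real q / 12) + exp (- Y\<^sup>2 / 4))) + M * exp (- Y\<^sup>2 / 2))"
    if f: "log_taylor r \<beta> \<gamma> W c f" and W: "1 \<le> W x" and \<beta>: "0 < \<beta>" "\<beta> \<le> real r + 1" and M: "\<And>y. f y \<le> M"
      and q: "1 \<le> q" and \<sigma>: "0 < \<sigma>" and Y: "0 \<le> Y"
      and \<delta>: "\<sigma> * (Y + 1 + real N) \<le> \<gamma>" "\<sigma> * (Y + 1 + real N) \<le> 1"
        "W x * (\<sigma> * (Y + 1 + real N)) \<le> 1" "W x * (\<sigma> * (Y + 1 + real N)) powr \<beta> \<le> 1"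
      and K: "\<bar>x\<bar> + \<sigma> * (Y + 1) \<le> real_of_int K * \<sigma> / q"
    for \<beta> \<gamma> W c f M q \<sigma> Y x and K :: int
  proof -
    have pos: "0 < f y" for y using f by (simp add: log_taylor_def)
    define E where "E = exp (- real q / 12) + exp (- Y\<^sup>2 / 4)"
    have E0: "0 \<le> E" by (simp add: E_def)
    define u where "u k = real_of_int k / q - x / \<sigma>" for k
    \<comment> \<open>Rounding outwards gives \<open>u a \<le> - Y\<close> and
      \<open>Y \<le> u b\<close>, as the quadrature requires; retained nodes lie in [-Y - 1, Y], and
      all others are at distance at least \<open>Y\<close>.\<close>
    define a where "a = \<lfloor>(x / \<sigma> - Y) * q\<rfloor>"
    define b where "b = \<lceil>(x / \<sigma> + Y) * q\<rceil>"
    have ua: "u k \<ge> - Y - 1" if "a \<le> k" for k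
    proof -
      have "(x / \<sigma> - Y) * q - 1 \<le> k" using that unfolding a_def by linarith
      then have "((x / \<sigma> - Y) * q - 1) / q \<le> k / q" by (rule divide_right_mono) simp
      moreover have "((x / \<sigma> - Y) * q - 1) / q = x / \<sigma> - Y - 1 / q" using q by (simp add: diff_divide_distrib)
      moreover have "1 / real q \<le> 1" using q by simp
      ultimately show ?thesis unfolding u_def by linarith
    qed
    have ub: "u k \<le> Y" if "k < b" for k
    proof -
      have "k \<le> (x / \<sigma> + Y) * q" using that unfolding b_def by linarith
      then have "k / q \<le> ((x / \<sigma> + Y) * q) / q" by (rule divide_right_mono) simp
      then show ?thesis using q unfolding u_def by simp
    qed
    have ua': "u k \<le> - Y" if "k \<le> a" for k
    proof -
      have "k \<le> (x / \<sigma> - Y) * q" using that unfolding a_def by linarith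
      then have "k / q \<le> ((x / \<sigma> - Y) * q) / q" by (rule divide_right_mono) simp
      then show ?thesis using q unfolding u_def by simp
    qed
    have ub': "Y \<le> u k" if "b \<le> k" for k
    proof -
      have "(x / \<sigma> + Y) * q \<le> k" using that unfolding b_def by linarith
      then have "((x / \<sigma> + Y) * q) / q \<le> k / q" by (rule divide_right_mono) simp
      then show ?thesis using q unfolding u_def by simp
    qed
    have uk: "real_of_int k * \<sigma> / q = x + \<sigma> * u k" for k
      using \<sigma> q by (simp add: u_def field_simps)
    have sub: "{a..<b} \<subseteq> {-K..K}"
    proof
      fix k assume k: "k \<in> {a..<b}"
      have "\<bar>u k\<bar> \<le> Y + 1" using ua [of k] ub [of k] k Y by auto
      then have "\<bar>\<sigma> * u k\<bar> \<le> \<sigma> * (Y + 1)" using \<sigma> by (simp add: abs_mult)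
      then have "\<bar>real_of_int k * \<sigma> / q\<bar> \<le> real_of_int K * \<sigma> / q" using K unfolding uk by linarith
      then have "\<bar>real_of_int k\<bar> * (\<sigma> / q) \<le> real_of_int K * (\<sigma> / q)" using \<sigma> by (simp add: abs_mult)
      moreover have "0 < \<sigma> / q" using \<sigma> q by simp
      ultimately have "\<bar>real_of_int k\<bar> \<le> real_of_int K" by (rule mult_right_le_imp_le)
      then show "k \<in> {-K..K}" by auto
    qed
    let ?g = "quasi_density N w f \<sigma>"
    have gm: "grid_mixture N w f \<sigma> q K x = (\<Sum>k\<in>{-K..K}. psi (u k) / q * ?g (x + \<sigma> * u k))"
      unfolding grid_mixture_def
    proof (intro sum.cong refl)
      fix k
      have "psi_s \<sigma> (x - real_of_int k * \<sigma> / q) = psi (u k) / \<sigma>"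
        unfolding uk using \<sigma> by (simp add: psi_s_def psi_def)
      then show "\<sigma> / q * ?g (real_of_int k * \<sigma> / q) * psi_s \<sigma> (x - real_of_int k * \<sigma> / q) = psi (u k) / q * ?g (x + \<sigma> * u k)"
        using \<sigma> unfolding uk by simp
    qed
    also have "\<dots> = (\<Sum>k\<in>{a..<b}. psi (u k) / q * ?g (x + \<sigma> * u k)) + (\<Sum>k\<in>{-K..K} - {a..<b}. psi (u k) / q * ?g (x + \<sigma> * u k))"
      using sum.subset_diff [OF sub, of "\<lambda>k. psi (u k) / q * ?g (x + \<sigma> * u k)"] by simp
    finally have split: "grid_mixture N w f \<sigma> q K x = (\<Sum>k\<in>{a..<b}. psi (u k) / q * ?g (x + \<sigma> * u k)) + (\<Sum>k\<in>{-K..K} - {a..<b}. psi (u k) / q * ?g (x + \<sigma> * u k))" .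
    have riem: "(\<Sum>k\<in>{i..<j}. 1 / (1 + (u k)\<^sup>2) / q) \<le> 3 * pi" for i j
      using rect_sum_inverse_square_le [of "1 / real q" "x / \<sigma>" i j] q by (simp add: u_def mult.commute)
    \<comment> \<open>No comparison with \<open>f x\<close> is available at these nodes, only the
      global bound \<open>M\<close>. Part of the Gaussian exponent gives the factor in
      \<open>Y\<close>, the rest makes the sum bounded.\<close>
    have far: "\<bar>\<Sum>k\<in>{-K..K} - {a..<b}. psi (u k) / q * ?g (x + \<sigma> * u k)\<bar> \<le> B * (12 * pi) * (M * exp (- Y\<^sup>2 / 2))"
    proof -
      have M0: "0 \<le> M" using M [of 0] pos [of 0] by linarith
      have g: "\<bar>?g y\<bar> \<le> B * M" for y
      proof -
        have "\<bar>?g y\<bar> \<le> (\<Sum>i\<le>N. \<bar>w i\<bar> * M)"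
          unfolding quasi_density_def
          by (rule order_trans [OF sum_abs], rule sum_mono)
            (use M pos in \<open>auto simp: abs_mult less_imp_le intro!: mult_left_mono\<close>)
        then show ?thesis by (simp add: B_def sum_distrib_right)
      qed
      have "\<bar>\<Sum>k\<in>{-K..K} - {a..<b}. psi (u k) / q * ?g (x + \<sigma> * u k)\<bar>
          \<le> (\<Sum>k\<in>{-K..K} - {a..<b}. (exp (- Y\<^sup>2 / 2) * (4 * (1 / (1 + (u k)\<^sup>2))) / q) * (B * M))"
      proof (rule order_trans [OF sum_abs], rule sum_mono)
        fix k assume "k \<in> {-K..K} - {a..<b}"
        then have "k \<le> a \<or> b \<le> k" by auto
        then have "Y \<le> \<bar>u k\<bar>" using ua' [of k] ub' [of k] by auto
        then have "Y\<^sup>2 \<le> (u k)\<^sup>2" using Y by (simp add: abs_le_square_iff [symmetric])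
        then have "- (u k)\<^sup>2 \<le> - Y\<^sup>2 / 2 + - (u k)\<^sup>2 / 4" using zero_le_power2 [of "u k"] by linarith
        then have "exp (- (u k)\<^sup>2) \<le> exp (- Y\<^sup>2 / 2) * exp (- (u k)\<^sup>2 / 4)" by (simp flip: exp_add)
        also have "\<dots> \<le> exp (- Y\<^sup>2 / 2) * (4 / (1 + (u k)\<^sup>2))"
          by (intro mult_left_mono exp_neg_sq_quarter_le) auto
        finally have p: "psi (u k) \<le> exp (- Y\<^sup>2 / 2) * (4 * (1 / (1 + (u k)\<^sup>2)))"
          using psi_le_exp [of "u k"] by simp
        have "\<bar>psi (u k) / q * ?g (x + \<sigma> * u k)\<bar> = psi (u k) / q * \<bar>?g (x + \<sigma> * u k)\<bar>"
          using psi_pos [of "u k"] by (simp add: abs_mult)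
        also have "\<dots> \<le> (exp (- Y\<^sup>2 / 2) * (4 * (1 / (1 + (u k)\<^sup>2))) / q) * (B * M)"
          using p g psi_pos [of "u k"] by (intro mult_mono divide_right_mono) auto
        finally show "\<bar>psi (u k) / q * ?g (x + \<sigma> * u k)\<bar> \<le> (exp (- Y\<^sup>2 / 2) * (4 * (1 / (1 + (u k)\<^sup>2))) / q) * (B * M)" .
      qed
      also have "\<dots> \<le> (\<Sum>k\<in>{-K..<K + 1}. (exp (- Y\<^sup>2 / 2) * (4 * (1 / (1 + (u k)\<^sup>2))) / q) * (B * M))"
        using B0 M0 by (intro sum_mono2) auto
      also have "\<dots> = (exp (- Y\<^sup>2 / 2) * 4 * (B * M)) * (\<Sum>k\<in>{-K..<K + 1}. 1 / (1 + (u k)\<^sup>2) / q)"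
        unfolding sum_distrib_left by (intro sum.cong refl) (simp add: mult_ac)
      also have "\<dots> \<le> (exp (- Y\<^sup>2 / 2) * 4 * (B * M)) * (3 * pi)"
        using B0 M0 by (intro mult_left_mono riem) auto
      finally show ?thesis by (simp add: mult_ac)
    qed
    obtain Q where Q: "degree Q \<le> N" "coeff Q 0 = 1" "coeff_norm Q \<le> (real r + 1) ^ Suc r * W x ^ r"
      and Qv: "\<And>v. \<lbrakk>\<bar>v\<bar> \<le> \<gamma>; \<bar>v\<bar> \<le> 1; W x * \<bar>v\<bar> \<le> 1; W x * \<bar>v\<bar> powr \<beta> \<le> 1\<rbrakk> \<Longrightarrow>
       \<bar>f (x + v) / f x - poly Q v\<bar> \<le> Cr * W x ^ Suc r * \<bar>v\<bar> powr \<beta>"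
      using relative_expansion [of r \<beta> \<gamma> W c f x thesis] f W \<beta> unfolding N_def Cr_def by blast
    define R where "R k i = f (x + \<sigma> * (u k + real i)) / f x - poly Q (\<sigma> * (u k + real i))" for k i
    have R: "\<bar>R k i\<bar> \<le> Cr * W x ^ Suc r * \<sigma> powr \<beta> * (\<bar>u k\<bar> + real N + 1) ^ Suc r"
      if "k \<in> {a..<b}" "i \<le> N" for k i
    proof -
      have uki: "\<bar>u k + real i\<bar> \<le> Y + 1 + real N" using ua [of k] ub [of k] that Y by auto
      define v where "v = \<sigma> * (u k + real i)"
      have v: "\<bar>v\<bar> \<le> \<sigma> * (Y + 1 + real N)" using uki \<sigma> by (simp add: v_def abs_mult)
      have v3: "W x * \<bar>v\<bar> \<le> W x * (\<sigma> * (Y + 1 + real N))" using v W by (intro mult_left_mono) auto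
      have v4: "W x * \<bar>v\<bar> powr \<beta> \<le> W x * (\<sigma> * (Y + 1 + real N)) powr \<beta>"
        using v W \<beta> by (intro mult_left_mono powr_mono2) auto
      have "\<bar>R k i\<bar> \<le> Cr * W x ^ Suc r * \<bar>v\<bar> powr \<beta>"
        unfolding R_def v_def [symmetric] using v v3 v4 \<delta> by (intro Qv) linarith+
      also have "\<dots> \<le> Cr * W x ^ Suc r * (\<sigma> powr \<beta> * (\<bar>u k\<bar> + real N + 1) ^ Suc r)"
      proof (intro mult_left_mono)
        have "\<bar>u k + real i\<bar> powr \<beta> \<le> (\<bar>u k\<bar> + real N + 1) powr \<beta>"
          using that \<beta> by (intro powr_mono2) auto
        also have "\<dots> \<le> (\<bar>u k\<bar> + real N + 1) powr real (Suc r)"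
          using \<beta> by (intro powr_mono) auto
        also have "\<dots> = (\<bar>u k\<bar> + real N + 1) ^ Suc r"
          by (intro powr_realpow) (auto intro: add_nonneg_pos)
        finally have "\<sigma> powr \<beta> * \<bar>u k + real i\<bar> powr \<beta> \<le> \<sigma> powr \<beta> * (\<bar>u k\<bar> + real N + 1) ^ Suc r"
          by (intro mult_left_mono) auto
        then show "\<bar>v\<bar> powr \<beta> \<le> \<sigma> powr \<beta> * (\<bar>u k\<bar> + real N + 1) ^ Suc r"
          using \<sigma> by (simp add: v_def abs_mult powr_mult)
      qed (use Cr0 W in auto)
      finally show ?thesis by (simp add: mult.assoc)
    qed
    define T where "T n = (\<Sum>k\<in>{a..<b}. psi (u k) / q * (\<Sum>i\<le>N. w i * (u k + real i) ^ n))" for n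
    have T: "\<bar>T n - (if n = 0 then 1 else 0)\<bar> \<le> C * E" if "n \<le> N" for n
    proof -
      have "a / q - x / \<sigma> \<le> - Y" "Y \<le> b / q - x / \<sigma>"
        using ua' [of a] ub' [of b] by (auto simp: u_def)
      then show ?thesis
        using w that q Y unfolding T_def u_def E_def quasi_interpolation_weights_def N_def [symmetric] by blast
    qed
    \<comment> \<open>Exchanging the sums leaves the grid functionals \<open>T n\<close> on
      monomials. They are close to 1 for \<open>n = 0\<close> and to 0 otherwise, so only
      \<open>coeff Q 0 = 1\<close> survives.\<close>
    have main: "(\<Sum>k\<in>{a..<b}. psi (u k) / q * (\<Sum>i\<le>N. w i * poly Q (\<sigma> * (u k + real i)))) = (\<Sum>n\<le>N. coeff Q n * \<sigma> ^ n * T n)"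
    proof -
      have pQ: "poly Q y = (\<Sum>n\<le>N. coeff Q n * y ^ n)" for y
        unfolding poly_altdef using Q(1) by (intro sum.mono_neutral_left) (auto simp: coeff_eq_0)
      have "(\<Sum>i\<le>N. w i * poly Q (\<sigma> * (u k + real i))) = (\<Sum>n\<le>N. coeff Q n * \<sigma> ^ n * (\<Sum>i\<le>N. w i * (u k + real i) ^ n))" for k
        unfolding pQ sum_distrib_left by (subst sum.swap) (simp add: power_mult_distrib mult_ac)
      then have "(\<Sum>k\<in>{a..<b}. psi (u k) / q * (\<Sum>i\<le>N. w i * poly Q (\<sigma> * (u k + real i))))
         = (\<Sum>k\<in>{a..<b}. \<Sum>n\<le>N. coeff Q n * \<sigma> ^ n * (psi (u k) / q * (\<Sum>i\<le>N. w i * (u k + real i) ^ n)))"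
        by (simp only: sum_distrib_left) (simp add: mult_ac sum_distrib_left)
      also have "\<dots> = (\<Sum>n\<le>N. coeff Q n * \<sigma> ^ n * T n)"
        unfolding T_def by (subst sum.swap) (simp only: sum_distrib_left)
      finally show ?thesis .
    qed
    have main_err: "\<bar>(\<Sum>n\<le>N. coeff Q n * \<sigma> ^ n * T n) - 1\<bar> \<le> (real r + 1) ^ Suc r * W x ^ r * (C * E)"
    proof -
      have \<sigma>1: "\<sigma> \<le> 1"
      proof -
        have "\<sigma> * 1 \<le> \<sigma> * (Y + 1 + real N)" using \<sigma> Y by (intro mult_left_mono) auto
        then show ?thesis using \<delta>(2) by linarith
      qed
      have "(\<Sum>n\<le>N. coeff Q n * \<sigma> ^ n * (if n = 0 then 1 else 0)) = 1"
        using Q(2) by (simp add: if_distrib sum.delta cong: if_cong)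
      then have "\<bar>(\<Sum>n\<le>N. coeff Q n * \<sigma> ^ n * T n) - 1\<bar> = \<bar>\<Sum>n\<le>N. coeff Q n * \<sigma> ^ n * (T n - (if n = 0 then 1 else 0))\<bar>"
        by (simp only: right_diff_distrib sum_subtractf)
      also have "\<dots> \<le> (\<Sum>n\<le>N. \<bar>coeff Q n\<bar> * (C * E))"
      proof (rule order_trans [OF sum_abs], rule sum_mono)
        fix n assume n: "n \<in> {..N}"
        have "\<bar>coeff Q n * \<sigma> ^ n * (T n - (if n = 0 then 1 else 0))\<bar> = \<bar>coeff Q n\<bar> * (\<sigma> ^ n * \<bar>T n - (if n = 0 then 1 else 0)\<bar>)"
          using \<sigma> by (simp add: abs_mult)
        also have "\<dots> \<le> \<bar>coeff Q n\<bar> * (1 * (C * E))"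
          using T [of n] n \<sigma> \<sigma>1 by (intro mult_left_mono mult_mono power_le_one) auto
        finally show "\<bar>coeff Q n * \<sigma> ^ n * (T n - (if n = 0 then 1 else 0))\<bar> \<le> \<bar>coeff Q n\<bar> * (C * E)" by simp
      qed
      also have "\<dots> = coeff_norm Q * (C * E)"
        by (simp add: coeff_norm_eq_sum [OF Q(1)] sum_distrib_right)
      also have "\<dots> \<le> (real r + 1) ^ Suc r * W x ^ r * (C * E)"
        using Q(3) C0 E0 by (intro mult_right_mono) auto
      finally show ?thesis .
    qed
    have rem: "\<bar>\<Sum>k\<in>{a..<b}. psi (u k) / q * (\<Sum>i\<le>N. w i * R k i)\<bar> \<le> Cr * B * Cp * (3 * pi) * (W x ^ Suc r * \<sigma> powr \<beta>)"
    proof -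
      define F where "F = Cr * W x ^ Suc r * \<sigma> powr \<beta>"
      have F0: "0 \<le> F" using Cr0 W by (simp add: F_def)
      have "\<bar>\<Sum>k\<in>{a..<b}. psi (u k) / q * (\<Sum>i\<le>N. w i * R k i)\<bar> \<le> (\<Sum>k\<in>{a..<b}. (B * F * Cp) * (1 / (1 + (u k)\<^sup>2) / q))"
      proof (rule order_trans [OF sum_abs], rule sum_mono)
        fix k assume k: "k \<in> {a..<b}"
        have "\<bar>\<Sum>i\<le>N. w i * R k i\<bar> \<le> (\<Sum>i\<le>N. \<bar>w i\<bar> * (F * (\<bar>u k\<bar> + real N + 1) ^ Suc r))"
        proof (rule order_trans [OF sum_abs], rule sum_mono)
          fix i assume "i \<in> {..N}"
          then show "\<bar>w i * R k i\<bar> \<le> \<bar>w i\<bar> * (F * (\<bar>u k\<bar> + real N + 1) ^ Suc r)"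
            unfolding abs_mult F_def using R [OF k, of i] by (intro mult_left_mono) auto
        qed
        then have r1: "\<bar>\<Sum>i\<le>N. w i * R k i\<bar> \<le> B * F * (\<bar>u k\<bar> + real N + 1) ^ Suc r"
          by (simp add: B_def sum_distrib_right mult.assoc)
        have "\<bar>psi (u k) / q * (\<Sum>i\<le>N. w i * R k i)\<bar> = psi (u k) / q * \<bar>\<Sum>i\<le>N. w i * R k i\<bar>"
          using psi_pos [of "u k"] by (simp add: abs_mult)
        also have "\<dots> \<le> psi (u k) / q * (B * F * (\<bar>u k\<bar> + real N + 1) ^ Suc r)"
          using r1 psi_pos [of "u k"] by (intro mult_left_mono) auto
        also have "\<dots> = (B * F / q) * (psi (u k) * (\<bar>u k\<bar> + real N + 1) ^ Suc r)" by simp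
        also have "\<dots> \<le> (B * F / q) * (Cp / (1 + (u k)\<^sup>2))"
          unfolding Cp_def using B0 F0 by (intro mult_left_mono psi_mult_power_le) auto
        finally show "\<bar>psi (u k) / q * (\<Sum>i\<le>N. w i * R k i)\<bar> \<le> (B * F * Cp) * (1 / (1 + (u k)\<^sup>2) / q)"
          by (simp add: mult_ac)
      qed
      also have "\<dots> = (B * F * Cp) * (\<Sum>k\<in>{a..<b}. 1 / (1 + (u k)\<^sup>2) / q)" by (simp add: sum_distrib_left)
      also have "\<dots> \<le> (B * F * Cp) * (3 * pi)" using B0 F0 Cp0 by (intro mult_left_mono riem) auto
      finally show ?thesis by (simp add: F_def mult_ac)
    qed
    have near: "(\<Sum>k\<in>{a..<b}. psi (u k) / q * ?g (x + \<sigma> * u k)) =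
       f x * ((\<Sum>n\<le>N. coeff Q n * \<sigma> ^ n * T n) + (\<Sum>k\<in>{a..<b}. psi (u k) / q * (\<Sum>i\<le>N. w i * R k i)))"
    proof -
      have "?g (x + \<sigma> * u k) = f x * ((\<Sum>i\<le>N. w i * poly Q (\<sigma> * (u k + real i))) + (\<Sum>i\<le>N. w i * R k i))" for k
      proof -
        have "f (x + \<sigma> * u k + real i * \<sigma>) = f x * (poly Q (\<sigma> * (u k + real i)) + R k i)" for i
          using pos [of x] by (simp add: R_def algebra_simps)
        then show ?thesis
          unfolding quasi_density_def by (simp add: sum_distrib_left sum.distrib [symmetric] algebra_simps)
      qed
      then have "(\<Sum>k\<in>{a..<b}. psi (u k) / q * ?g (x + \<sigma> * u k)) =
          (\<Sum>k\<in>{a..<b}. f x * (psi (u k) / q * (\<Sum>i\<le>N. w i * poly Q (\<sigma> * (u k + real i))) + psi (u k) / q * (\<Sum>i\<le>N. w i * R k i)))"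
        by (intro sum.cong refl) (simp add: distrib_left mult_ac)
      also have "\<dots> = f x * ((\<Sum>k\<in>{a..<b}. psi (u k) / q * (\<Sum>i\<le>N. w i * poly Q (\<sigma> * (u k + real i)))) + (\<Sum>k\<in>{a..<b}. psi (u k) / q * (\<Sum>i\<le>N. w i * R k i)))"
        unfolding sum_distrib_left [symmetric] sum.distrib ..
      finally show ?thesis unfolding main .
    qed
    define X1 where "X1 = (\<Sum>n\<le>N. coeff Q n * \<sigma> ^ n * T n) - 1"
    define X2 where "X2 = (\<Sum>k\<in>{a..<b}. psi (u k) / q * (\<Sum>i\<le>N. w i * R k i))"
    define X3 where "X3 = (\<Sum>k\<in>{-K..K} - {a..<b}. psi (u k) / q * ?g (x + \<sigma> * u k))"
    have "grid_mixture N w f \<sigma> q K x - f x = f x * (X1 + X2) + X3"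
      unfolding split near X1_def X2_def X3_def by (simp add: algebra_simps)
    also have "\<bar>\<dots>\<bar> \<le> f x * (\<bar>X1\<bar> + \<bar>X2\<bar>) + \<bar>X3\<bar>"
    proof -
      have "\<bar>f x * (X1 + X2)\<bar> \<le> f x * (\<bar>X1\<bar> + \<bar>X2\<bar>)"
        using pos [of x] by (simp add: abs_mult)
      then show ?thesis by linarith
    qed
    also have "\<dots> \<le> f x * (A * (W x ^ r * E) + A * (W x ^ Suc r * \<sigma> powr \<beta>)) + A * (M * exp (- Y\<^sup>2 / 2))"
    proof -
      have "\<bar>X1\<bar> \<le> ((real r + 1) ^ Suc r * C) * (W x ^ r * E)" using main_err by (simp add: X1_def mult_ac)
      also have "\<dots> \<le> A * (W x ^ r * E)" using W E0 by (intro mult_right_mono A1) auto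
      finally have 1: "\<bar>X1\<bar> \<le> A * (W x ^ r * E)" .
      have "\<bar>X2\<bar> \<le> (Cr * B * Cp * (3 * pi)) * (W x ^ Suc r * \<sigma> powr \<beta>)" using rem by (simp add: X2_def)
      also have "\<dots> \<le> A * (W x ^ Suc r * \<sigma> powr \<beta>)" using W by (intro mult_right_mono A1) auto
      finally have 2: "\<bar>X2\<bar> \<le> A * (W x ^ Suc r * \<sigma> powr \<beta>)" .
      have M0: "0 \<le> M" using M [of 0] pos [of 0] by linarith
      have "\<bar>X3\<bar> \<le> (B * (12 * pi)) * (M * exp (- Y\<^sup>2 / 2))" using far by (simp add: X3_def)
      also have "\<dots> \<le> A * (M * exp (- Y\<^sup>2 / 2))" using M0 by (intro mult_right_mono A1) auto
      finally have 3: "\<bar>X3\<bar> \<le> A * (M * exp (- Y\<^sup>2 / 2))" .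
      show ?thesis using pos [of x] 1 2 3 by (intro add_mono mult_left_mono) auto
    qed
    finally show ?thesis unfolding E_def by (simp add: algebra_simps)
  qed
  then show ?thesis using A0 unfolding N_def by blast
qed

section \<open>Bounding the Kullback--Leibler divergence\<close>

text \<open>Normalising adds \<open>ln Z\<close> to the divergence, and
  \<open>ln Z \<le> Z - 1\<close>, which is the integral of \<open>Q - f\<close>.\<close>

lemma kl_normalized_le:
  fixes f Q B :: "real \<Rightarrow> real"
  assumes f: "has_bochner_integral lborel f 1" "\<And>x. 0 < f x"
    and Q: "has_bochner_integral lborel Q Z" "\<And>x. 0 < Q x" and Z: "0 < Z"
    and int: "integrable lborel (\<lambda>x. f x * ln (f x / Q x))"
    and B: "integrable lborel B" "\<And>x. f x * ln (f x / Q x) + Q x - f x \<le> B x"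
  shows "integrable lborel (\<lambda>x. f x * ln (f x / (Q x / Z)))"
    and "(\<integral>x. f x * ln (f x / (Q x / Z)) \<partial>lborel) \<le> integral\<^sup>L lborel B"
proof -
  have eq: "f x * ln (f x / (Q x / Z)) = f x * ln (f x / Q x) + f x * ln Z" for x
  proof -
    have "ln (f x / (Q x / Z)) = ln (f x / Q x) + ln Z"
      using f(2) [of x] Q(2) [of x] Z by (simp add: ln_div ln_mult)
    then show ?thesis by (simp add: distrib_left)
  qed
  have fi: "integrable lborel f" "integral\<^sup>L lborel f = 1" using f(1) by (auto simp: has_bochner_integral_iff)
  have Qi: "integrable lborel Q" "integral\<^sup>L lborel Q = Z" using Q(1) by (auto simp: has_bochner_integral_iff)
  show "integrable lborel (\<lambda>x. f x * ln (f x / (Q x / Z)))"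
    unfolding eq using int fi by auto
  have "(\<integral>x. f x * ln (f x / (Q x / Z)) \<partial>lborel) = (\<integral>x. f x * ln (f x / Q x) \<partial>lborel) + ln Z"
    unfolding eq using int fi by simp
  also have "\<dots> \<le> (\<integral>x. f x * ln (f x / Q x) \<partial>lborel) + Z - 1"
    using ln_le_minus_one [OF Z] by linarith
  also have "\<dots> = (\<integral>x. f x * ln (f x / Q x) + Q x - f x \<partial>lborel)"
    using int fi Qi by simp
  also have "\<dots> \<le> integral\<^sup>L lborel B"
    using int fi Qi B by (intro integral_mono) auto
  finally show "(\<integral>x. f x * ln (f x / (Q x / Z)) \<partial>lborel) \<le> integral\<^sup>L lborel B" .
qed

text \<open>With \<open>Q = F * (1 + s)\<close> the terms linear in \<open>s\<close> cancel and
  \<open>F * (s - ln (1 + s))\<close> remains; this doubles the exponent of the relative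
  error.\<close>

lemma kl_integrand_near:
  fixes F Q :: real
  assumes "0 < F" "\<bar>Q - F\<bar> \<le> \<eta> * F" "\<eta> \<le> 1 / 2"
  shows "F * ln (F / Q) + Q - F \<le> 2 * \<eta>\<^sup>2 * F"
proof -
  define s where "s = (Q - F) / F"
  have s: "\<bar>s\<bar> \<le> \<eta>" using assms by (simp add: s_def abs_divide divide_le_eq)
  have Q: "Q = F * (1 + s)" using assms by (simp add: s_def field_simps)
  have "1 + s > 0" using s assms by linarith
  have "F / Q = inverse (1 + s)" unfolding Q using assms by (simp add: inverse_eq_divide)
  then have "ln (F / Q) = - ln (1 + s)" using \<open>1 + s > 0\<close> by (simp add: ln_inverse)
  then have "F * ln (F / Q) + Q - F = F * (s - ln (1 + s))"
    unfolding Q by (simp add: algebra_simps)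
  also have "\<dots> \<le> F * (2 * s\<^sup>2)"
    using abs_ln_one_plus_x_minus_x_bound [of s] s assms by (intro mult_left_mono) linarith+
  also have "\<dots> \<le> F * (2 * \<eta>\<^sup>2)"
  proof -
    have "s\<^sup>2 \<le> \<eta>\<^sup>2" using s by (metis abs_ge_zero power2_abs power_mono)
    then show ?thesis using assms by simp
  qed
  finally show ?thesis by (simp add: mult_ac)
qed

text \<open>Below the threshold \<open>\<sigma> powr (4 * \<beta> + 4)\<close> one factor \<open>sqrt F \<le> \<sigma> powr (2 * \<beta> + 2)\<close> absorbs the
  \<open>1 / \<sigma>\<^sup>2\<close> in the bound for \<open>- ln Q\<close>, and the other one keeps a Gaussian tail.\<close>

lemma kl_integrand_le:
  fixes F Q x \<sigma> \<beta> \<kappa> M C2 C5 C6 :: real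
  assumes \<sigma>: "0 < \<sigma>" "\<sigma> < 1" and \<kappa>: "\<kappa> = - ln \<sigma>" "1 \<le> \<kappa>" and \<beta>: "0 < \<beta>"
    and F: "0 < F" "F \<le> M * exp (- x\<^sup>2)" and M: "0 < M" "M * \<sigma> \<le> 1"
    and C: "0 \<le> C2" "0 \<le> C5" "0 \<le> C6"
    and near: "\<bar>x\<bar> \<le> (4 * \<beta> + 8) * sqrt \<kappa> - 1 \<Longrightarrow>
        \<bar>Q - F\<bar> \<le> C2 * (1 + \<bar>x\<bar>) ^ d * (\<sigma> powr \<beta> * F + \<sigma> powr (5 * \<beta> + 4) * exp (- x\<^sup>2))"
    and small: "\<bar>x\<bar> \<le> (4 * \<beta> + 8) * sqrt \<kappa> - 1 \<Longrightarrow> C2 * (1 + \<bar>x\<bar>) ^ d * (2 * \<sigma> powr \<beta>) \<le> 1 / 2"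
    and Q: "0 < Q" "- ln Q \<le> (C5 + x\<^sup>2) / \<sigma>\<^sup>2" "Q \<le> C6 * exp (- x\<^sup>2 / 2) / \<sigma>\<^sup>2"
  shows "F * ln (F / Q) + Q - F \<le>
     (8 * C2\<^sup>2 * M + 2 * sqrt M + C2 + sqrt M * (C5 + M + 1) + C6) * \<sigma> powr (2 * \<beta>)
       * ((1 + \<bar>x\<bar>) ^ (2 * d + 2) * exp (- x\<^sup>2 / 4))"
    (is "_ \<le> ?C7 * _ * ?T")
proof -
  define s where "s = \<sigma> powr (2 * \<beta>)"
  have s0: "0 < s" using \<sigma> by (simp add: s_def)
  define P where "P = (1 + \<bar>x\<bar>) ^ (2 * d + 2)"
  define E where "E = exp (- x\<^sup>2 / 4)"
  have T: "?T = P * E" by (simp add: P_def E_def)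
  have P1: "1 \<le> P" unfolding P_def by (intro one_le_power) auto
  have Pd: "(1 + \<bar>x\<bar>) ^ d \<le> P" and P2d: "(1 + \<bar>x\<bar>) ^ (2 * d) \<le> P" and P2: "(1 + \<bar>x\<bar>) ^ 2 \<le> P"
    unfolding P_def by (intro power_increasing; simp)+
  have Px: "x\<^sup>2 \<le> P"
  proof -
    have "\<bar>x\<bar>\<^sup>2 \<le> (1 + \<bar>x\<bar>)\<^sup>2" by (intro power_mono) auto
    then show ?thesis using P2 by simp
  qed
  have E0: "0 < E" by (simp add: E_def)
  have E1: "exp (- x\<^sup>2) \<le> E" "exp (- x\<^sup>2 / 2) \<le> E" by (auto simp: E_def)
  have powr_exp: "\<sigma> powr c = exp (- (c * \<kappa>))" for c using \<sigma> \<kappa> by (simp add: powr_def)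
  have C7: "8 * C2\<^sup>2 * M \<le> ?C7" "2 * sqrt M + C2 + sqrt M * (C5 + M + 1) + C6 \<le> ?C7"
    "sqrt M * (C5 + M + 1) + C6 \<le> ?C7" "0 \<le> ?C7"
    using C M by auto
  show ?thesis
  proof (cases "\<sigma> powr (4 * \<beta> + 4) < F")
    case True
    \<comment> \<open>Outside the window the tail bound would give
      \<open>F \<le> M * \<sigma> powr (4 * \<beta> + 5)\<close>, and the spare \<sigma> absorbs
      \<open>M\<close>. One \<open>sqrt \<kappa>\<close> pays for the \<open>- 1\<close> of the
      window, leaving the radius \<open>(4 * \<beta> + 7) * sqrt \<kappa>\<close>.\<close>
    have x: "\<bar>x\<bar> \<le> (4 * \<beta> + 8) * sqrt \<kappa> - 1"
    proof (rule ccontr)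
      assume "\<not> ?thesis"
      moreover have "(4 * \<beta> + 7) * sqrt \<kappa> \<le> (4 * \<beta> + 8) * sqrt \<kappa> - 1"
        using \<kappa> by (simp add: algebra_simps)
      ultimately have "(4 * \<beta> + 7) * sqrt \<kappa> \<le> \<bar>x\<bar>" by linarith
      then have "((4 * \<beta> + 7) * sqrt \<kappa>)\<^sup>2 \<le> \<bar>x\<bar>\<^sup>2" using \<beta> \<kappa> by (intro power_mono) auto
      then have xx: "(4 * \<beta> + 7)\<^sup>2 * \<kappa> \<le> x\<^sup>2" using \<kappa> by (simp add: power_mult_distrib)
      have "4 * \<beta> + 5 \<le> (4 * \<beta> + 7)\<^sup>2" using \<beta> by (simp add: power2_eq_square algebra_simps add_nonneg_nonneg)
      then have "(4 * \<beta> + 5) * \<kappa> \<le> (4 * \<beta> + 7)\<^sup>2 * \<kappa>" using \<kappa> by (intro mult_right_mono) auto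
      then have "exp (- x\<^sup>2) \<le> \<sigma> powr (4 * \<beta> + 5)" using xx unfolding powr_exp by simp
      then have "F \<le> M * \<sigma> powr (4 * \<beta> + 5)" using F(2) M by (meson mult_left_mono less_imp_le order_trans)
      also have "\<dots> = (M * \<sigma>) * \<sigma> powr (4 * \<beta> + 4)"
      proof -
        have "\<sigma> powr (4 * \<beta> + 5) = \<sigma> powr (4 * \<beta> + 4 + 1)" by (simp add: add.assoc)
        also have "\<dots> = \<sigma> powr (4 * \<beta> + 4) * \<sigma>" using \<sigma> by (subst powr_add) simp
        finally show ?thesis by simp
      qed
      also have "\<dots> \<le> 1 * \<sigma> powr (4 * \<beta> + 4)" using M by (intro mult_right_mono) auto
      finally show False using True by simp
    qed
    define \<eta> where "\<eta> = C2 * (1 + \<bar>x\<bar>) ^ d * (2 * \<sigma> powr \<beta>)"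
    \<comment> \<open>The exponent splits as \<open>\<beta> + (4 * \<beta> + 4)\<close>, and the
      second part is below \<open>F\<close> in this case.\<close>
    have "\<sigma> powr (5 * \<beta> + 4) * exp (- x\<^sup>2) \<le> \<sigma> powr (5 * \<beta> + 4) * 1" by (intro mult_left_mono) auto
    also have "\<dots> = \<sigma> powr \<beta> * \<sigma> powr (4 * \<beta> + 4)" by (simp flip: powr_add)
    also have "\<dots> \<le> \<sigma> powr \<beta> * F" using True by (intro mult_left_mono) auto
    finally have "\<sigma> powr \<beta> * F + \<sigma> powr (5 * \<beta> + 4) * exp (- x\<^sup>2) \<le> 2 * \<sigma> powr \<beta> * F" by linarith
    then have "C2 * (1 + \<bar>x\<bar>) ^ d * (\<sigma> powr \<beta> * F + \<sigma> powr (5 * \<beta> + 4) * exp (- x\<^sup>2))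
        \<le> C2 * (1 + \<bar>x\<bar>) ^ d * (2 * \<sigma> powr \<beta> * F)" using C by (intro mult_left_mono) auto
    then have "\<bar>Q - F\<bar> \<le> \<eta> * F" using near [OF x] by (simp add: \<eta>_def mult_ac)
    then have "F * ln (F / Q) + Q - F \<le> 2 * \<eta>\<^sup>2 * F"
      using small [OF x] F by (intro kl_integrand_near) (auto simp: \<eta>_def)
    also have "\<dots> \<le> 2 * \<eta>\<^sup>2 * (M * E)"
    proof (intro mult_left_mono)
      show "F \<le> M * E" using F(2) E1(1) M by (meson mult_left_mono less_imp_le order_trans)
    qed auto
    also have "\<eta>\<^sup>2 = 4 * C2\<^sup>2 * (1 + \<bar>x\<bar>) ^ (2 * d) * s"
    proof -
      have "(\<sigma> powr \<beta>)\<^sup>2 = s" using \<sigma> by (simp add: s_def power2_eq_square flip: powr_add)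
      then show ?thesis unfolding \<eta>_def power_mult_distrib by (simp add: mult_ac power_mult [symmetric])
    qed
    also have "2 * (4 * C2\<^sup>2 * (1 + \<bar>x\<bar>) ^ (2 * d) * s) * (M * E) = (8 * C2\<^sup>2 * M) * (s * E) * (1 + \<bar>x\<bar>) ^ (2 * d)"
      by simp
    also have "\<dots> \<le> ?C7 * (s * E) * P"
      using C7 P2d s0 E0 M by (intro mult_mono mult_right_mono) auto
    finally show ?thesis unfolding T s_def by (simp add: mult_ac)
  next
    case False
    have F1: "F \<le> s * \<sigma>\<^sup>2 * (sqrt M * exp (- x\<^sup>2 / 2))"
    proof -
      have "sqrt F \<le> sqrt (\<sigma> powr (4 * \<beta> + 4))" using False by simp
      also have "\<dots> = \<sigma> powr (2 * \<beta> + 2)"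
      proof (rule real_sqrt_unique)
        show "(\<sigma> powr (2 * \<beta> + 2))\<^sup>2 = \<sigma> powr (4 * \<beta> + 4)"
          unfolding power2_eq_square powr_add [symmetric] by simp
      qed simp
      also have "\<dots> = s * \<sigma>\<^sup>2" using \<sigma> by (simp add: s_def powr_add)
      finally have 1: "sqrt F \<le> s * \<sigma>\<^sup>2" .
      have "sqrt F \<le> sqrt (M * exp (- x\<^sup>2))" using F by simp
      also have "\<dots> = sqrt M * exp (- x\<^sup>2 / 2)"
      proof -
        have "sqrt (exp (- x\<^sup>2)) = exp (- x\<^sup>2 / 2)"
          by (rule real_sqrt_unique) (auto simp: power2_eq_square simp flip: exp_add)
        then show ?thesis by (simp add: real_sqrt_mult)
      qed
      finally have 2: "sqrt F \<le> sqrt M * exp (- x\<^sup>2 / 2)" .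
      have "F = sqrt F * sqrt F" using F by simp
      also have "\<dots> \<le> (s * \<sigma>\<^sup>2) * (sqrt M * exp (- x\<^sup>2 / 2))"
        using 1 2 s0 F by (intro mult_mono) auto
      finally show ?thesis .
    qed
    have lnF: "ln F \<le> M"
    proof -
      have "F \<le> M * 1" using F(2) M by (meson exp_le_one_iff mult_left_mono less_imp_le neg_le_0_iff_le order_trans zero_le_power2)
      then show ?thesis using ln_le_minus_one [OF F(1)] by linarith
    qed
    have part1: "F * ln (F / Q) \<le> (sqrt M * (C5 + M + 1)) * (s * (P * E))"
    proof -
      have "\<sigma>\<^sup>2 \<le> 1" using \<sigma> by (simp add: power_le_one)
      then have M\<sigma>: "M \<le> M / \<sigma>\<^sup>2" using M \<sigma> by (simp add: field_simps)
      have "ln (F / Q) = ln F - ln Q" using F Q by (simp add: ln_div)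
      also have "\<dots> \<le> M / \<sigma>\<^sup>2 + (C5 + x\<^sup>2) / \<sigma>\<^sup>2" using lnF Q(2) M\<sigma> by linarith
      also have "\<dots> = (C5 + M + x\<^sup>2) / \<sigma>\<^sup>2" by (simp add: add_divide_distrib)
      also have "\<dots> \<le> ((C5 + M + 1) * P) / \<sigma>\<^sup>2"
      proof (intro divide_right_mono)
        have "(C5 + M) * 1 + x\<^sup>2 \<le> (C5 + M) * P + P" using P1 Px C M by (intro add_mono mult_left_mono) auto
        then show "C5 + M + x\<^sup>2 \<le> (C5 + M + 1) * P" by (simp add: algebra_simps)
      qed auto
      finally have l: "ln (F / Q) \<le> ((C5 + M + 1) * P) / \<sigma>\<^sup>2" .
      have nn: "0 \<le> ((C5 + M + 1) * P) / \<sigma>\<^sup>2" using C M P1 by auto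
      have "F * ln (F / Q) \<le> F * (((C5 + M + 1) * P) / \<sigma>\<^sup>2)" using l F by (intro mult_left_mono) auto
      also have "\<dots> \<le> (s * \<sigma>\<^sup>2 * (sqrt M * exp (- x\<^sup>2 / 2))) * (((C5 + M + 1) * P) / \<sigma>\<^sup>2)"
        by (intro mult_right_mono F1 nn)
      also have "\<dots> = (sqrt M * (C5 + M + 1) * (s * P)) * exp (- x\<^sup>2 / 2)"
        using \<sigma> by (simp add: mult_ac)
      also have "\<dots> \<le> (sqrt M * (C5 + M + 1) * (s * P)) * E"
        using C M s0 P1 E1 by (intro mult_left_mono) auto
      finally show ?thesis by (simp add: mult_ac)
    qed
    show ?thesis
    proof (cases "\<bar>x\<bar> \<le> (4 * \<beta> + 8) * sqrt \<kappa> - 1")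
      case True
      define c where "c = C2 * (1 + \<bar>x\<bar>) ^ d"
      have c0: "0 \<le> c" using C by (simp add: c_def)
      have "c * \<sigma> powr \<beta> \<le> 1" using small [OF True] by (simp add: c_def)
      then have "(c * \<sigma> powr \<beta>) * F \<le> 1 * F" using F by (intro mult_right_mono) auto
      then have "Q \<le> 2 * F + c * (\<sigma> powr (5 * \<beta> + 4) * exp (- x\<^sup>2))"
        using near [OF True] unfolding c_def [symmetric] distrib_left by (simp add: mult.assoc)
      also have "\<dots> \<le> 2 * (s * (sqrt M * (P * E))) + C2 * (s * (P * E))"
      proof (intro add_mono mult_left_mono)
        have "s * \<sigma>\<^sup>2 * (sqrt M * exp (- x\<^sup>2 / 2)) \<le> s * 1 * (sqrt M * E)"
          using s0 \<sigma> M E1 by (intro mult_mono mult_left_mono power_le_one) auto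
        also have "\<dots> \<le> s * (sqrt M * (P * E))"
          using s0 M P1 E0 by (simp add: mult_left_mono)
        finally show "F \<le> s * (sqrt M * (P * E))" using F1 by linarith
        have "\<sigma> powr (5 * \<beta> + 4) \<le> s" unfolding s_def using \<sigma> \<beta> by (intro powr_mono') auto
        then have "c * (\<sigma> powr (5 * \<beta> + 4) * exp (- x\<^sup>2)) \<le> (C2 * P) * (s * E)"
          using c0 C P1 Pd E1 s0 unfolding c_def by (intro mult_mono mult_left_mono) auto
        then show "c * (\<sigma> powr (5 * \<beta> + 4) * exp (- x\<^sup>2)) \<le> C2 * (s * (P * E))" by (simp add: mult_ac)
      qed auto
      finally have "F * ln (F / Q) + Q - F \<le> (2 * sqrt M + C2 + sqrt M * (C5 + M + 1)) * (s * (P * E))"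
        using part1 F by (simp add: algebra_simps)
      also have "\<dots> \<le> ?C7 * (s * (P * E))"
        using C7 C s0 P1 E0 by (intro mult_right_mono) auto
      finally show ?thesis unfolding T s_def by (simp add: mult_ac)
    next
      \<comment> \<open>Outside the window \<open>Q\<close> is not compared with \<open>F\<close>:
        half of its own Gaussian bound supplies \<open>\<sigma> powr (2 * \<beta> + 2)\<close>,
        which cancels the \<open>1 / \<sigma>^2\<close>.\<close>
      case False
      moreover have "(4 * \<beta> + 7) * sqrt \<kappa> \<le> (4 * \<beta> + 8) * sqrt \<kappa> - 1"
        using \<kappa> by (simp add: algebra_simps)
      ultimately have "(4 * \<beta> + 7) * sqrt \<kappa> \<le> \<bar>x\<bar>" by linarith
      then have "((4 * \<beta> + 7) * sqrt \<kappa>)\<^sup>2 \<le> \<bar>x\<bar>\<^sup>2" using \<beta> \<kappa> by (intro power_mono) auto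
      then have xx: "(4 * \<beta> + 7)\<^sup>2 * \<kappa> \<le> x\<^sup>2" using \<kappa> by (simp add: power_mult_distrib)
      have "4 * (2 * \<beta> + 2) \<le> (4 * \<beta> + 7)\<^sup>2" using \<beta> by (simp add: power2_eq_square algebra_simps add_nonneg_nonneg)
      then have "(4 * (2 * \<beta> + 2)) * \<kappa> \<le> (4 * \<beta> + 7)\<^sup>2 * \<kappa>" using \<kappa> by (intro mult_right_mono) auto
      then have "- x\<^sup>2 / 4 \<le> - ((2 * \<beta> + 2) * \<kappa>)" using xx by linarith
      then have "E \<le> \<sigma> powr (2 * \<beta> + 2)" unfolding powr_exp E_def by simp
      also have "\<dots> = s * \<sigma>\<^sup>2" using \<sigma> by (simp add: s_def powr_add)
      finally have e: "E \<le> s * \<sigma>\<^sup>2" .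
      have "exp (- x\<^sup>2 / 2) = E * E" by (simp add: E_def flip: exp_add)
      also have "\<dots> \<le> (s * \<sigma>\<^sup>2) * E" using e E0 by (intro mult_right_mono) auto
      finally have "C6 * exp (- x\<^sup>2 / 2) / \<sigma>\<^sup>2 \<le> C6 * ((s * \<sigma>\<^sup>2) * E) / \<sigma>\<^sup>2"
        using C by (intro divide_right_mono mult_left_mono) auto
      then have "Q \<le> C6 * (s * E)" using Q(3) \<sigma> by simp
      also have "\<dots> \<le> C6 * (s * (P * E))" using C s0 P1 E0 by (intro mult_left_mono) auto
      finally have "F * ln (F / Q) + Q - F \<le> (sqrt M * (C5 + M + 1) + C6) * (s * (P * E))"
        using part1 F by (simp add: algebra_simps)
      also have "\<dots> \<le> ?C7 * (s * (P * E))"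
        using C7 C s0 P1 E0 by (intro mult_right_mono) auto
      finally show ?thesis unfolding T s_def by (simp add: mult_ac)
    qed
  qed
qed

text \<open>Purely qualitative: the bounds on \<open>Q\<close> may depend on \<sigma> here.\<close>

lemma integrable_kl_integrand:
  fixes f Q :: "real \<Rightarrow> real"
  assumes [measurable]: "f \<in> borel_measurable borel" "Q \<in> borel_measurable borel"
    and f: "\<And>x. 0 < f x" "\<And>x. f x \<le> M * exp (- x\<^sup>2)" "\<And>x. \<bar>ln (f x)\<bar> \<le> W0 * (1 + \<bar>x\<bar>) ^ d"
    and Q: "\<And>x. 0 < Q x" "\<And>x. - ln (Q x) \<le> a + b * x\<^sup>2" "\<And>x. Q x \<le> c"
    and nonneg: "0 \<le> M" "0 \<le> W0" "0 \<le> a" "0 \<le> b"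
  shows "integrable lborel (\<lambda>x. f x * ln (f x / Q x))"
proof (rule Bochner_Integration.integrable_bound)
  define D where "D = M * (W0 + a + b + \<bar>ln c\<bar>)"
  have D0: "0 \<le> D" using nonneg by (simp add: D_def)
  show "integrable lborel (\<lambda>x. D * (fact (d + 2) * exp 3) * exp (- x\<^sup>2 / 8))"
    by (intro integrable_mult_right integrable_exp_sq_eighth)
  show "AE x in lborel. norm (f x * ln (f x / Q x)) \<le> norm (D * (fact (d + 2) * exp 3) * exp (- x\<^sup>2 / 8))"
  proof (intro AE_I2)
    fix x :: real
    define P where "P = (1 + \<bar>x\<bar>) ^ (d + 2)"
    have P1: "1 \<le> P" unfolding P_def by (intro one_le_power) auto
    have Pd: "(1 + \<bar>x\<bar>) ^ d \<le> P" and P2: "(1 + \<bar>x\<bar>) ^ 2 \<le> P"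
      unfolding P_def by (intro power_increasing; simp)+
    have Px: "x\<^sup>2 \<le> P"
    proof -
      have "\<bar>x\<bar>\<^sup>2 \<le> (1 + \<bar>x\<bar>)\<^sup>2" by (intro power_mono) auto
      then show ?thesis using P2 by simp
    qed
    have lnQ: "\<bar>ln (Q x)\<bar> \<le> a + b * x\<^sup>2 + \<bar>ln c\<bar>"
    proof -
      have "0 < c" using Q(1,3) [of x] by linarith
      then have "ln (Q x) \<le> ln c" using Q(1,3) [of x] by simp
      moreover have "0 \<le> b * x\<^sup>2" using nonneg by simp
      ultimately show ?thesis using Q(2) [of x] nonneg by linarith
    qed
    have "\<bar>ln (f x / Q x)\<bar> \<le> \<bar>ln (f x)\<bar> + \<bar>ln (Q x)\<bar>" using f(1) [of x] Q(1) [of x] by (simp add: ln_div abs_triangle_ineq4)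
    also have "\<dots> \<le> W0 * P + (a * P + b * P + \<bar>ln c\<bar> * P)"
    proof -
      have "W0 * (1 + \<bar>x\<bar>) ^ d \<le> W0 * P" "a * 1 \<le> a * P" "b * x\<^sup>2 \<le> b * P" "\<bar>ln c\<bar> * 1 \<le> \<bar>ln c\<bar> * P"
        by (intro mult_left_mono; use nonneg P1 Px Pd in simp)+
      then show ?thesis using f(3) [of x] lnQ by linarith
    qed
    also have "\<dots> = (W0 + a + b + \<bar>ln c\<bar>) * P" by (simp add: algebra_simps)
    finally have l: "\<bar>ln (f x / Q x)\<bar> \<le> (W0 + a + b + \<bar>ln c\<bar>) * P" .
    have fx: "f x \<le> M * exp (- x\<^sup>2 / 4)"
    proof -
      have "M * exp (- x\<^sup>2) \<le> M * exp (- x\<^sup>2 / 4)" using nonneg by (intro mult_left_mono) auto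
      then show ?thesis using f(2) [of x] by linarith
    qed
    have "norm (f x * ln (f x / Q x)) = f x * \<bar>ln (f x / Q x)\<bar>" using f(1) [of x] by (simp add: abs_mult)
    also have "\<dots> \<le> (M * exp (- x\<^sup>2 / 4)) * ((W0 + a + b + \<bar>ln c\<bar>) * P)"
      using fx l nonneg by (intro mult_mono) auto
    also have "\<dots> = D * (P * exp (- x\<^sup>2 / 4))" by (simp add: D_def mult_ac)
    also have "\<dots> \<le> D * (fact (d + 2) * exp 3 * exp (- x\<^sup>2 / 8))"
      unfolding P_def using D0 by (intro mult_left_mono poly_growth_mult_gauss_le)
    finally show "norm (f x * ln (f x / Q x)) \<le> norm (D * (fact (d + 2) * exp 3) * exp (- x\<^sup>2 / 8))"
      using D0 by (simp add: abs_mult mult_ac)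
  qed
qed measurable

section \<open>Positivity, pointwise bounds and total mass of the mixture\<close>

text \<open>As the weights sum to 1, the relative deviation from \<open>f y\<close> is the weighted
  sum of the relative increments of \<open>f\<close>, and these are small. This makes the masses
  nonnegative and keeps the tail of \<open>f\<close>.\<close>

lemma quasi_density_bounds:
  assumes f: "log_taylor r \<beta> \<gamma> W c f" and \<beta>: "0 < \<beta>" and \<sigma>: "0 < \<sigma>" and W: "0 \<le> W y"
    and w: "(\<Sum>i\<le>N. w i) = 1"
    and N: "real N * \<sigma> \<le> \<gamma>" "real N * \<sigma> \<le> 1" "W y * (real N * \<sigma>) \<le> \<kappa>" "W y * (real N * \<sigma>) powr \<beta> \<le> \<kappa>"
    and \<kappa>: "\<kappa> \<le> 1" "(\<Sum>i\<le>N. \<bar>w i\<bar>) * (exp (real r + 1) * ((real r + 1) * \<kappa>)) \<le> 1 / 2"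
  shows "f y / 2 \<le> quasi_density N w f \<sigma> y" "quasi_density N w f \<sigma> y \<le> 2 * f y"
proof -
  have pos: "0 < f y" using f by (simp add: log_taylor_def)
  have inc: "\<bar>f (y + real i * \<sigma>) / f y - 1\<bar> \<le> exp (real r + 1) * ((real r + 1) * \<kappa>)" if "i \<le> N" for i
  proof -
    have iN: "\<bar>real i * \<sigma>\<bar> \<le> real N * \<sigma>" using that \<sigma> by (simp add: mult_right_mono)
    have w1: "W y * \<bar>real i * \<sigma>\<bar> \<le> \<kappa>" using mult_left_mono [OF iN W] N(3) by linarith
    have "W y * \<bar>real i * \<sigma>\<bar> powr \<beta> \<le> W y * (real N * \<sigma>) powr \<beta>"
      using iN W \<beta> by (intro mult_left_mono powr_mono2) auto
    then have w2: "W y * \<bar>real i * \<sigma>\<bar> powr \<beta> \<le> \<kappa>" using N(4) by linarith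
    have "\<bar>f (y + real i * \<sigma>) / f y - 1\<bar> \<le> exp (real r + 1) * (real r * (W y * \<bar>real i * \<sigma>\<bar>) + W y * \<bar>real i * \<sigma>\<bar> powr \<beta>)"
      using iN N w1 w2 \<kappa>(1) by (intro relative_increment_le [OF f]) linarith+
    also have "\<dots> \<le> exp (real r + 1) * (real r * \<kappa> + \<kappa>)"
      using w1 w2 by (intro mult_left_mono add_mono) auto
    finally show ?thesis by (simp add: algebra_simps)
  qed
  have "quasi_density N w f \<sigma> y / f y - 1 = (\<Sum>i\<le>N. w i * (f (y + real i * \<sigma>) / f y - 1))"
    unfolding quasi_density_def right_diff_distrib sum_subtractf using w by (simp add: sum_divide_distrib)
  also have "\<bar>\<dots>\<bar> \<le> (\<Sum>i\<le>N. \<bar>w i\<bar> * (exp (real r + 1) * ((real r + 1) * \<kappa>)))"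
    by (rule order_trans [OF sum_abs], rule sum_mono, unfold abs_mult) (auto intro!: mult_left_mono inc)
  also have "\<dots> \<le> 1 / 2" using \<kappa>(2) by (simp add: sum_distrib_right)
  finally have "\<bar>quasi_density N w f \<sigma> y / f y - 1\<bar> \<le> 1 / 2" .
  then have "1 / 2 \<le> quasi_density N w f \<sigma> y / f y" "quasi_density N w f \<sigma> y / f y \<le> 2"
    by linarith+
  then show "f y / 2 \<le> quasi_density N w f \<sigma> y" "quasi_density N w f \<sigma> y \<le> 2 * f y"
    using pos by (simp_all add: field_simps)
qed

text \<open>The node at 0 alone is kept. The bound is of order
  \<open>exp (- x^2 / \<sigma>^2)\<close>, which suffices because its logarithm is only needed where
  \<open>f\<close> is small.\<close>

lemma grid_mixture_lower:
  assumes "0 < \<sigma>" "1 \<le> q" "0 \<le> K" "0 \<le> g0" "g0 \<le> quasi_density N w f \<sigma> 0"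
    and nonneg: "\<And>k. k \<in> {-K..K} \<Longrightarrow> 0 \<le> quasi_density N w f \<sigma> (real_of_int k * \<sigma> / q)"
  shows "g0 / q * psi (x / \<sigma>) \<le> grid_mixture N w f \<sigma> q K x"
proof -
  let ?F = "\<lambda>k::int. (\<sigma> / q * quasi_density N w f \<sigma> (real_of_int k * \<sigma> / q)) * psi_s \<sigma> (x - real_of_int k * \<sigma> / q)"
  have psi_s: "0 \<le> psi_s \<sigma> z" for z using assms psi_pos [of "z / \<sigma>"] by (simp add: psi_s_def)
  have "g0 / q * psi (x / \<sigma>) \<le> quasi_density N w f \<sigma> 0 / q * psi (x / \<sigma>)"
    using assms psi_pos [of "x / \<sigma>"] by (intro mult_right_mono divide_right_mono) auto
  also have "\<dots> = ?F 0" using assms by (simp add: psi_s_def)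
  also have "\<dots> \<le> (\<Sum>k\<in>{-K..K}. ?F k)"
    using assms psi_s by (intro member_le_sum) (auto intro!: mult_nonneg_nonneg divide_nonneg_nonneg)
  finally show ?thesis by (simp add: grid_mixture_def)
qed

text \<open>For \<open>\<sigma> \<le> 1\<close> the estimate
  \<open>x^2 \<le> 2 * y^2 + 2 * (x - y)^2\<close> bounds every term by the same Gaussian in
  \<open>x\<close>. Multiplying by the number of nodes is wasteful, but costs only a power of
  \<sigma>.\<close>

lemma grid_mixture_upper:
  assumes "0 < \<sigma>" "\<sigma> \<le> 1" "1 \<le> q" "0 \<le> K" "0 \<le> M"
    and nonneg: "\<And>k. k \<in> {-K..K} \<Longrightarrow> 0 \<le> quasi_density N w f \<sigma> (real_of_int k * \<sigma> / q)"
    and le: "\<And>k. k \<in> {-K..K} \<Longrightarrow>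
      quasi_density N w f \<sigma> (real_of_int k * \<sigma> / q) \<le> M * exp (- (real_of_int k * \<sigma> / q)\<^sup>2)"
  shows "grid_mixture N w f \<sigma> q K x \<le> (2 * real_of_int K + 1) / q * (M * exp (- x\<^sup>2 / 2))"
proof -
  have "grid_mixture N w f \<sigma> q K x \<le> (\<Sum>k\<in>{-K..K}. 1 / q * (M * exp (- x\<^sup>2 / 2)))"
    unfolding grid_mixture_def
  proof (rule sum_mono)
    fix k assume k: "k \<in> {-K..K}"
    define y where "y = real_of_int k * \<sigma> / q"
    define g where "g = quasi_density N w f \<sigma> y"
    have g: "0 \<le> g" "g \<le> M * exp (- y\<^sup>2)" using nonneg [OF k] le [OF k] by (auto simp: g_def y_def)
    have e: "exp (- y\<^sup>2) * exp (- ((x - y) / \<sigma>)\<^sup>2) \<le> exp (- x\<^sup>2 / 2)"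
    proof -
      have "\<bar>x - y\<bar> \<le> \<bar>(x - y) / \<sigma>\<bar>" using assms by (simp add: abs_divide le_divide_eq mult_left_le)
      then have "(x - y)\<^sup>2 \<le> ((x - y) / \<sigma>)\<^sup>2" by (simp only: abs_le_square_iff)
      moreover have "x\<^sup>2 \<le> 2 * y\<^sup>2 + 2 * (x - y)\<^sup>2"
        using zero_le_power2 [of "x - 2 * y"] by (simp add: power2_eq_square algebra_simps)
      ultimately have "- y\<^sup>2 + - ((x - y) / \<sigma>)\<^sup>2 \<le> - x\<^sup>2 / 2" by linarith
      then show ?thesis by (simp flip: exp_add)
    qed
    have "(\<sigma> / q * g) * psi_s \<sigma> (x - y) = 1 / q * (g * psi ((x - y) / \<sigma>))"
      using assms by (simp add: psi_s_def)
    also have "\<dots> \<le> 1 / q * ((M * exp (- y\<^sup>2)) * exp (- ((x - y) / \<sigma>)\<^sup>2))"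
      using g assms psi_pos [of "(x - y) / \<sigma>"] by (intro mult_left_mono mult_mono psi_le_exp) auto
    also have "\<dots> \<le> 1 / q * (M * exp (- x\<^sup>2 / 2))"
      using e assms by (simp add: mult.assoc mult_left_mono divide_right_mono)
    finally show "\<sigma> / q * quasi_density N w f \<sigma> (real_of_int k * \<sigma> / q) * psi_s \<sigma> (x - real_of_int k * \<sigma> / q)
       \<le> 1 / q * (M * exp (- x\<^sup>2 / 2))"
      unfolding g_def y_def .
  qed
  also have "\<dots> = (2 * real_of_int K + 1) / q * (M * exp (- x\<^sup>2 / 2))"
  proof -
    have "real (card {-K..K}) = 2 * real_of_int K + 1" using assms by simp
    then show ?thesis by simp
  qed
  finally show ?thesis .
qed

lemma grid_mixture_integral:
  assumes "0 < \<sigma>"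
  shows "has_bochner_integral lborel (grid_mixture N w f \<sigma> q K)
    (\<Sum>k\<in>{-K..K}. \<sigma> / q * quasi_density N w f \<sigma> (real_of_int k * \<sigma> / q))"
proof -
  have "has_bochner_integral lborel (\<lambda>x. \<Sum>k\<in>{-K..K}. (\<sigma> / q * quasi_density N w f \<sigma> (real_of_int k * \<sigma> / q))
        * psi_s \<sigma> (x - real_of_int k * \<sigma> / q))
     (\<Sum>k\<in>{-K..K}. (\<sigma> / q * quasi_density N w f \<sigma> (real_of_int k * \<sigma> / q)) * 1)"
    by (intro has_bochner_integral_sum has_bochner_integral_mult_right has_bochner_integral_psi_s assms)
  then show ?thesis by (simp add: grid_mixture_def [abs_def])
qed

text \<open>The innermost existential of \<open>theorem2\<close>, with its three bounds as
  parameters; it has the same syntactic form, so that unfolding it closes the final goal.\<close>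

definition mixture_approximable :: "(real \<Rightarrow> real) \<Rightarrow> real \<Rightarrow> real \<Rightarrow> real \<Rightarrow> real \<Rightarrow> bool" where
  "mixture_approximable f \<sigma> m R \<kappa> \<longleftrightarrow>
     (\<exists>m' :: nat. \<exists>p \<mu> :: nat \<Rightarrow> real. \<exists>\<mu>\<sigma> :: real.
         (\<forall>u \<in> {1..m'}. 0 \<le> p u \<and> \<mu> u \<in> {-\<mu>\<sigma>..\<mu>\<sigma>}) \<and>
         (\<Sum>u = 1..m'. p u) = 1 \<and> real m' < m \<and> \<mu>\<sigma> \<le> R \<and>
         (let wp = (\<lambda>x. \<Sum>u = 1..m'. p u * psi_s \<sigma> (x - \<mu> u)) in
            integrable lborel (\<lambda>x. f x * ln (f x / wp x)) \<and>
            (\<integral>x. f x * ln (f x / wp x) \<partial>lborel) \<le> \<kappa>))"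

lemma mixture_approximableI:
  fixes K :: int and p \<mu> :: "int \<Rightarrow> real"
  assumes "0 \<le> K" "\<And>k. k \<in> {-K..K} \<Longrightarrow> 0 \<le> p k" "\<And>k. k \<in> {-K..K} \<Longrightarrow> \<bar>\<mu> k\<bar> \<le> R"
    and "(\<Sum>k\<in>{-K..K}. p k) = 1" "2 * real_of_int K + 1 < m"
    and "integrable lborel (\<lambda>x. f x * ln (f x / (\<Sum>k\<in>{-K..K}. p k * psi_s \<sigma> (x - \<mu> k))))"
    and "(\<integral>x. f x * ln (f x / (\<Sum>k\<in>{-K..K}. p k * psi_s \<sigma> (x - \<mu> k))) \<partial>lborel) \<le> \<kappa>"
  shows "mixture_approximable f \<sigma> m R \<kappa>"
proof -
  define m' where "m' = nat (2 * K + 1)"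
  have re: "(\<Sum>u = 1..m'. F (int u - 1 - K)) = (\<Sum>k\<in>{-K..K}. F k)" for F :: "int \<Rightarrow> real"
    using assms(1)
    by (intro sum.reindex_bij_witness [of _ "\<lambda>k. nat (k + K + 1)" "\<lambda>u. int u - 1 - K"]) (auto simp: m'_def)
  have mem: "int u - 1 - K \<in> {-K..K}" if "u \<in> {1..m'}" for u
    using that assms(1) by (auto simp: m'_def)
  have wp: "(\<Sum>u = 1..m'. p (int u - 1 - K) * psi_s \<sigma> (x - \<mu> (int u - 1 - K))) = (\<Sum>k\<in>{-K..K}. p k * psi_s \<sigma> (x - \<mu> k))" for x
    by (rule re)
  show ?thesis
    unfolding mixture_approximable_def
  proof (intro exI conjI)
    show "\<forall>u\<in>{1..m'}. 0 \<le> p (int u - 1 - K) \<and> \<mu> (int u - 1 - K) \<in> {-R..R}"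
    proof (intro ballI conjI)
      fix u assume "u \<in> {1..m'}"
      note k = mem [OF this]
      show "0 \<le> p (int u - 1 - K)" by (rule assms(2) [OF k])
      show "\<mu> (int u - 1 - K) \<in> {-R..R}" using assms(3) [OF k] by (auto simp: abs_le_iff)
    qed
    show "(\<Sum>u = 1..m'. p (int u - 1 - K)) = 1" using re [of p] assms(4) by simp
    show "real m' < m" using assms(1,5) by (simp add: m'_def)
    show "let wp = \<lambda>x. \<Sum>u = 1..m'. p (int u - 1 - K) * psi_s \<sigma> (x - \<mu> (int u - 1 - K)) in
        integrable lborel (\<lambda>x. f x * ln (f x / wp x)) \<and> (\<integral>x. f x * ln (f x / wp x) \<partial>lborel) \<le> \<kappa>"
      unfolding Let_def wp by (intro conjI assms(6,7))
  qed simp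
qed

section \<open>Choice of the scale and assembly for a fixed order r\<close>

text \<open>Apart from the first clause, every clause says that a positive power of \<sigma> beats
  powers of its logarithm. Writing \<open>powr 1\<close> lets a single limit cover both
  exponents.\<close>

lemma eventually_small_scale:
  fixes A H M b \<gamma> \<kappa> W0 C2 N :: real and d d2 :: nat
  assumes "0 < A" "0 < b" "0 < \<gamma>" "0 < \<kappa>" "0 \<le> N"
  shows "\<forall>\<^sub>F \<sigma> in at_right 0. 4 * H + 1 \<le> - ln \<sigma> \<and> M * \<sigma> \<le> 1 \<and> (12 * H * - ln \<sigma> + 1) * \<sigma>\<^sup>2 \<le> 1 \<and>
     (2 * A * sqrt (- ln \<sigma>) + \<sigma>) * \<sigma> \<le> 1 \<and> \<sigma> * (- ln \<sigma> + 2 + N) \<le> \<gamma> \<and> \<sigma> * (- ln \<sigma> + 2 + N) \<le> 1 \<and>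
     W0 * ((1 + A * sqrt (- ln \<sigma>)) ^ d * (\<sigma> * (- ln \<sigma> + 1 + N)) powr 1) \<le> \<kappa> \<and>
     W0 * ((1 + A * sqrt (- ln \<sigma>)) ^ d * (\<sigma> * (- ln \<sigma> + 1 + N)) powr b) \<le> \<kappa> \<and>
     (4 * C2) * ((1 + A * sqrt (- ln \<sigma>)) ^ d2 * (\<sigma> * (- ln \<sigma> + 1 + N)) powr b) \<le> 1"
proof -
  have small: "\<forall>\<^sub>F \<sigma> in at_right 0. g \<sigma> \<le> e" if "(g \<longlongrightarrow> 0) (at_right (0::real))" "0 < e" for g and e :: real
    using order_tendstoD(2) [OF that] by (rule eventually_mono) simp
  have *: "((\<lambda>\<sigma>. (1 + A * sqrt (- ln \<sigma>)) ^ p * (\<sigma> * (- ln \<sigma> + 1 + N)) powr e) \<longlongrightarrow> 0) (at_right 0)"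
    if "0 < e" for p e
    using that assms by real_asymp
  have **: "((\<lambda>\<sigma>. c * ((1 + A * sqrt (- ln \<sigma>)) ^ p * (\<sigma> * (- ln \<sigma> + 1 + N)) powr e)) \<longlongrightarrow> 0) (at_right 0)"
    if "0 < e" for c p e
    using tendsto_mult_left [OF * [OF that], of c] by simp
  have "\<forall>\<^sub>F \<sigma> in at_right 0. 4 * H + 1 \<le> - ln (\<sigma>::real)"
    by real_asymp
  moreover have "\<forall>\<^sub>F \<sigma> in at_right 0. M * \<sigma> \<le> 1" by (intro small) (real_asymp, simp)
  moreover have "\<forall>\<^sub>F \<sigma> in at_right 0. (12 * H * - ln \<sigma> + 1) * \<sigma>\<^sup>2 \<le> 1" by (intro small) (real_asymp, simp)
  moreover have "\<forall>\<^sub>F \<sigma> in at_right 0. (2 * A * sqrt (- ln \<sigma>) + \<sigma>) * \<sigma> \<le> 1" by (intro small) (real_asymp, simp)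
  moreover have "\<forall>\<^sub>F \<sigma> in at_right 0. \<sigma> * (- ln \<sigma> + 2 + N) \<le> \<gamma>" using assms by (intro small) (real_asymp, simp)
  moreover have "\<forall>\<^sub>F \<sigma> in at_right 0. \<sigma> * (- ln \<sigma> + 2 + N) \<le> 1" by (intro small) (real_asymp, simp)
  moreover have "\<forall>\<^sub>F \<sigma> in at_right 0. W0 * ((1 + A * sqrt (- ln \<sigma>)) ^ d * (\<sigma> * (- ln \<sigma> + 1 + N)) powr 1) \<le> \<kappa>"
    using assms by (intro small **) auto
  moreover have "\<forall>\<^sub>F \<sigma> in at_right 0. W0 * ((1 + A * sqrt (- ln \<sigma>)) ^ d * (\<sigma> * (- ln \<sigma> + 1 + N)) powr b) \<le> \<kappa>"
    using assms by (intro small **) auto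
  moreover have "\<forall>\<^sub>F \<sigma> in at_right 0. (4 * C2) * ((1 + A * sqrt (- ln \<sigma>)) ^ d2 * (\<sigma> * (- ln \<sigma> + 1 + N)) powr b) \<le> 1"
    using assms by (intro small **) auto
  ultimately show ?thesis by (simp only: eventually_conj_iff)
qed

text \<open>Uniform over all \<beta> with \<open>rr \<beta> = r\<close> and
  \<open>b \<le> \<beta>\<close>: quantities increasing in \<beta> are replaced by their values at
  \<open>r + 1\<close>, and powers of numbers below 1 by their values at \<open>b\<close>.\<close>

lemma Hclass_mixture_approximable:
  assumes pos: "0 < \<gamma>" "0 < lp" "0 < M" "0 < b"
  shows "\<exists>s0 c0. 0 < s0 \<and> s0 < 1 \<and> 0 < c0 \<and>
    (\<forall>\<beta> f \<sigma>. b \<le> \<beta> \<longrightarrow> rr \<beta> = r \<longrightarrow> f \<in> Hclass \<beta> \<gamma> lp L \<epsilon> C \<alpha> \<xi> M \<longrightarrow> 0 < \<sigma> \<longrightarrow> \<sigma> < s0 \<longrightarrow>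
      mixture_approximable f \<sigma>
        ((2 * (4 * \<beta> + 8) * (12 * ((4 * \<beta> + 8)\<^sup>2 + 5 * \<beta> + 4) + 1) + 2) * (1 / \<sigma>) * \<bar>ln \<sigma>\<bar> powr (3 / 2))
        ((4 * \<beta> + 8) * \<bar>ln \<sigma>\<bar> powr (1 / 2)) (c0 * \<sigma> powr (2 * \<beta>)))"
proof -
  obtain W0 d where W01: "1 \<le> W0" and taylor: "\<And>\<beta> f. 0 < \<beta> \<Longrightarrow> rr \<beta> = r \<Longrightarrow> f \<in> Hclass \<beta> \<gamma> lp L \<epsilon> C \<alpha> \<xi> M \<Longrightarrow>
     log_taylor r \<beta> \<gamma> (\<lambda>x. W0 * (1 + \<bar>x\<bar>) ^ d) (\<lambda>x j. dlog j f x / fact j) f \<and>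
     (\<forall>x. \<bar>ln (f x)\<bar> \<le> W0 * (1 + \<bar>x\<bar>) ^ d)"
    using Hclass_log_taylor [OF pos(1,2), of r L \<epsilon> C \<alpha> \<xi> M] by blast
  define N where "N = r * r"
  obtain w Cw where w: "quasi_interpolation_weights N w Cw"
    using exists_quasi_interpolation_weights by blast
  have w1: "(\<Sum>i\<le>N. w i) = 1" using w by (simp add: quasi_interpolation_weights_def)
  obtain A0 where A0: "0 \<le> A0" and loc: "\<And>\<beta> \<gamma> W c f M (q::nat) \<sigma> Y x (K::int).
    log_taylor r \<beta> \<gamma> W c f \<Longrightarrow> 1 \<le> W x \<Longrightarrow> 0 < \<beta> \<Longrightarrow> \<beta> \<le> real r + 1 \<Longrightarrow> (\<forall>y. f y \<le> M) \<Longrightarrow>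
    1 \<le> q \<Longrightarrow> 0 < \<sigma> \<Longrightarrow> 0 \<le> Y \<Longrightarrow>
    \<sigma> * (Y + 1 + real N) \<le> \<gamma> \<Longrightarrow> \<sigma> * (Y + 1 + real N) \<le> 1 \<Longrightarrow>
    W x * (\<sigma> * (Y + 1 + real N)) \<le> 1 \<Longrightarrow> W x * (\<sigma> * (Y + 1 + real N)) powr \<beta> \<le> 1 \<Longrightarrow>
    \<bar>x\<bar> + \<sigma> * (Y + 1) \<le> real_of_int K * \<sigma> / q \<Longrightarrow>
    \<bar>grid_mixture N w f \<sigma> q K x - f x\<bar>
      \<le> A0 * (f x * (W x ^ Suc r * \<sigma> powr \<beta> + W x ^ r * (exp (- real q / 12) + exp (- Y\<^sup>2 / 4))) + M * exp (- Y\<^sup>2 / 2))"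
    using local_approximation [OF w [unfolded N_def]] unfolding N_def by blast
  define B where "B = (\<Sum>i\<le>N. \<bar>w i\<bar>)"
  have B0: "0 \<le> B" by (simp add: B_def sum_nonneg)
  define D where "D = exp (real r + 1) * (real r + 1)"
  have D0: "0 < D" by (simp add: D_def)
  \<comment> \<open>Small enough for \<open>quasi_density_bounds\<close>; the minimum with 1 also
    serves the hypotheses of \<open>local_approximation\<close>.\<close>
  define \<kappa> where "\<kappa> = min 1 (1 / (2 * (B + 1) * D))"
  have \<kappa>: "0 < \<kappa>" "\<kappa> \<le> 1" using B0 D0 by (auto simp: \<kappa>_def)
  have \<kappa>B: "B * (exp (real r + 1) * ((real r + 1) * \<kappa>)) \<le> 1 / 2"
  proof -
    have "B * (D * \<kappa>) \<le> (B + 1) * (D * \<kappa>)" using D0 \<kappa> by (intro mult_right_mono) auto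
    also have "\<dots> \<le> (B + 1) * (D * (1 / (2 * (B + 1) * D)))"
      using B0 D0 by (intro mult_left_mono) (auto simp: \<kappa>_def)
    also have "\<dots> = 1 / 2" using B0 D0 by (simp add: divide_simps)
    finally show ?thesis by (simp add: D_def mult.assoc)
  qed
  \<comment> \<open>The largest \<beta> with \<open>rr \<beta> = r\<close>; \<open>A1\<close> and
    \<open>H1\<close> are the matching upper bounds for \<open>A\<close> and
    \<open>H\<close>.\<close>
  define b1 where "b1 = real r + 1"
  define A1 where "A1 = 4 * b1 + 8"
  define H1 where "H1 = A1\<^sup>2 + 5 * b1 + 4"
  have A10: "0 < A1" by (simp add: A1_def b1_def)
  define C2 where "C2 = A0 * (1 + 3 * M) * W0 ^ Suc r"
  have C20: "0 \<le> C2" using A0 pos W01 by (simp add: C2_def)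
  define d2 where "d2 = d * Suc r"
  define C7 where "C7 = 8 * C2\<^sup>2 * M + 2 * sqrt M + C2 + sqrt M * ((lp + 4) + M + 1) + 2 * M"
  have C70: "0 \<le> C7" using C20 pos by (simp add: C7_def)
  define J where "J = (\<integral>u. exp (- u\<^sup>2 / 8) \<partial>(lborel :: real measure))"
  have J0: "0 \<le> J" by (simp add: J_def)
  define c0 where "c0 = C7 * (fact (2 * d2 + 2) * exp 3) * J + 1"
  have c0: "0 < c0" using C70 J0 by (simp add: c0_def add_nonneg_pos)
  from eventually_small_scale [OF A10 pos(4) pos(1) \<kappa>(1) of_nat_0_le_iff [of N], of H1 M W0 d C2 d2]
  obtain s1 where s1: "0 < s1" and sm: "\<And>\<sigma>. 0 < \<sigma> \<Longrightarrow> \<sigma> < s1 \<Longrightarrow>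
     4 * H1 + 1 \<le> - ln \<sigma> \<and> M * \<sigma> \<le> 1 \<and> (12 * H1 * - ln \<sigma> + 1) * \<sigma>\<^sup>2 \<le> 1 \<and>
     (2 * A1 * sqrt (- ln \<sigma>) + \<sigma>) * \<sigma> \<le> 1 \<and> \<sigma> * (- ln \<sigma> + 2 + N) \<le> \<gamma> \<and> \<sigma> * (- ln \<sigma> + 2 + N) \<le> 1 \<and>
     W0 * ((1 + A1 * sqrt (- ln \<sigma>)) ^ d * (\<sigma> * (- ln \<sigma> + 1 + N)) powr 1) \<le> \<kappa> \<and>
     W0 * ((1 + A1 * sqrt (- ln \<sigma>)) ^ d * (\<sigma> * (- ln \<sigma> + 1 + N)) powr b) \<le> \<kappa> \<and>
     (4 * C2) * ((1 + A1 * sqrt (- ln \<sigma>)) ^ d2 * (\<sigma> * (- ln \<sigma> + 1 + N)) powr b) \<le> 1"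
    unfolding eventually_at_right_field by auto
  define s0 where "s0 = min s1 (1 / 2)"
  have "mixture_approximable f \<sigma>
        ((2 * (4 * \<beta> + 8) * (12 * ((4 * \<beta> + 8)\<^sup>2 + 5 * \<beta> + 4) + 1) + 2) * (1 / \<sigma>) * \<bar>ln \<sigma>\<bar> powr (3 / 2))
        ((4 * \<beta> + 8) * \<bar>ln \<sigma>\<bar> powr (1 / 2)) (c0 * \<sigma> powr (2 * \<beta>))"
    if b\<beta>: "b \<le> \<beta>" and rr: "rr \<beta> = r" and f: "f \<in> Hclass \<beta> \<gamma> lp L \<epsilon> C \<alpha> \<xi> M" and \<sigma>: "0 < \<sigma>" "\<sigma> < s0"
    for \<beta> f \<sigma>
  proof -
    have \<beta>: "0 < \<beta>" using pos b\<beta> by linarith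
    have \<beta>r: "\<beta> \<le> b1" using rr_eqD(2) [OF \<beta> rr] by (simp add: b1_def)
    define l where "l = - ln \<sigma>"
    define R where "R = sqrt l"
    have \<sigma>1: "\<sigma> < 1" "\<sigma> < s1" using \<sigma> by (auto simp: s0_def)
    define A where "A = 4 * \<beta> + 8"
    define H where "H = A\<^sup>2 + 5 * \<beta> + 4"
    have A: "8 \<le> A" "A \<le> A1" using \<beta> \<beta>r by (auto simp: A_def A1_def)
    have H: "4 \<le> H" "H \<le> H1"
    proof -
      have "A\<^sup>2 \<le> A1\<^sup>2" using A by (intro power_mono) auto
      then show "H \<le> H1" using \<beta>r by (simp add: H_def H1_def)
      show "4 \<le> H" using \<beta> by (simp add: H_def)
    qed
    note sm' = sm [OF \<sigma>(1) \<sigma>1(2), folded l_def, folded R_def]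
    have l4: "4 * H1 + 1 \<le> l" using sm' by simp
    then have l1: "1 \<le> l" "4 * H \<le> l" using H by linarith+
    have R1: "1 \<le> R" "R * R = l" using l1 by (auto simp: R_def)
    \<comment> \<open>The largest displacement at which \<open>f\<close> is expanded: nodes within
      \<open>\<sigma> * (l + 1)\<close> plus shifts up to \<open>\<sigma> * N\<close>. Thus
      \<open>Y = l\<close>, and \<open>exp (- l^2 / 4) \<le> \<sigma> powr H\<close> as soon as
      \<open>4 * H \<le> l\<close>.\<close>
    define \<delta> where "\<delta> = \<sigma> * (l + 1 + real N)"
    have \<delta>0: "0 < \<delta>" using \<sigma> l1 by (simp add: \<delta>_def add_pos_nonneg)
    have \<delta>2: "\<delta> + \<sigma> = \<sigma> * (l + 2 + real N)" by (simp add: \<delta>_def algebra_simps)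
    have \<delta>1: "\<delta> \<le> \<gamma>" "\<delta> \<le> 1" using sm' \<sigma> \<delta>2 by linarith+
    define W where "W x = W0 * (1 + \<bar>x\<bar>) ^ d" for x :: real
    have W1: "1 \<le> W x" for x
    proof -
      have "1 * 1 \<le> W x" unfolding W_def using W01 by (intro mult_mono one_le_power) auto
      then show ?thesis by simp
    qed
    have T: "log_taylor r \<beta> \<gamma> W (\<lambda>x j. dlog j f x / fact j) f" and lnf: "\<bar>ln (f x)\<bar> \<le> W0 * (1 + \<bar>x\<bar>) ^ d" for x
      using taylor [OF \<beta> rr f] by (auto simp: W_def [abs_def])
    have \<delta>b: "\<delta> powr \<beta> \<le> \<delta> powr b" using \<delta>0 \<delta>1 b\<beta> by (intro powr_mono') auto
    have grow: "(1 + \<bar>x\<bar>) ^ n \<le> (1 + A1 * R) ^ n" if "\<bar>x\<bar> \<le> A * R" for x n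
    proof (intro power_mono)
      have "A * R \<le> A1 * R" using A R1 by (intro mult_right_mono) auto
      then show "1 + \<bar>x\<bar> \<le> 1 + A1 * R" using that by linarith
    qed auto
    have W\<delta>: "W x * \<delta> \<le> \<kappa>" "W x * \<delta> powr \<beta> \<le> \<kappa>" if "\<bar>x\<bar> \<le> A * R" for x
    proof -
      have "W x \<le> W0 * (1 + A1 * R) ^ d" unfolding W_def using W01 grow [OF that] by (intro mult_left_mono) auto
      then have "W x * \<delta> \<le> (W0 * (1 + A1 * R) ^ d) * \<delta>" "W x * \<delta> powr \<beta> \<le> (W0 * (1 + A1 * R) ^ d) * \<delta> powr b"
        using \<delta>0 \<delta>b W1 [of x] by (auto intro!: mult_mono)
      then show "W x * \<delta> \<le> \<kappa>" "W x * \<delta> powr \<beta> \<le> \<kappa>"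
        using sm' \<delta>0 by (auto simp: \<delta>_def mult.assoc)
    qed
    \<comment> \<open>Makes the quadrature error \<open>exp (- q / 12)\<close> at most
      \<open>\<sigma> powr H\<close>.\<close>
    define q where "q = nat \<lceil>12 * H * l\<rceil>"
    have Hl: "0 < 12 * H * l" using H l1 by simp
    then have q1: "1 \<le> q" and q: "12 * H * l \<le> real q" "real q \<le> 12 * H * l + 1"
      unfolding q_def by linarith+
    define K where "K = \<lfloor>A * R * real q / \<sigma>\<rfloor>"
    have K0: "0 \<le> K" using A R1 \<sigma> by (simp add: K_def)
    have Kle: "real_of_int K \<le> A * R * real q / \<sigma>" "A * R * real q / \<sigma> - 1 \<le> real_of_int K"
      unfolding K_def by linarith+
    define h where "h = \<sigma> / real q"
    have h: "0 < h" "h \<le> \<sigma>" using \<sigma> q1 by (auto simp: h_def divide_le_eq)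
    have node: "real_of_int k * \<sigma> / q = real_of_int k * h" for k by (simp add: h_def)
    have Kh: "real_of_int K * h \<le> A * R" "A * R - \<sigma> \<le> real_of_int K * h"
    proof -
      have e: "A * R * real q / \<sigma> * h = A * R" using \<sigma> q1 by (simp add: h_def)
      show "real_of_int K * h \<le> A * R" using mult_right_mono [OF Kle(1), of h] h e by simp
      show "A * R - \<sigma> \<le> real_of_int K * h" using mult_right_mono [OF Kle(2), of h] h e by (simp add: left_diff_distrib)
    qed
    have nodeK: "\<bar>real_of_int k * h\<bar> \<le> A * R" if "k \<in> {-K..K}" for k
    proof -
      have "\<bar>real_of_int k\<bar> * h \<le> real_of_int K * h" using that h by (intro mult_right_mono) auto
      moreover have "\<bar>real_of_int k * h\<bar> = \<bar>real_of_int k\<bar> * h" using h by (simp add: abs_mult)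
      ultimately show ?thesis using Kh by linarith
    qed
    let ?g = "quasi_density N w f \<sigma>"
    let ?Q = "grid_mixture N w f \<sigma> q K"
    have fpos: "0 < f x" for x using f by (simp add: Hclass_def)
    have fM: "f x \<le> M * exp (- x\<^sup>2)" for x
    proof -
      have "f x \<le> M * psi x" using f by (simp add: Hclass_def)
      also have "\<dots> \<le> M * exp (- x\<^sup>2)" using pos by (intro mult_left_mono psi_le_exp) auto
      finally show ?thesis .
    qed
    have fM1: "f x \<le> M" for x
    proof -
      have "M * exp (- x\<^sup>2) \<le> M * 1" using pos by (intro mult_left_mono) auto
      then show ?thesis using fM [of x] by linarith
    qed
    have f0: "exp (- lp) \<le> f 0"
    proof -
      have "\<bar>dlog 0 f 0\<bar> \<le> lp" using f by (simp add: Hclass_def)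
      then have "- lp \<le> ln (f 0)" by (simp add: dlog_def)
      then have "exp (- lp) \<le> exp (ln (f 0))" by simp
      then show ?thesis using fpos [of 0] by simp
    qed
    have fmeas [measurable]: "f \<in> borel_measurable borel" using f by (simp add: Hclass_def is_density_def)
    have fint: "has_bochner_integral lborel f 1"
      using f fpos by (intro has_bochner_integral_nn_integral) (auto simp: Hclass_def is_density_def less_imp_le)
    have gb: "f y / 2 \<le> ?g y" "?g y \<le> 2 * f y" if y: "\<bar>y\<bar> \<le> A * R" for y
    proof -
      have N\<delta>: "real N * \<sigma> \<le> \<delta>" "0 \<le> real N * \<sigma>" using \<sigma> l1 by (auto simp: \<delta>_def algebra_simps)
      have "W y * (real N * \<sigma>) \<le> W y * \<delta>" using N\<delta> W1 [of y] by (intro mult_left_mono) auto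
      moreover have "W y * (real N * \<sigma>) powr \<beta> \<le> W y * \<delta> powr \<beta>"
        using N\<delta> W1 [of y] \<beta> by (intro mult_left_mono powr_mono2) auto
      ultimately have c: "real N * \<sigma> \<le> \<gamma>" "real N * \<sigma> \<le> 1" "W y * (real N * \<sigma>) \<le> \<kappa>" "W y * (real N * \<sigma>) powr \<beta> \<le> \<kappa>"
        using N\<delta> \<delta>1 W\<delta> [OF y] by linarith+
      have W0y: "0 \<le> W y" using W1 [of y] by linarith
      show "f y / 2 \<le> ?g y" "?g y \<le> 2 * f y"
        using quasi_density_bounds [OF T \<beta> \<sigma>(1) W0y w1 c \<kappa>(2) \<kappa>B [unfolded B_def]] by blast+
    qed
    have gnode: "0 \<le> ?g (real_of_int k * \<sigma> / q)"
      "?g (real_of_int k * \<sigma> / q) \<le> (2 * M) * exp (- (real_of_int k * \<sigma> / q)\<^sup>2)" if k: "k \<in> {-K..K}" for k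
      using gb [OF nodeK [OF k]] fpos [of "real_of_int k * h"] fM [of "real_of_int k * h"] unfolding node by linarith+
    have g0: "exp (- lp) / 2 \<le> ?g 0"
    proof -
      have "f 0 / 2 \<le> ?g 0" using A R1 by (intro gb) auto
      then show ?thesis using f0 by linarith
    qed
    have Qlow: "exp (- lp) / 2 / q * psi (x / \<sigma>) \<le> ?Q x" for x
      using \<sigma> q1 K0 g0 gnode by (intro grid_mixture_lower) auto
    have Qpos: "0 < ?Q x" for x
    proof -
      have "0 < exp (- lp) / 2 / q * psi (x / \<sigma>)" using q1 psi_pos by simp
      then show ?thesis using Qlow [of x] by linarith
    qed
    have \<sigma>2: "0 < \<sigma>\<^sup>2" "\<sigma>\<^sup>2 \<le> 1" using \<sigma> \<sigma>1 by (auto simp: power_le_one)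
    \<comment> \<open>The lower bound for the mixture carries a factor \<open>1 / q\<close>; this
      crude bound on \<open>q\<close> lets its logarithm disappear in a multiple of
      \<open>1 / \<sigma>^2\<close>.\<close>
    have q\<sigma>: "real q * \<sigma>\<^sup>2 \<le> 1"
    proof -
      have "H * l \<le> H1 * l" using H l1 by (intro mult_right_mono) auto
      then have "real q \<le> 12 * H1 * l + 1" using q by linarith
      then have "real q * \<sigma>\<^sup>2 \<le> (12 * H1 * l + 1) * \<sigma>\<^sup>2" using \<sigma>2 by (intro mult_right_mono) auto
      then show ?thesis using sm' by linarith
    qed
    have Qln: "- ln (?Q x) \<le> (lp + 4 + x\<^sup>2) / \<sigma>\<^sup>2" for x
    proof -
      have "ln (exp (- lp) / 2 / q * psi (x / \<sigma>)) \<le> ln (?Q x)"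
        using Qlow [of x] Qpos [of x] q1 psi_pos [of "x / \<sigma>"] by (intro ln_mono) auto
      moreover have "ln (exp (- lp) / 2 / q * psi (x / \<sigma>)) = - lp - ln (2 * real q * sqrt pi) - x\<^sup>2 / \<sigma>\<^sup>2"
      proof -
        have "exp (- lp) / 2 / q * psi (x / \<sigma>) = exp (- lp - x\<^sup>2 / \<sigma>\<^sup>2) / (2 * real q * sqrt pi)"
        proof -
          have "exp (- lp - x\<^sup>2 / \<sigma>\<^sup>2) = exp (- lp) * exp (- (x / \<sigma>)\<^sup>2)"
            by (simp add: power_divide flip: exp_add)
          then show ?thesis by (simp add: psi_def)
        qed
        then show ?thesis using q1 by (simp add: ln_div)
      qed
      moreover have "ln (2 * real q * sqrt pi) \<le> 4 * real q"
      proof -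
        have "sqrt pi \<le> 2" using pi_less_4 by (intro real_le_lsqrt) auto
        then have "2 * real q * sqrt pi \<le> 2 * real q * 2" by (intro mult_left_mono) auto
        moreover have "ln (2 * real q * sqrt pi) \<le> 2 * real q * sqrt pi - 1"
          using q1 by (intro ln_le_minus_one) auto
        ultimately show ?thesis by linarith
      qed
      ultimately have 1: "- ln (?Q x) \<le> lp + 4 * real q + x\<^sup>2 / \<sigma>\<^sup>2" by linarith
      have "lp * \<sigma>\<^sup>2 \<le> lp * 1" using \<sigma>2 pos by (intro mult_left_mono) auto
      then have "lp \<le> lp / \<sigma>\<^sup>2" using \<sigma>2 by (simp add: le_divide_eq)
      moreover have "4 * real q \<le> 4 / \<sigma>\<^sup>2" using q\<sigma> \<sigma>2 by (simp add: le_divide_eq)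
      ultimately have "- ln (?Q x) \<le> lp / \<sigma>\<^sup>2 + 4 / \<sigma>\<^sup>2 + x\<^sup>2 / \<sigma>\<^sup>2" using 1 by linarith
      then show ?thesis by (simp add: add_divide_distrib)
    qed
    have K\<sigma>: "(2 * real_of_int K + 1) / q \<le> 1 / \<sigma>\<^sup>2"
    proof -
      have "(2 * real_of_int K + 1) / q \<le> (2 * (A * R * real q / \<sigma>) + 1) / q"
        using Kle by (intro divide_right_mono) auto
      also have "\<dots> = 2 * (A * R) / \<sigma> + 1 / q" using q1 by (simp add: add_divide_distrib)
      also have "\<dots> \<le> 2 * (A1 * R) / \<sigma> + 1"
        using A R1 \<sigma> q1 by (intro add_mono divide_right_mono mult_left_mono mult_right_mono) auto
      also have "\<dots> = ((2 * A1 * R + \<sigma>) * \<sigma>) / \<sigma>\<^sup>2"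
        using \<sigma> by (simp add: power2_eq_square field_simps)
      also have "\<dots> \<le> 1 / \<sigma>\<^sup>2" using sm' \<sigma>2 by (intro divide_right_mono) auto
      finally show ?thesis .
    qed
    have Qup: "?Q x \<le> (2 * M) * exp (- x\<^sup>2 / 2) / \<sigma>\<^sup>2" for x
    proof -
      have "?Q x \<le> (2 * real_of_int K + 1) / q * ((2 * M) * exp (- x\<^sup>2 / 2))"
        using \<sigma> \<sigma>1 q1 K0 pos gnode by (intro grid_mixture_upper) auto
      also have "\<dots> \<le> 1 / \<sigma>\<^sup>2 * ((2 * M) * exp (- x\<^sup>2 / 2))"
        using K\<sigma> pos by (intro mult_right_mono) auto
      finally show ?thesis by simp
    qed
    have powr_exp: "\<sigma> powr c = exp (- (c * l))" for c using \<sigma> by (simp add: powr_def l_def)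
    have near: "\<bar>?Q x - f x\<bar> \<le> C2 * (1 + \<bar>x\<bar>) ^ d2 * (\<sigma> powr \<beta> * f x + \<sigma> powr (5 * \<beta> + 4) * exp (- x\<^sup>2))"
      if x: "\<bar>x\<bar> \<le> A * R - 1" for x
    proof -
      have xR: "\<bar>x\<bar> \<le> A * R" using x by linarith
      define E where "E = \<sigma> powr (5 * \<beta> + 4) * exp (- x\<^sup>2)"
      have E0: "0 \<le> E" by (simp add: E_def)
      have EH: "exp (- (H * l)) \<le> E"
      proof -
        have "\<bar>x\<bar>\<^sup>2 \<le> (A * R)\<^sup>2" using xR by (intro power_mono) auto
        moreover have "R\<^sup>2 = l" using R1(2) by (simp add: power2_eq_square)
        ultimately have "x\<^sup>2 \<le> A\<^sup>2 * l" by (simp add: power_mult_distrib)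
        then have "- (H * l) \<le> - ((5 * \<beta> + 4) * l) + - x\<^sup>2"
          by (simp add: H_def algebra_simps)
        then show ?thesis unfolding E_def powr_exp by (simp flip: exp_add)
      qed
      have l2: "4 * H * l \<le> l\<^sup>2" using mult_right_mono [OF l1(2), of l] l1 by (simp add: power2_eq_square)
      have Hl0: "0 \<le> H * l" using H l1 by simp
      have e1: "exp (- real q / 12) \<le> E" "exp (- l\<^sup>2 / 4) \<le> E" "exp (- l\<^sup>2 / 2) \<le> E"
      proof -
        have "- real q / 12 \<le> - (H * l)" "- l\<^sup>2 / 4 \<le> - (H * l)" "- l\<^sup>2 / 2 \<le> - (H * l)"
          using q l2 Hl0 by linarith+
        then show "exp (- real q / 12) \<le> E" "exp (- l\<^sup>2 / 4) \<le> E" "exp (- l\<^sup>2 / 2) \<le> E"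
          using EH by (meson exp_le_cancel_iff order_trans)+
      qed
      have W\<kappa>: "W x * \<delta> \<le> 1" "W x * \<delta> powr \<beta> \<le> 1" using W\<delta> [OF xR] \<kappa> by linarith+
      \<comment> \<open>The unit margin of the window covers both the reach
        \<open>\<sigma> * (l + 1)\<close> of the near nodes and the at most \<sigma> lost by
        rounding \<open>K\<close> down.\<close>
      have cov: "\<bar>x\<bar> + \<sigma> * (l + 1) \<le> real_of_int K * \<sigma> / q"
      proof -
        have "\<sigma> * (l + 1) + \<sigma> \<le> \<delta> + \<sigma>" using \<sigma> by (simp add: \<delta>_def algebra_simps)
        also have "\<dots> \<le> 1" using sm' unfolding \<delta>2 by simp
        finally show ?thesis using x Kh(2) unfolding node by linarith
      qed
      have "\<bar>?Q x - f x\<bar> \<le> A0 * (f x * (W x ^ Suc r * \<sigma> powr \<beta> + W x ^ r * (exp (- real q / 12) + exp (- l\<^sup>2 / 4))) + M * exp (- l\<^sup>2 / 2))"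
        using T W1 \<beta> \<beta>r fM1 q1 \<sigma> l1 \<delta>1 W\<kappa> cov unfolding \<delta>_def b1_def by (intro loc) auto
      also have "\<dots> \<le> A0 * ((1 + 3 * M) * W x ^ Suc r * (\<sigma> powr \<beta> * f x + E))"
      proof (intro mult_left_mono A0)
        define V where "V = W x ^ Suc r"
        have Wr0: "0 \<le> W x ^ r" by (intro zero_le_power order_trans [OF zero_le_one W1])
        have V1: "1 \<le> V" unfolding V_def by (intro one_le_power W1)
        have Vr: "W x ^ r \<le> V" unfolding V_def by (intro power_increasing W1) auto
        have t1: "f x * (W x ^ r * (exp (- real q / 12) + exp (- l\<^sup>2 / 4))) \<le> M * (V * (2 * E))"
          using fM1 [of x] fpos [of x] e1 Vr V1 E0 pos Wr0
          by (intro mult_mono) (auto intro: less_imp_le intro!: mult_nonneg_nonneg add_nonneg_nonneg)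
        have t2: "M * exp (- l\<^sup>2 / 2) \<le> M * (V * E)"
        proof (intro mult_left_mono)
          have "1 * E \<le> V * E" using V1 E0 by (intro mult_right_mono) auto
          then show "exp (- l\<^sup>2 / 2) \<le> V * E" using e1 by linarith
        qed (use pos in auto)
        have t3: "0 \<le> V * E" "0 \<le> 3 * M * (V * (\<sigma> powr \<beta> * f x))"
          using V1 E0 pos fpos [of x] by (auto intro!: mult_nonneg_nonneg intro: less_imp_le)
        have "f x * (V * \<sigma> powr \<beta> + W x ^ r * (exp (- real q / 12) + exp (- l\<^sup>2 / 4))) + M * exp (- l\<^sup>2 / 2)
            \<le> V * (\<sigma> powr \<beta> * f x) + 3 * M * (V * E)"
          using t1 t2 by (simp add: algebra_simps)
        also have "\<dots> \<le> (1 + 3 * M) * V * (\<sigma> powr \<beta> * f x + E)"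
          using t3 by (simp add: algebra_simps)
        finally show "f x * (W x ^ Suc r * \<sigma> powr \<beta> + W x ^ r * (exp (- real q / 12) + exp (- l\<^sup>2 / 4))) + M * exp (- l\<^sup>2 / 2)
            \<le> (1 + 3 * M) * W x ^ Suc r * (\<sigma> powr \<beta> * f x + E)" unfolding V_def .
      qed
      also have "\<dots> = C2 * (1 + \<bar>x\<bar>) ^ d2 * (\<sigma> powr \<beta> * f x + E)"
      proof -
        have "W x ^ Suc r = W0 ^ Suc r * (1 + \<bar>x\<bar>) ^ d2"
          unfolding W_def power_mult_distrib d2_def power_mult ..
        then show ?thesis unfolding C2_def by (simp add: mult_ac)
      qed
      finally show ?thesis unfolding E_def .
    qed
    have small: "C2 * (1 + \<bar>x\<bar>) ^ d2 * (2 * \<sigma> powr \<beta>) \<le> 1 / 2" if x: "\<bar>x\<bar> \<le> A * R - 1" for x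
    proof -
      have "\<sigma> * 1 \<le> \<delta>" unfolding \<delta>_def using \<sigma> l1 by (intro mult_left_mono) auto
      then have "\<sigma> powr \<beta> \<le> \<delta> powr \<beta>" using \<sigma> \<beta> by (intro powr_mono2) auto
      then have s: "\<sigma> powr \<beta> \<le> \<delta> powr b" using \<delta>b by linarith
      have "(1 + \<bar>x\<bar>) ^ d2 \<le> (1 + A1 * R) ^ d2" using x by (intro grow) linarith
      then have "C2 * ((1 + \<bar>x\<bar>) ^ d2 * \<sigma> powr \<beta>) \<le> C2 * ((1 + A1 * R) ^ d2 * \<delta> powr b)"
        using s C20 A10 R1 by (intro mult_left_mono mult_mono) auto
      then show ?thesis using sm' by (simp add: \<delta>_def)
    qed
    define Z where "Z = (\<Sum>k\<in>{-K..K}. \<sigma> / q * ?g (real_of_int k * \<sigma> / q))"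
    have Qint: "has_bochner_integral lborel ?Q Z"
      unfolding Z_def by (rule grid_mixture_integral [OF \<sigma>(1)])
    have Zpos: "0 < Z"
    proof -
      have "0 < \<sigma> / q * ?g (real_of_int 0 * \<sigma> / q)" using g0 \<sigma> q1 exp_gt_zero [of "- lp"] by (simp del: exp_gt_zero)
      also have "\<dots> \<le> Z" unfolding Z_def
        using \<sigma> K0 gnode by (intro member_le_sum [of 0 "{-K..K}" "\<lambda>k. \<sigma> / q * ?g (real_of_int k * \<sigma> / q)"]) auto
      finally show ?thesis .
    qed
    have Qmeas: "?Q \<in> borel_measurable borel"
      using Qint by (auto simp: has_bochner_integral_iff dest: borel_measurable_integrable)
    have kl_int: "integrable lborel (\<lambda>x. f x * ln (f x / ?Q x))"
    proof (rule integrable_kl_integrand [OF fmeas Qmeas fpos fM lnf Qpos])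
      show "- ln (?Q x) \<le> (lp + 4) / \<sigma>\<^sup>2 + 1 / \<sigma>\<^sup>2 * x\<^sup>2" for x
        using Qln [of x] by (simp add: add_divide_distrib)
      show "?Q x \<le> (2 * M) / \<sigma>\<^sup>2" for x
      proof -
        have "(2 * M) * exp (- x\<^sup>2 / 2) / \<sigma>\<^sup>2 \<le> (2 * M) * 1 / \<sigma>\<^sup>2"
          using pos by (intro divide_right_mono mult_left_mono) auto
        then show ?thesis using Qup [of x] by simp
      qed
    qed (use pos W01 in auto)
    define Bd where "Bd x = C7 * \<sigma> powr (2 * \<beta>) * ((fact (2 * d2 + 2) * exp 3) * exp (- x\<^sup>2 / 8))" for x :: real
    have Bd: "f x * ln (f x / ?Q x) + ?Q x - f x \<le> Bd x" for x
    proof -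
      have "f x * ln (f x / ?Q x) + ?Q x - f x \<le> C7 * \<sigma> powr (2 * \<beta>) * ((1 + \<bar>x\<bar>) ^ (2 * d2 + 2) * exp (- x\<^sup>2 / 4))"
        unfolding C7_def
        using near [of x] small [of x] \<sigma> \<sigma>1 l1 \<beta> fpos fM pos sm' C20 Qpos Qln Qup
        by (intro kl_integrand_le [where \<kappa> = l]) (auto simp: l_def [symmetric] R_def [symmetric] A_def [symmetric])
      also have "\<dots> \<le> Bd x"
        unfolding Bd_def using C70 by (intro mult_left_mono poly_growth_mult_gauss_le) auto
      finally show ?thesis .
    qed
    have Bdi: "integrable lborel Bd" "integral\<^sup>L lborel Bd \<le> c0 * \<sigma> powr (2 * \<beta>)"
    proof -
      show "integrable lborel Bd"
        unfolding Bd_def [abs_def] by (intro integrable_mult_right integrable_exp_sq_eighth)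
      have "integral\<^sup>L lborel Bd = (c0 - 1) * \<sigma> powr (2 * \<beta>)"
        unfolding Bd_def [abs_def] c0_def J_def by simp
      also have "\<dots> \<le> c0 * \<sigma> powr (2 * \<beta>)" by (intro mult_right_mono) auto
      finally show "integral\<^sup>L lborel Bd \<le> c0 * \<sigma> powr (2 * \<beta>)" .
    qed
    note kl = kl_normalized_le [OF fint fpos Qint Qpos Zpos kl_int Bdi(1) Bd]
    define p where "p k = \<sigma> / q * ?g (real_of_int k * \<sigma> / q) / Z" for k :: int
    have mix: "(\<Sum>k\<in>{-K..K}. p k * psi_s \<sigma> (x - real_of_int k * \<sigma> / q)) = ?Q x / Z" for x
      unfolding grid_mixture_def sum_divide_distrib by (intro sum.cong refl) (simp add: p_def)
    have labs: "\<bar>ln \<sigma>\<bar> = l" using \<sigma> \<sigma>1 by (simp add: l_def)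
    have Rp: "\<bar>ln \<sigma>\<bar> powr (1 / 2) = R" "\<bar>ln \<sigma>\<bar> powr (3 / 2) = l * R"
    proof -
      show 1: "\<bar>ln \<sigma>\<bar> powr (1 / 2) = R" unfolding labs R_def using l1 by (simp add: powr_half_sqrt)
      have "l powr (3 / 2) = l powr (1 + 1 / 2)" by simp
      also have "\<dots> = l * l powr (1 / 2)" using l1 by (simp only: powr_add) simp
      finally show "\<bar>ln \<sigma>\<bar> powr (3 / 2) = l * R" using 1 unfolding labs by simp
    qed
    show ?thesis
      unfolding Rp A_def [symmetric] H_def [symmetric]
    proof (rule mixture_approximableI [OF K0, where p = p and \<mu> = "\<lambda>k. real_of_int k * \<sigma> / q"])
      show "0 \<le> p k" if "k \<in> {-K..K}" for k using gnode [OF that] \<sigma> Zpos by (simp add: p_def)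
      show "\<bar>real_of_int k * \<sigma> / q\<bar> \<le> A * R" if "k \<in> {-K..K}" for k using nodeK [OF that] unfolding node .
      show "(\<Sum>k\<in>{-K..K}. p k) = 1"
        unfolding p_def sum_divide_distrib [symmetric] Z_def [symmetric] using Zpos by simp
      show "2 * real_of_int K + 1 < (2 * A * (12 * H + 1) + 2) * (1 / \<sigma>) * (l * R)"
      proof -
        \<comment> \<open>The node count is of order \<open>A * R * q / \<sigma>\<close> with
          \<open>q \<le> (12 * H + 1) * l\<close>, hence the power 3/2 of the logarithm; the extra
          \<open>2 * X\<close> absorbs the 1 and makes the inequality strict.\<close>
        define X where "X = 1 / \<sigma> * (l * R)"
        have "1 * 1 \<le> l * R" using l1 R1 by (intro mult_mono) auto
        then have "1 * 1 \<le> X" unfolding X_def using \<sigma> \<sigma>1 by (intro mult_mono) auto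
        then have X1: "1 \<le> X" by simp
        have "real q \<le> (12 * H + 1) * l" using q l1 by (simp add: algebra_simps)
        then have "2 * (A * R * real q / \<sigma>) \<le> 2 * (A * R * ((12 * H + 1) * l) / \<sigma>)"
          using A R1 \<sigma> by (intro mult_left_mono divide_right_mono) auto
        also have "\<dots> = 2 * A * (12 * H + 1) * X" by (simp add: X_def)
        finally have "2 * real_of_int K + 1 < 2 * A * (12 * H + 1) * X + 2 * X" using Kle(1) X1 by linarith
        then show ?thesis by (simp add: X_def algebra_simps)
      qed
      show "integrable lborel (\<lambda>x. f x * ln (f x / (\<Sum>k\<in>{-K..K}. p k * psi_s \<sigma> (x - real_of_int k * \<sigma> / q))))"
        unfolding mix by (rule kl(1))
      show "(\<integral>x. f x * ln (f x / (\<Sum>k\<in>{-K..K}. p k * psi_s \<sigma> (x - real_of_int k * \<sigma> / q))) \<partial>lborel) \<le> c0 * \<sigma> powr (2 * \<beta>)"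
        unfolding mix using kl(2) Bdi(2) by linarith
    qed
  qed
  moreover have "0 < s0" "s0 < 1" using s1 by (auto simp: s0_def)
  ultimately show ?thesis using c0 by blast
qed

lemma mixture_approximable_mono:
  assumes "mixture_approximable f \<sigma> m R \<kappa>" "\<kappa> \<le> \<kappa>'"
  shows "mixture_approximable f \<sigma> m R \<kappa>'"
  using assms unfolding mixture_approximable_def Let_def by (blast intro: order_trans)

section \<open>Dependence of the constants on the smoothness\<close>

text \<open>A sum of ramps: the i-th rises from 0 at \<open>i - 2\<close> to \<open>c i\<close> at
  \<open>i - 1\<close>. Near any point only finitely many are nonzero, and at \<open>t\<close> the
  ramp with index \<open>nat \<lceil>t\<rceil>\<close> has already reached its full height.\<close>

lemma exists_continuous_majorant:
  fixes c :: "nat \<Rightarrow> real"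
  assumes "\<And>n. 0 \<le> c n"
  obtains F where "continuous_on UNIV F" "\<And>t::real. 0 \<le> F t" "\<And>t. 0 \<le> t \<Longrightarrow> c (nat \<lceil>t\<rceil>) \<le> F t"
proof -
  define \<phi> where "\<phi> i t = c i * min 1 (max 0 (t - real i + 2))" for i and t :: real
  define F where "F t = (\<Sum>i\<le>nat \<lceil>t\<rceil> + 2. \<phi> i t)" for t
  have \<phi>0: "0 \<le> \<phi> i t" for i t using assms by (simp add: \<phi>_def)
  have F_eq: "F t = (\<Sum>i\<le>m. \<phi> i t)" if "nat \<lceil>t\<rceil> + 2 \<le> m" for t m
    unfolding F_def
  proof (rule sum.mono_neutral_left)
    show "\<forall>i\<in>{..m} - {..nat \<lceil>t\<rceil> + 2}. \<phi> i t = 0"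
    proof
      fix i assume "i \<in> {..m} - {..nat \<lceil>t\<rceil> + 2}"
      then have "nat \<lceil>t\<rceil> + 2 < i" by auto
      then have "t - real i + 2 \<le> 0" by linarith
      then show "\<phi> i t = 0" by (simp add: \<phi>_def)
    qed
  qed (use that in auto)
  have cont: "isCont F t0" for t0
  proof -
    define m where "m = nat \<lceil>t0 + 1\<rceil> + 2"
    have "t0 < t0 + 1" by linarith
    then have "\<forall>\<^sub>F t in nhds t0. t < t0 + 1"
      using eventually_nhds_in_open [of "{..<t0 + 1}" t0] by simp
    then have ev: "\<forall>\<^sub>F t in nhds t0. F t = (\<Sum>i\<le>m. \<phi> i t)"
    proof (rule eventually_mono)
      fix t assume "t < t0 + 1"
      then have "nat \<lceil>t\<rceil> + 2 \<le> m" unfolding m_def by (intro add_mono nat_mono ceiling_mono) auto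
      then show "F t = (\<Sum>i\<le>m. \<phi> i t)" by (rule F_eq)
    qed
    have "isCont (\<lambda>t. \<Sum>i\<le>m. \<phi> i t) t0"
      unfolding \<phi>_def by (intro continuous_intros)
    then show ?thesis using isCont_cong [OF ev] by simp
  qed
  show ?thesis
  proof
    show "continuous_on UNIV F" using cont by (simp add: continuous_at_imp_continuous_on)
    show "0 \<le> F t" for t unfolding F_def by (intro sum_nonneg \<phi>0)
    show "c (nat \<lceil>t\<rceil>) \<le> F t" if "0 \<le> t" for t
    proof -
      have "1 \<le> t - real (nat \<lceil>t\<rceil>) + 2" using that by linarith
      then have "c (nat \<lceil>t\<rceil>) = \<phi> (nat \<lceil>t\<rceil>) t" by (simp add: \<phi>_def)
      also have "\<dots> \<le> F t" unfolding F_def by (rule member_le_sum) (simp_all only: atMost_iff le_add1 \<phi>0 finite_atMost)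
      finally show ?thesis .
    qed
  qed
qed

theorem theorem2:
  fixes \<gamma> lp \<epsilon> C \<alpha> \<xi> M :: real and L :: "real poly"
  assumes "0 < \<gamma>" "0 < lp" "0 < \<epsilon>" "0 < C" "0 < \<alpha>" "0 < \<xi>" "0 < M"
  shows "\<exists>sbar c G Gt :: real \<Rightarrow> real.
    (\<forall>\<beta> > 0. 0 < sbar \<beta> \<and> sbar \<beta> < 1 \<and> 0 < c \<beta> \<and> 0 < G \<beta> \<and> 0 < Gt \<beta>) \<and>
    continuous_on {0<..} sbar \<and> continuous_on {0<..} c \<and>
    strict_mono_on {0<..} G \<and> strict_mono_on {0<..} Gt \<and>
    (\<forall>\<beta> > 0. \<forall>f \<in> Hclass \<beta> \<gamma> lp L \<epsilon> C \<alpha> \<xi> M. \<forall>\<sigma>. 0 < \<sigma> \<and> \<sigma> < sbar \<beta> \<longrightarrow>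
      (\<exists>m' :: nat. \<exists>p \<mu> :: nat \<Rightarrow> real. \<exists>\<mu>\<sigma> :: real.
         (\<forall>u \<in> {1..m'}. 0 \<le> p u \<and> \<mu> u \<in> {-\<mu>\<sigma>..\<mu>\<sigma>}) \<and>
         (\<Sum>u = 1..m'. p u) = 1 \<and>
         real m' < G \<beta> * (1 / \<sigma>) * \<bar>ln \<sigma>\<bar> powr (3/2) \<and>
         \<mu>\<sigma> \<le> Gt \<beta> * \<bar>ln \<sigma>\<bar> powr (1/2) \<and>
         (let wp = (\<lambda>x. \<Sum>u = 1..m'. p u * psi_s \<sigma> (x - \<mu> u)) in
            integrable lborel (\<lambda>x. f x * ln (f x / wp x)) \<and>
            (\<integral>x. f x * ln (f x / wp x) \<partial>lborel) \<le> c \<beta> * \<sigma> powr (2 * \<beta>))))"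
proof -
  define rate where "rate \<beta> = 2 * (4 * \<beta> + 8) * (12 * ((4 * \<beta> + 8)\<^sup>2 + 5 * \<beta> + 4) + 1) + 2" for \<beta> :: real
  \<comment> \<open>\<open>z = (r, n)\<close> encodes the order and the lower bound
    \<open>1 / (n + 1)\<close> on \<beta>, so only countably many pairs of constants have to be
    dominated.\<close>
  have "\<forall>z :: nat \<times> nat. \<exists>y :: real \<times> real. 0 < fst y \<and> fst y < 1 \<and> 0 < snd y \<and>
    (\<forall>\<beta> f \<sigma>. 1 / (real (snd z) + 1) \<le> \<beta> \<longrightarrow> rr \<beta> = fst z \<longrightarrow> f \<in> Hclass \<beta> \<gamma> lp L \<epsilon> C \<alpha> \<xi> M \<longrightarrow>
      0 < \<sigma> \<longrightarrow> \<sigma> < fst y \<longrightarrow>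
      mixture_approximable f \<sigma> (rate \<beta> * (1 / \<sigma>) * \<bar>ln \<sigma>\<bar> powr (3 / 2))
        ((4 * \<beta> + 8) * \<bar>ln \<sigma>\<bar> powr (1 / 2)) (snd y * \<sigma> powr (2 * \<beta>)))"
  proof
    fix z :: "nat \<times> nat"
    have "0 < 1 / (real (snd z) + 1)" by simp
    from Hclass_mixture_approximable [OF assms(1,2,7) this, of "fst z" L \<epsilon> C \<alpha> \<xi>]
    obtain s0 c0 where "0 < s0 \<and> s0 < 1 \<and> 0 < c0 \<and>
      (\<forall>\<beta> f \<sigma>. 1 / (real (snd z) + 1) \<le> \<beta> \<longrightarrow> rr \<beta> = fst z \<longrightarrow> f \<in> Hclass \<beta> \<gamma> lp L \<epsilon> C \<alpha> \<xi> M \<longrightarrow>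
        0 < \<sigma> \<longrightarrow> \<sigma> < s0 \<longrightarrow>
        mixture_approximable f \<sigma> (rate \<beta> * (1 / \<sigma>) * \<bar>ln \<sigma>\<bar> powr (3 / 2))
          ((4 * \<beta> + 8) * \<bar>ln \<sigma>\<bar> powr (1 / 2)) (c0 * \<sigma> powr (2 * \<beta>)))"
      unfolding rate_def by blast
    then show "\<exists>y :: real \<times> real. 0 < fst y \<and> fst y < 1 \<and> 0 < snd y \<and>
      (\<forall>\<beta> f \<sigma>. 1 / (real (snd z) + 1) \<le> \<beta> \<longrightarrow> rr \<beta> = fst z \<longrightarrow> f \<in> Hclass \<beta> \<gamma> lp L \<epsilon> C \<alpha> \<xi> M \<longrightarrow>
        0 < \<sigma> \<longrightarrow> \<sigma> < fst y \<longrightarrow>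
        mixture_approximable f \<sigma> (rate \<beta> * (1 / \<sigma>) * \<bar>ln \<sigma>\<bar> powr (3 / 2))
          ((4 * \<beta> + 8) * \<bar>ln \<sigma>\<bar> powr (1 / 2)) (snd y * \<sigma> powr (2 * \<beta>)))"
      by (intro exI [of _ "(s0, c0)"], unfold fst_conv snd_conv)
  qed
  from choice [OF this] obtain y :: "nat \<times> nat \<Rightarrow> real \<times> real" where y: "\<And>z. 0 < fst (y z)" "\<And>z. 0 < snd (y z)"
    and approx: "\<And>z \<beta> f \<sigma>. 1 / (real (snd z) + 1) \<le> \<beta> \<Longrightarrow> rr \<beta> = fst z \<Longrightarrow> f \<in> Hclass \<beta> \<gamma> lp L \<epsilon> C \<alpha> \<xi> M \<Longrightarrow>
      0 < \<sigma> \<Longrightarrow> \<sigma> < fst (y z) \<Longrightarrow>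
      mixture_approximable f \<sigma> (rate \<beta> * (1 / \<sigma>) * \<bar>ln \<sigma>\<bar> powr (3 / 2))
        ((4 * \<beta> + 8) * \<bar>ln \<sigma>\<bar> powr (1 / 2)) (snd (y z) * \<sigma> powr (2 * \<beta>))"
    by blast
  \<comment> \<open>The reciprocal turns the lower bound needed for the scale into an upper bound,
    so that one majorant serves both constants, for all orders up to \<open>n\<close>.\<close>
  define K where "K n = (\<Sum>r\<le>n. snd (y (r, n)) + 1 / fst (y (r, n)))" for n
  have term_nonneg: "0 \<le> snd (y z) + 1 / fst (y z)" for z
    using y [of z] by (simp add: less_imp_le)
  have "0 \<le> K n" for n unfolding K_def by (intro sum_nonneg term_nonneg)
  then obtain F where F: "continuous_on UNIV F" "\<And>t::real. 0 \<le> F t" "\<And>t. 0 \<le> t \<Longrightarrow> K (nat \<lceil>t\<rceil>) \<le> F t"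
    using exists_continuous_majorant by blast
  \<comment> \<open>Bounds \<beta> and \<open>1 / \<beta>\<close> at once: with
    \<open>n = nat \<lceil>t \<beta>\<rceil>\<close> the order \<open>rr \<beta>\<close> is at most
    \<open>n\<close> and \<beta> is at least \<open>1 / (n + 1)\<close>.\<close>
  define t where "t \<beta> = \<beta> + 1 / \<beta>" for \<beta> :: real
  have Ft: "continuous_on {0<..} (\<lambda>\<beta>. F (t \<beta>))"
  proof (rule continuous_on_compose2 [OF F(1)])
    show "continuous_on {0<..} t" unfolding t_def by (intro continuous_intros) auto
  qed simp
  \<comment> \<open>The 2 keeps the value below 1 even where \<open>F\<close> vanishes; the 1 in the
    next constant keeps that one positive.\<close>
  have sbar: "continuous_on {0<..} (\<lambda>\<beta>. 1 / (2 + F (t \<beta>)))"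
  proof (intro continuous_intros Ft ballI)
    show "2 + F (t \<beta>) \<noteq> 0" for \<beta> using F(2) [of "t \<beta>"] by linarith
  qed
  have c: "continuous_on {0<..} (\<lambda>\<beta>. 1 + F (t \<beta>))" by (intro continuous_intros Ft)
  have rate_mono: "strict_mono_on {0<..} rate"
  proof (rule strict_mono_onI)
    fix a b :: real assume ab: "a \<in> {0<..}" "b \<in> {0<..}" "a < b"
    have "(4 * a + 8)\<^sup>2 < (4 * b + 8)\<^sup>2" using ab by (intro power_strict_mono) auto
    then have lt: "12 * ((4 * a + 8)\<^sup>2 + 5 * a + 4) + 1 < 12 * ((4 * b + 8)\<^sup>2 + 5 * b + 4) + 1" using ab by simp
    have "0 \<le> (4 * a + 8)\<^sup>2" by simp
    then have nn: "0 \<le> 12 * ((4 * a + 8)\<^sup>2 + 5 * a + 4) + 1" using ab by simp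
    have le: "2 * (4 * a + 8) < 2 * (4 * b + 8)" "0 < 2 * (4 * b + 8)" using ab by auto
    have "2 * (4 * a + 8) * (12 * ((4 * a + 8)\<^sup>2 + 5 * a + 4) + 1)
        < 2 * (4 * b + 8) * (12 * ((4 * b + 8)\<^sup>2 + 5 * b + 4) + 1)"
      by (rule mult_strict_mono [OF le(1) lt le(2) nn])
    then show "rate a < rate b" by (simp add: rate_def)
  qed
  have radius_mono: "strict_mono_on {0<..} (\<lambda>\<beta>::real. 4 * \<beta> + 8)"
    by (rule strict_mono_onI) simp
  have rate_pos: "0 < rate \<beta>" if "0 < \<beta>" for \<beta>
    using that by (simp add: rate_def add_pos_pos)
  have main: "mixture_approximable f \<sigma> (rate \<beta> * (1 / \<sigma>) * \<bar>ln \<sigma>\<bar> powr (3 / 2))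
        ((4 * \<beta> + 8) * \<bar>ln \<sigma>\<bar> powr (1 / 2)) ((1 + F (t \<beta>)) * \<sigma> powr (2 * \<beta>))"
    if \<beta>: "0 < \<beta>" and f: "f \<in> Hclass \<beta> \<gamma> lp L \<epsilon> C \<alpha> \<xi> M" and \<sigma>: "0 < \<sigma>" "\<sigma> < 1 / (2 + F (t \<beta>))" for \<beta> f \<sigma>
  proof -
    define n where "n = nat \<lceil>t \<beta>\<rceil>"
    have t0: "0 \<le> t \<beta>" using \<beta> by (simp add: t_def)
    have tn: "t \<beta> \<le> real n" unfolding n_def by linarith
    have rn: "rr \<beta> \<le> n"
    proof -
      have "\<beta> \<le> t \<beta>" using \<beta> by (simp add: t_def)
      then have "real (rr \<beta>) < real n" using rr_eqD(1) [OF \<beta> refl] tn by linarith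
      then show ?thesis by simp
    qed
    have bn: "1 / (real n + 1) \<le> \<beta>"
    proof -
      have "1 / \<beta> \<le> real n + 1" using \<beta> tn by (simp add: t_def)
      then show ?thesis using \<beta> by (simp add: field_simps)
    qed
    define z where "z = (rr \<beta>, n)"
    have "snd (y z) + 1 / fst (y z) \<le> K n"
      unfolding K_def z_def using rn term_nonneg
      by (intro member_le_sum [of "rr \<beta>" "{..n}" "\<lambda>r. snd (y (r, n)) + 1 / fst (y (r, n))"]) auto
    then have yF: "snd (y z) + 1 / fst (y z) \<le> F (t \<beta>)" using F(3) [OF t0] unfolding n_def by linarith
    have "1 / fst (y z) \<le> 2 + F (t \<beta>)" using yF y(2) [of z] by linarith
    then have "1 / (2 + F (t \<beta>)) \<le> fst (y z)"
      using y(1) [of z] F(2) [of "t \<beta>"] by (simp add: divide_le_eq pos_divide_le_eq mult.commute)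
    then have "mixture_approximable f \<sigma> (rate \<beta> * (1 / \<sigma>) * \<bar>ln \<sigma>\<bar> powr (3 / 2))
        ((4 * \<beta> + 8) * \<bar>ln \<sigma>\<bar> powr (1 / 2)) (snd (y z) * \<sigma> powr (2 * \<beta>))"
      using f \<sigma> bn by (intro approx) (auto simp: z_def)
    moreover have "snd (y z) * \<sigma> powr (2 * \<beta>) \<le> (1 + F (t \<beta>)) * \<sigma> powr (2 * \<beta>)"
    proof (rule mult_right_mono)
      have "0 < 1 / fst (y z)" using y(1) [of z] by simp
      then show "snd (y z) \<le> 1 + F (t \<beta>)" using yF by linarith
    qed simp
    ultimately show ?thesis by (rule mixture_approximable_mono)
  qed
  have positive: "\<forall>\<beta>>0. 0 < 1 / (2 + F (t \<beta>)) \<and> 1 / (2 + F (t \<beta>)) < 1 \<and> 0 < 1 + F (t \<beta>) \<and> 0 < rate \<beta> \<and> 0 < 4 * \<beta> + 8"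
  proof (intro allI impI)
    fix \<beta> :: real assume "0 < \<beta>"
    then show "0 < 1 / (2 + F (t \<beta>)) \<and> 1 / (2 + F (t \<beta>)) < 1 \<and> 0 < 1 + F (t \<beta>) \<and> 0 < rate \<beta> \<and> 0 < 4 * \<beta> + 8"
      using F(2) [of "t \<beta>"] rate_pos by (simp add: add_pos_nonneg)
  qed
  have approximable: "\<forall>\<beta>>0. \<forall>f\<in>Hclass \<beta> \<gamma> lp L \<epsilon> C \<alpha> \<xi> M. \<forall>\<sigma>. 0 < \<sigma> \<and> \<sigma> < 1 / (2 + F (t \<beta>)) \<longrightarrow>
      mixture_approximable f \<sigma> (rate \<beta> * (1 / \<sigma>) * \<bar>ln \<sigma>\<bar> powr (3 / 2))
        ((4 * \<beta> + 8) * \<bar>ln \<sigma>\<bar> powr (1 / 2)) ((1 + F (t \<beta>)) * \<sigma> powr (2 * \<beta>))"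
    using main by blast
  show ?thesis
    by (rule exI [of _ "\<lambda>\<beta>. 1 / (2 + F (t \<beta>))"], rule exI [of _ "\<lambda>\<beta>. 1 + F (t \<beta>)"], rule exI [of _ rate],
        rule exI [of _ "\<lambda>\<beta>. 4 * \<beta> + 8"],
        intro conjI positive sbar c rate_mono radius_mono approximable [unfolded mixture_approximable_def])
qed

end
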